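(* Let $\mathbf z_1,\dots,\mathbf z_n$ be a random sample from the distribution of a random vector $\mathbf z\in\mathbb R^p$ with mutually independent components having mean $0$ and variance $1$. Notation is as in the context; in particular $\hat{\mathbf V}$ denotes the sample standardizing matrix, and in each part it is assumed that $\sqrt n(\hat{\mathbf V}-\mathbf I_p)=O_P(1)$. (i) Suppose $\mathbf z$ has finite sixth moments and $\gamma_1,\dots,\gamma_p$ are distinct. Then for $\alpha=1$ there is a sequence of compound cumulant solutions $\hat{\mathbf W}\to_P\mathbf I_p$ such that the limiting distribution of $\sqrt n\,\mathrm{vec}(\hat{\mathbf W}-\mathbf I_p)$ is multivariate normal with mean vector $\mathbf 0$ and asymptotic variances $$ASV(\hat w_{kk})=\frac{\kappa_k+2}{4},\qquad ASV(\hat w_{kl})=\frac{\zeta_{11}}{(\gamma_k-\gamma_l)^2},\quad k\ne l,$$ where $\zeta_{11}=(\nu_k-\gamma_k^2)+(\nu_l-\gamma_l^2)+\gamma_l^2+(p-2)$. (ii) Suppose $\mathbf z$ has finite eighth moments and $\kappa_1,\dots,\kappa_p$ are distinct. Then for $\alpha=0$ there is a sequence of compound cumulant solutions $\hat{\mathbf W}\to_P\mathbf I_p$ such that the limiting distribution of $\sqrt n\,\mathrm{vec}(\hat{\mathbf W}-\mathbf I_p)$ is multivariate normal with mean vector $\mathbf 0$ and asymptotic variances $$ASV(\hat w_{kk})=\frac{\kappa_k+2}{4},\qquad ASV(\hat w_{kl})=\frac{\zeta_{22}}{(\kappa_k-\kappa_l)^2},\quad k\ne l,$$ where $\zeta_{22}=(\omega_k-\beta_k^2)+(\omega_l-\beta_l^2)+\kappa_l^2+\sum_{m\ne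 k,l}(\beta_m-1)$. (iii) Suppose $\mathbf z$ has finite eighth moments and there is no pair $k\ne l$ with $\gamma_k=\gamma_l$ and $\kappa_k=\kappa_l$. Then there is a sequence of compound cumulant solutions $\hat{\mathbf W}\to_P\mathbf I_p$ based on both skewness and kurtosis such that the limiting distribution of $\sqrt n\,\mathrm{vec}(\hat{\mathbf W}-\mathbf I_p)$ is multivariate normal with mean vector $\mathbf 0$ and asymptotic variances $$ASV(\hat w_{kk})=\frac{\kappa_k+2}{4},\qquad ASV(\hat w_{kl})=\frac{\alpha^2\delta_{1kl}^2\zeta_{11}+(1-\alpha)^2\delta_{2kl}^2\zeta_{22}+2\alpha(1-\alpha)\delta_{1kl}\delta_{2kl}\zeta_{12}}{(\alpha\delta_{1kl}^2+(1-\alpha)\delta_{2kl}^2)^2},\quad k\ne l,$$ where $\delta_{1kl}=\gamma_k-\gamma_l$, $\delta_{2kl}=\kappa_k-\kappa_l$, $\alpha\in[0,1]$ is the proportion of weight given to skewness, $\zeta_{11},\zeta_{22}$ are as in (i), (ii), and $\zeta_{12}=(\eta_k-\gamma_k\beta_k)+(\eta_l-\gamma_l\beta_l)+\gamma_l\kappa_l+\sum_{m\ne k,l}\gamma_m$.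
   Context: Moments, with $z_k$ the $k$th component of $\mathbf z$: $\gamma_k=E(z_k^3)$, $\beta_k=E(z_k^4)$, $\kappa_k=\beta_k-3$, $\omega_k=E(z_k^6)-E(z_k^3)^2$, $\nu_k=E(z_k^4)-1$, $\eta_k=E(z_k^5)-E(z_k^3)$. $ASV(\hat w_{kl})$ denotes the variance of the $(k,l)$ coordinate of the limiting distribution of $\sqrt n(\hat{\mathbf W}-\mathbf I_p)$ as $n\to\infty$. Cumulant matrices: for a random $p$-vector $\mathbf x$ with mean zero, $\mathbf C^{3i}(\mathbf x)=E[x_i\mathbf x\mathbf x^T]$, $\mathbf C^{4ij}(\mathbf x)=E[x_ix_j\mathbf x\mathbf x^T]-E(x_ix_j)E(\mathbf x\mathbf x^T)-E(x_i\mathbf x)E(x_j\mathbf x^T)-E(x_j\mathbf x)E(x_i\mathbf x^T)$, and the compound cumulant matrices are $\mathbf C^3(\mathbf x)=\sum_{i=1}^p\mathbf C^{3i}(\mathbf x)$, $\mathbf C^4(\mathbf x)=\sum_{i=1}^p\mathbf C^{4ii}(\mathbf x)$. Compound cumulant estimate: let $\bar{\mathbf z}=\frac1n\sum_i\mathbf z_i$ and $\hat{\boldsymbol\Sigma}=\frac1n\sum_i(\mathbf z_i-\bar{\mathbf z})(\mathbf z_i-\bar{\mathbf z})^T$ (nonsingular with probability tending to one). The data are first standardized by the sample version $\hat{\mathbf V}=\hat{\mathbf U}^*\hat{\boldsymbol\Sigma}^{-1/2}$, with $\hat{\mathbf U}^*$ orthogonal, of an arbitrary independent component functional $(\boldsymbol\Sigma^*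 )^{-1/2}=\mathbf U^*\boldsymbol\Sigma^{-1/2}$ ($\mathbf U^*$ orthogonal, $\boldsymbol\Sigma$ the covariance matrix); an independent component functional is an affine equivariant functional (up to permutation and sign changes of rows) that transforms $\mathbf x$ to independent components whenever $\mathbf x=\boldsymbol\mu+\boldsymbol\Omega\mathbf z$ with $\boldsymbol\Omega$ nonsingular and $\mathbf z$ having independent standardized components, at most one of them normal. Let $\hat{\mathbf C}^3,\hat{\mathbf C}^4$ be the matrices $\mathbf C^3,\mathbf C^4$ of the empirical distribution of $\hat{\mathbf V}(\mathbf z_i-\bar{\mathbf z})$, $i=1,\dots,n$. A compound cumulant solution with weight $\alpha\in[0,1]$ is $\hat{\mathbf W}=(\hat w_{kl})=\hat{\mathbf U}\hat{\mathbf V}$, where $\hat{\mathbf U}$ maximizes $\alpha\|\mathrm{diag}(\mathbf U\hat{\mathbf C}^3\mathbf U^T)\|^2+(1-\alpha)\|\mathrm{diag}(\mathbf U\hat{\mathbf C}^4\mathbf U^T)\|^2$ over orthogonal $\mathbf U$; here $\mathrm{diag}(\mathbf A)$ is the diagonal matrix with the diagonal of $\mathbf A$ and $\|\cdot\|$ is the Frobenius norm.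
   Formalization: In (iii) the denominators αδ₁ₖₗ²+(1−α)δ₂ₖₗ² are assumed nonzero for all k≠l; this is automatic for 0<α<1, and at α=1 (α=0) it says the γ's (κ's) are distinct, without which the displayed variance is 0/0. *)

theory Defs
  imports "HOL-Probability.Probability"
begin

section \<open>Laws on Euclidean space and modes of convergence\<close>

text \<open>Point masses count as (degenerate) normal laws, as is usual for limiting distributions.\<close>

definition normal_law :: "real measure \<Rightarrow> bool" where
  "normal_law N \<longleftrightarrow>
     (\<exists>m \<sigma>. (\<sigma> = 0 \<and> N = return borel m) \<or> (\<sigma> > 0 \<and> N = density lborel (normal_density m \<sigma>)))"

definition multivariate_normal :: "'b::euclidean_space measure \<Rightarrow> bool" where
  "multivariate_normal L \<longleftrightarrow> prob_space L \<and> sets L = sets borel \<and>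
     (\<forall>a. normal_law (distr L borel (\<lambda>x. a \<bullet> x)))"

definition converges_in_distribution ::
    "'w measure \<Rightarrow> (nat \<Rightarrow> 'w \<Rightarrow> 'b::euclidean_space) \<Rightarrow> 'b measure \<Rightarrow> bool" where
  "converges_in_distribution M X L \<longleftrightarrow>
     (\<forall>f :: 'b \<Rightarrow> real. continuous_on UNIV f \<and> bounded (range f) \<longrightarrow>
        (\<lambda>n. \<integral>\<omega>. f (X n \<omega>) \<partial>M) \<longlonglongrightarrow> (\<integral>x. f x \<partial>L))"

definition converges_in_probability ::
    "'w measure \<Rightarrow> (nat \<Rightarrow> 'w \<Rightarrow> 'b::real_normed_vector) \<Rightarrow> 'b \<Rightarrow> bool" where
  "converges_in_probability M X c \<longleftrightarrow>
     (\<forall>\<epsilon>>0. (\<lambda>n. measure M {\<omega> \<in> space M. norm (X n \<omega> - c) > \<epsilon>}) \<longlonglongrightarrow> 0)"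

text \<open>\<open>X\<^sub>n = O\<^sub>P(1)\<close>.\<close>

definition bounded_in_probability ::
    "'w measure \<Rightarrow> (nat \<Rightarrow> 'w \<Rightarrow> 'b::real_normed_vector) \<Rightarrow> bool" where
  "bounded_in_probability M X \<longleftrightarrow>
     (\<forall>\<epsilon>>0. \<exists>K. \<forall>\<^sub>F n in sequentially. measure M {\<omega> \<in> space M. norm (X n \<omega>) > K} \<le> \<epsilon>)"

text \<open>Stated with an inner event, because \<open>{\<omega>. Q n \<omega>}\<close> itself need not be measurable.\<close>

definition with_probability_tending_to_one ::
    "'w measure \<Rightarrow> (nat \<Rightarrow> 'w \<Rightarrow> bool) \<Rightarrow> bool" where
  "with_probability_tending_to_one M Q \<longleftrightarrow>
     (\<exists>E. (\<forall>n. E n \<in> sets M \<and> (\<forall>\<omega>\<in>E n. Q n \<omega>)) \<and> (\<lambda>n. measure M (E n)) \<longlonglongrightarrow> 1)"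


section \<open>Moments and cumulant matrices of a law on \<open>\<real>\<^sup>p\<close>\<close>

definition mean_vector :: "(real^'n) measure \<Rightarrow> real^'n" where
  "mean_vector F = (\<chi> i. \<integral>x. x $ i \<partial>F)"

definition covariance_matrix :: "(real^'n) measure \<Rightarrow> real^'n^'n" where
  "covariance_matrix F =
     (\<chi> i j. \<integral>x. (x $ i - mean_vector F $ i) * (x $ j - mean_vector F $ j) \<partial>F)"

text \<open>The cumulant matrices are in terms of raw moments: they are meant for laws with mean zero.\<close>

definition C3i :: "(real^'n) measure \<Rightarrow> 'n \<Rightarrow> real^'n^'n" where
  "C3i F i = (\<chi> k l. \<integral>x. x $ i * (x $ k * x $ l) \<partial>F)"

definition C4ij :: "(real^'n) measure \<Rightarrow> 'n \<Rightarrow> 'n \<Rightarrow> real^'n^'n" where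
  "C4ij F i j = (\<chi> k l.
     (\<integral>x. x $ i * x $ j * (x $ k * x $ l) \<partial>F)
     - (\<integral>x. x $ i * x $ j \<partial>F) * (\<integral>x. x $ k * x $ l \<partial>F)
     - (\<integral>x. x $ i * x $ k \<partial>F) * (\<integral>x. x $ j * x $ l \<partial>F)
     - (\<integral>x. x $ j * x $ k \<partial>F) * (\<integral>x. x $ i * x $ l \<partial>F))"

definition C3 :: "(real^'n) measure \<Rightarrow> real^'n^'n" where
  "C3 F = (\<Sum>i\<in>UNIV. C3i F i)"

definition C4 :: "(real^'n) measure \<Rightarrow> real^'n^'n" where
  "C4 F = (\<Sum>i\<in>UNIV. C4ij F i i)"

definition finite_moments :: "nat \<Rightarrow> (real^'n) measure \<Rightarrow> bool" where
  "finite_moments m F \<longleftrightarrow> (\<forall>k. integrable F (\<lambda>x. \<bar>x $ k\<bar> ^ m))"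

definition moment :: "nat \<Rightarrow> (real^'n) measure \<Rightarrow> 'n \<Rightarrow> real" where
  "moment m F k = (\<integral>x. (x $ k) ^ m \<partial>F)"

definition gam :: "(real^'n) measure \<Rightarrow> 'n \<Rightarrow> real" where
  "gam F k = moment 3 F k"

definition bet :: "(real^'n) measure \<Rightarrow> 'n \<Rightarrow> real" where
  "bet F k = moment 4 F k"

definition kap :: "(real^'n) measure \<Rightarrow> 'n \<Rightarrow> real" where
  "kap F k = bet F k - 3"

definition omg :: "(real^'n) measure \<Rightarrow> 'n \<Rightarrow> real" where
  "omg F k = moment 6 F k - (moment 3 F k)\<^sup>2"

definition nu :: "(real^'n) measure \<Rightarrow> 'n \<Rightarrow> real" where
  "nu F k = moment 4 F k - 1"

definition eta :: "(real^'n) measure \<Rightarrow> 'n \<Rightarrow> real" where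
  "eta F k = moment 5 F k - moment 3 F k"

definition zeta11 :: "(real^'n) measure \<Rightarrow> 'n \<Rightarrow> 'n \<Rightarrow> real" where
  "zeta11 F k l =
     (nu F k - (gam F k)\<^sup>2) + (nu F l - (gam F l)\<^sup>2) + (gam F l)\<^sup>2 + (real CARD('n) - 2)"

definition zeta22 :: "(real^'n) measure \<Rightarrow> 'n \<Rightarrow> 'n \<Rightarrow> real" where
  "zeta22 F k l =
     (omg F k - (bet F k)\<^sup>2) + (omg F l - (bet F l)\<^sup>2) + (kap F l)\<^sup>2
     + (\<Sum>m\<in>UNIV - {k, l}. bet F m - 1)"

definition zeta12 :: "(real^'n) measure \<Rightarrow> 'n \<Rightarrow> 'n \<Rightarrow> real" where
  "zeta12 F k l =
     (eta F k - gam F k * bet F k) + (eta F l - gam F l * bet F l) + gam F l * kap F l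
     + (\<Sum>m\<in>UNIV - {k, l}. gam F m)"


section \<open>Independent component functionals\<close>

text \<open>\<open>F\<close> is the law of a random vector with mutually independent components of mean 0 and
  variance 1.\<close>

definition independent_standardized :: "(real^'n) measure \<Rightarrow> bool" where
  "independent_standardized F \<longleftrightarrow>
     prob_space F \<and> sets F = sets borel \<and>
     prob_space.indep_vars F (\<lambda>_. borel) (\<lambda>k x. x $ k) UNIV \<and>
     (\<forall>k. integrable F (\<lambda>x. (x $ k)\<^sup>2) \<and> (\<integral>x. x $ k \<partial>F) = 0 \<and> (\<integral>x. (x $ k)\<^sup>2 \<partial>F) = 1)"

definition at_most_one_normal :: "(real^'n) measure \<Rightarrow> bool" where
  "at_most_one_normal F \<longleftrightarrow>
     (\<forall>k l. normal_law (distr F borel (\<lambda>x. x $ k)) \<and> normal_law (distr F borel (\<lambda>x. x $ l))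
        \<longrightarrow> k = l)"

definition ic_model_law :: "(real^'n) measure \<Rightarrow> bool" where
  "ic_model_law G \<longleftrightarrow>
     (\<exists>F \<mu> (\<Omega> :: real^'n^'n). independent_standardized F \<and> at_most_one_normal F \<and> invertible \<Omega> \<and>
        G = distr F borel (\<lambda>z. \<mu> + \<Omega> *v z))"

text \<open>\<open>S = \<Sigma>\<^sup>-\<^sup>1\<^sup>/\<^sup>2\<close>, the symmetric positive definite root; it is unique, and exists when \<open>\<Sigma>\<close> is
  symmetric positive definite.\<close>

definition is_inverse_sqrt :: "real^'n^'n \<Rightarrow> real^'n^'n \<Rightarrow> bool" where
  "is_inverse_sqrt S \<Sigma> \<longleftrightarrow>
     transpose S = S \<and> (\<forall>x. x \<noteq> 0 \<longrightarrow> x \<bullet> (S *v x) > 0) \<and>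
     invertible \<Sigma> \<and> S ** S = matrix_inv \<Sigma>"

text \<open>Equality up to a permutation and sign changes of the rows.\<close>

definition row_equivalent :: "real^'n^'n \<Rightarrow> real^'n^'n \<Rightarrow> bool" where
  "row_equivalent A B \<longleftrightarrow>
     (\<exists>\<pi> s. bij \<pi> \<and> (\<forall>i. s i = 1 \<or> s i = -1) \<and> (\<forall>i. B $ i = s i *\<^sub>R A $ (\<pi> i)))"

text \<open>
  A functional \<open>\<Gamma>\<close> with domain \<open>D\<close>. A domain is needed, since affine equivariance up to row
  permutations and signs is impossible at laws with too much symmetry, such as the standard normal
  law. \<open>D\<close> has to contain every law of an independent component model, but it may be larger;
  to evaluate \<open>\<Gamma>\<close> at a sample it has to contain the empirical distribution.
\<close>

definition ic_functional ::
    "(real^'n) measure set \<Rightarrow> ((real^'n) measure \<Rightarrow> real^'n^'n) \<Rightarrow> bool" where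
  "ic_functional D \<Gamma> \<longleftrightarrow>
     (\<forall>G\<in>D. prob_space G \<and> sets G = sets borel \<and> finite_moments 2 G \<and>
        (\<exists>U S. orthogonal_matrix U \<and> is_inverse_sqrt S (covariance_matrix G) \<and> \<Gamma> G = U ** S)) \<and>
     (\<forall>G\<in>D. \<forall>A b. invertible A \<longrightarrow>
        distr G borel (\<lambda>x. A *v x + b) \<in> D \<and>
        row_equivalent (\<Gamma> G ** matrix_inv A) (\<Gamma> (distr G borel (\<lambda>x. A *v x + b)))) \<and>
     (\<forall>G. ic_model_law G \<longrightarrow>
        G \<in> D \<and> prob_space.indep_vars G (\<lambda>_. borel) (\<lambda>k x. (\<Gamma> G *v x) $ k) UNIV)"


section \<open>Compound cumulant solutions\<close>

definition empirical :: "nat \<Rightarrow> (nat \<Rightarrow> real^'n) \<Rightarrow> (real^'n) measure" where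
  "empirical n x = distr (uniform_count_measure {..<n}) borel x"

text \<open>
  \<open>V\<close> is a sample version of \<open>\<Gamma>\<close> for the samples \<open>Z 0, \<dots>, Z (n - 1)\<close>. As \<open>\<Gamma>\<close> is only determined
  up to row permutations and signs, so is \<open>V\<close>. On the exceptional event, which includes all samples
  with a singular covariance matrix, \<open>V\<close> is arbitrary.
\<close>

definition sample_version ::
    "'w measure \<Rightarrow> (nat \<Rightarrow> 'w \<Rightarrow> real^'n) \<Rightarrow> (real^'n) measure set \<Rightarrow>
     ((real^'n) measure \<Rightarrow> real^'n^'n) \<Rightarrow> (nat \<Rightarrow> 'w \<Rightarrow> real^'n^'n) \<Rightarrow> bool" where
  "sample_version M Z D \<Gamma> V \<longleftrightarrow>
     (\<forall>n. V n \<in> borel_measurable M) \<and>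
     with_probability_tending_to_one M (\<lambda>n \<omega>.
        empirical n (\<lambda>i. Z i \<omega>) \<in> D \<and>
        row_equivalent (\<Gamma> (empirical n (\<lambda>i. Z i \<omega>))) (V n \<omega>))"

text \<open>The empirical distribution of \<open>V (x\<^sub>i - x\<^sub>m)\<close>, where \<open>x\<^sub>m\<close> is the sample mean.\<close>

definition standardized_empirical ::
    "nat \<Rightarrow> (nat \<Rightarrow> real^'n) \<Rightarrow> real^'n^'n \<Rightarrow> (real^'n) measure" where
  "standardized_empirical n x V = empirical n (\<lambda>i. V *v (x i - mean_vector (empirical n x)))"

definition diag_part :: "real^'n^'n \<Rightarrow> real^'n^'n" where
  "diag_part A = (\<chi> i j. if i = j then A $ i $ j else 0)"

text \<open>The norm of \<open>real^'n^'n\<close> is the Frobenius norm.\<close>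

definition compound_objective ::
    "real \<Rightarrow> real^'n^'n \<Rightarrow> real^'n^'n \<Rightarrow> real^'n^'n \<Rightarrow> real" where
  "compound_objective \<alpha> A B U =
     \<alpha> * (norm (diag_part (U ** A ** transpose U)))\<^sup>2 +
     (1 - \<alpha>) * (norm (diag_part (U ** B ** transpose U)))\<^sup>2"

definition compound_cumulant_solution ::
    "real \<Rightarrow> nat \<Rightarrow> (nat \<Rightarrow> real^'n) \<Rightarrow> real^'n^'n \<Rightarrow> real^'n^'n \<Rightarrow> bool" where
  "compound_cumulant_solution \<alpha> n x V W \<longleftrightarrow>
     (\<exists>U. is_arg_max
            (compound_objective \<alpha> (C3 (standardized_empirical n x V))
                                  (C4 (standardized_empirical n x V)))
            orthogonal_matrix U \<and>
          W = U ** V)"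

definition compound_cumulant_sequence ::
    "'w measure \<Rightarrow> (nat \<Rightarrow> 'w \<Rightarrow> real^'n) \<Rightarrow> (nat \<Rightarrow> 'w \<Rightarrow> real^'n^'n) \<Rightarrow> real \<Rightarrow>
     (nat \<Rightarrow> 'w \<Rightarrow> real^'n^'n) \<Rightarrow> bool" where
  "compound_cumulant_sequence M Z V \<alpha> W \<longleftrightarrow>
     (\<forall>n. W n \<in> borel_measurable M \<and>
        (\<forall>\<omega>\<in>space M. compound_cumulant_solution \<alpha> n (\<lambda>i. Z i \<omega>) (V n \<omega>) (W n \<omega>)))"

text \<open>Vectorization; coordinates are indexed by pairs, so no stacking order has to be chosen.\<close>

definition vectorize :: "real^'n^'n \<Rightarrow> real^('n \<times> 'n)" where
  "vectorize A = (\<chi> kl. A $ fst kl $ snd kl)"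

text \<open>The variance of the \<open>(k, l)\<close> coordinate of a limiting law \<open>L\<close>.\<close>

definition ASV :: "(real^('n::finite \<times> 'n)) measure \<Rightarrow> 'n \<Rightarrow> 'n \<Rightarrow> real" where
  "ASV L k l = (\<integral>x. (x $ (k, l) - (\<integral>y. y $ (k, l) \<partial>L))\<^sup>2 \<partial>L)"

text \<open>\<open>L\<close> is the limiting law of \<open>\<surd>n vec(W\<^sub>n - I)\<close> and is normal with mean vector 0.\<close>

definition limiting_normal ::
    "'w measure \<Rightarrow> (nat \<Rightarrow> 'w \<Rightarrow> real^'n^'n) \<Rightarrow> (real^('n \<times> 'n)) measure \<Rightarrow> bool" where
  "limiting_normal M W L \<longleftrightarrow>
     multivariate_normal L \<and> (\<forall>kl. (\<integral>x. x $ kl \<partial>L) = 0) \<and>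
     converges_in_distribution M (\<lambda>n \<omega>. sqrt (real n) *\<^sub>R vectorize (W n \<omega> - mat 1)) L"

end

theory Submission
  imports Defs
begin

text \<open>
  With \<open>V = \<Sigma>\<^sup>-\<^sup>1\<^sup>/\<^sup>2\<close> up to rotation and \<open>W = U V\<close>, the matrix \<open>W\<close> is determined to first order by two
  sets of equations: \<open>W\<close> whitens the sample, which gives \<open>w\<^sub>k\<^sub>l + w\<^sub>l\<^sub>k = - s\<^sub>k\<^sub>l\<close> for the deviation \<open>s\<close> of
  the sample covariance matrix from \<open>I\<close>, and the derivative of the objective at \<open>U\<close> vanishes in the
  direction of every plane rotation. Expanding both around \<open>V = W = I\<close> and the population moments,
  \<open>V\<close> drops out and \<open>W - I\<close> becomes, up to terms of smaller order, the sample mean of an explicit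
  polynomial of degree at most three in each variable; the multivariate central limit theorem and
  a computation of variances finish the proof. The objective is invariant under signed permutations
  of the rows and its population version is maximized at these only, so that a maximizer close to
  \<open>I\<close> exists and can be selected measurably.

  Stochastic orders are handled by deterministic arguments: on events of probability at least
  \<open>1 - \<eta>\<close> all scaled deviations are bounded, and along the filter of pairs \<open>(n, \<omega>)\<close> with \<open>n \<rightarrow> \<infinity>\<close>
  and \<open>\<omega>\<close> in the \<open>n\<close>-th event one uses ordinary expansions.
\<close>

section \<open>Measurable selection of maximizers\<close>

text \<open>The deviation of V drops out for two reasons. In the third-order matrix it multiplies
  joint third moments that vanish off the diagonal; the fourth-order matrix sees V only through V^T
  V, the inverse sample covariance matrix by whitening. Stationarity in the plane (k, l) is a
  weighted sum of products of an off-diagonal entry with a difference of diagonal ones. The first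
  factor tends to 0, so only its linear part and the limit of the second factor count. With
  whitening this leaves two linear equations for w_kl and w_lk, whose determinant is the denominator
  of the asymptotic standard deviation. Compactness yields only consistency, while the expansion
  needs the rate n^(-1/2); the rate has to be extracted from the equations themselves. Sample
  moments of order 3 or 4 have this rate under 6 or 8 population moments, which is why for \<alpha>
  = 1 the fourth-order terms are suppressed throughout instead of being expanded. A solution is
  demanded at every point of the probability space, also where V is arbitrary, so the selection is
  made for all samples and only prefers maximizers near I.\<close>

lemma borel_measurable_Sup_compact:
  fixes f :: "'a \<Rightarrow> 'b::euclidean_space \<Rightarrow> real"
  assumes K: "compact K" "K \<noteq> {}"
    and meas: "\<And>u. (\<lambda>x. f x u) \<in> borel_measurable M"
    and cont: "\<And>x. x \<in> space M \<Longrightarrow> continuous_on UNIV (f x)"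
  shows "(\<lambda>x. SUP u\<in>K. f x u) \<in> borel_measurable M"
proof -
  \<comment> \<open>By continuity the supremum over a countable dense subset is the same, and
    countable suprema are measurable.\<close>
  obtain D where D: "countable D" "D \<subseteq> K" "K \<subseteq> closure D"
    using separable by blast
  have D0: "D \<noteq> {}" using D K by auto
  have cl: "closure D = K"
    using D compact_imp_closed[OF K(1)] by (simp add: closure_minimal subset_antisym)
  have bdd: "bdd_above (f x ` K)" if "x \<in> space M" for x
    by (meson bounded_imp_bdd_above compact_continuous_image compact_imp_bounded cont
        continuous_on_subset K(1) subset_UNIV that)
  have eq: "(SUP u\<in>K. f x u) = (SUP u\<in>D. f x u)" if x: "x \<in> space M" for x
  proof (rule antisym)
    show "(SUP u\<in>K. f x u) \<le> (SUP u\<in>D. f x u)"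
    proof (rule cSUP_least[OF K(2)])
      fix u assume "u \<in> K"
      show "f x u \<le> (SUP u\<in>D. f x u)"
      proof (rule continuous_le_on_closure[of D "f x"])
        show "continuous_on (closure D) (f x)" using cont[OF x] continuous_on_subset by blast
        show "u \<in> closure D" using \<open>u \<in> K\<close> cl by simp
        fix d assume "d \<in> D"
        then show "f x d \<le> (SUP u\<in>D. f x u)"
          using bdd[OF x] D(2) by (intro cSUP_upper bdd_above_mono[OF bdd[OF x]]) auto
      qed
    qed
    show "(SUP u\<in>D. f x u) \<le> (SUP u\<in>K. f x u)"
      using D0 D(2) bdd[OF x] by (intro cSUP_subset_mono) auto
  qed
  have "(\<lambda>x. SUP u\<in>D. f x u) \<in> borel_measurable M"
    using D(1) meas
    by (rule borel_measurable_cSUP) (meson bdd_above_mono bdd D(2) image_mono)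
  then show ?thesis
    by (subst measurable_cong[OF eq]) auto
qed

text \<open>Trades an uncountable existential quantifier for an inequality between two suprema; each
  of these is measurable in a parameter, hence so is the event that \<open>C\<close> contains a
  maximizer over \<open>K\<close>.\<close>

lemma compact_attains_Sup_iff:
  fixes f :: "'b::euclidean_space \<Rightarrow> real"
  assumes C: "compact C" "C \<noteq> {}" and CK: "C \<subseteq> K" and K: "compact K"
    and cont: "continuous_on UNIV f"
  shows "(\<exists>u\<in>C. \<forall>v\<in>K. f v \<le> f u) \<longleftrightarrow> (SUP u\<in>K. f u) \<le> (SUP u\<in>C. f u)"
proof -
  have bdd: "bdd_above (f ` K)"
    by (meson bounded_imp_bdd_above compact_continuous_image compact_imp_bounded cont
        continuous_on_subset K subset_UNIV)
  obtain c where c: "c \<in> C" "\<And>v. v \<in> C \<Longrightarrow> f v \<le> f c"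
    using continuous_attains_sup[OF C] cont continuous_on_subset by (metis subset_UNIV)
  have c': "(SUP u\<in>C. f u) = f c"
    using c by (intro cSup_eq_maximum) auto
  show ?thesis
  proof
    assume "\<exists>u\<in>C. \<forall>v\<in>K. f v \<le> f u"
    then obtain u where u: "u \<in> C" "\<And>v. v \<in> K \<Longrightarrow> f v \<le> f u" by auto
    have "(SUP u\<in>K. f u) \<le> f u" using u CK by (intro cSUP_least) auto
    then show "(SUP u\<in>K. f u) \<le> (SUP u\<in>C. f u)" using c(2)[OF u(1)] c' by simp
  next
    assume *: "(SUP u\<in>K. f u) \<le> (SUP u\<in>C. f u)"
    have "f v \<le> f c" if "v \<in> K" for v
      using cSUP_upper[OF that bdd] * c' by simp
    then show "\<exists>u\<in>C. \<forall>v\<in>K. f v \<le> f u" using c(1) by auto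
  qed
qed

text \<open>The selection is the limit of nested closed balls that meet the set of maximizers; at each
  stage the first ball of an enumeration with dense centres is taken.\<close>

lemma measurable_argmax:
  fixes f :: "'a \<Rightarrow> 'b::euclidean_space \<Rightarrow> real"
  assumes K: "compact K" "K \<noteq> {}"
    and meas: "\<And>u. (\<lambda>x. f x u) \<in> borel_measurable M"
    and cont: "\<And>x. x \<in> space M \<Longrightarrow> continuous_on UNIV (f x)"
  obtains g where "g \<in> borel_measurable M"
    "\<And>x. x \<in> space M \<Longrightarrow> g x \<in> K \<and> (\<forall>v\<in>K. f x v \<le> f x (g x))"
proof -
  obtain D :: "'b set" where D: "countable D" "\<And>X. open X \<Longrightarrow> X \<noteq> {} \<Longrightarrow> \<exists>d\<in>D. d \<in> X"
    using countable_dense_setE by metis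
  have D0: "D \<noteq> {}" using D(2)[of UNIV] by auto
  define q where "q = from_nat_into D"
  have q: "\<exists>i. u \<in> cball (q i) r" if "r > 0" for u r
  proof -
    obtain d where "d \<in> D" "d \<in> ball u r" using D(2)[of "ball u r"] \<open>r > 0\<close> by auto
    moreover obtain i where "q i = d"
      using from_nat_into_surj[OF D(1) \<open>d \<in> D\<close>] unfolding q_def by auto
    ultimately show ?thesis by (metis dist_commute less_imp_le mem_ball mem_cball)
  qed
  define r where "r j = inverse (real (Suc j))" for j
  \<comment> \<open>A word records the balls chosen so far by their positions in the enumeration
    \<open>q\<close>. Words form a countable type, which keeps every stage of the selection
    measurable.\<close>
  define B where "B w = K \<inter> (\<Inter>j<length w. cball (q (w ! j)) (r j))" for w
  define H where "H w x \<longleftrightarrow> (\<exists>u\<in>B w. \<forall>v\<in>K. f x v \<le> f x u)" for w x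
  have B_compact: "compact (B w)" for w
    unfolding B_def by (intro compact_Int_closed K(1) closed_INT) auto
  have H_meas: "(\<lambda>x. H w x) \<in> measurable M (count_space UNIV)" for w
  proof (cases "B w = {}")
    case True
    then show ?thesis unfolding H_def by simp
  next
    case False
    have "H w x \<longleftrightarrow> (SUP u\<in>K. f x u) \<le> (SUP u\<in>B w. f x u)" if "x \<in> space M" for x
      unfolding H_def using compact_attains_Sup_iff[OF B_compact False _ K(1) cont[OF that]]
      by (simp add: B_def)
    moreover have "(\<lambda>x. (SUP u\<in>K. f x u) \<le> (SUP u\<in>B w. f x u)) \<in> measurable M (count_space UNIV)"
      using borel_measurable_Sup_compact[OF K meas cont]
        borel_measurable_Sup_compact[OF B_compact False meas cont] by measurable
    ultimately show ?thesis by (subst measurable_cong) auto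
  qed
  define w where "w x = rec_nat [] (\<lambda>_ w. w @ [LEAST i. H (w @ [i]) x])" for x
  have w_Suc: "w x (Suc j) = w x j @ [LEAST i. H (w x j @ [i]) x]"
    and w_0: "w x 0 = []" for x j
    by (simp_all add: w_def)
  have len: "length (w x j) = j" for x j by (induction j) (auto simp: w_0 w_Suc)
  \<comment> \<open>For a fixed word the next index is the least one with a measurable property; the
    countably many words are treated separately and glued.\<close>
  have w_meas: "(\<lambda>x. w x j) \<in> measurable M (count_space UNIV)" for j
  proof (induction j)
    case 0
    then show ?case by (simp add: w_0)
  next
    case (Suc j)
    have "(\<lambda>x. v @ [LEAST i. H (v @ [i]) x]) \<in> measurable M (count_space UNIV)" for v
      by (rule measurable_compose[OF measurable_Least[OF H_meas]]) simp
    from measurable_compose_countable[OF this Suc] show ?case by (simp add: w_Suc)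
  qed
  have B_snoc: "B (v @ [i]) = B v \<inter> cball (q i) (r (length v))" for v i
    unfolding B_def by (simp add: lessThan_Suc Int_ac) (auto simp: nth_append)
  have H_w: "H (w x j) x" if x: "x \<in> space M" for x j
  proof (induction j)
    case 0
    show ?case unfolding H_def w_0 B_def
      using continuous_attains_sup[OF K continuous_on_subset[OF cont[OF x] subset_UNIV]] by auto
  next
    case (Suc j)
    then obtain u where u: "u \<in> B (w x j)" "\<forall>v\<in>K. f x v \<le> f x u" by (auto simp: H_def)
    obtain i where "u \<in> cball (q i) (r j)" using q[of "r j" u] by (auto simp: r_def)
    then have "H (w x j @ [i]) x" using u unfolding H_def B_snoc by (auto simp: len)
    then show ?case unfolding w_Suc by (rule LeastI)
  qed
  have B_dec: "B (w x k) \<subseteq> B (w x j)" if "j \<le> k" for x j k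
    using that by (induction rule: dec_induct) (auto simp: w_Suc B_snoc)
  have small: "dist u v \<le> 2 * r j" if "u \<in> B (w x (Suc j))" "v \<in> B (w x (Suc j))" for u v x j
  proof -
    have "dist (q (LEAST i. H (w x j @ [i]) x)) u \<le> r j" "dist (q (LEAST i. H (w x j @ [i]) x)) v \<le> r j"
      using that by (auto simp: w_Suc B_snoc len)
    then show ?thesis by (smt (verit) dist_triangle3)
  qed
  \<comment> \<open>The choice depends on x only through a word in a discrete space, so it is
    measurable although it is arbitrary.\<close>
  define h where "h v = (SOME u. u \<in> B v)" for v
  have h: "h (w x j) \<in> B (w x j)" if "x \<in> space M" for x j
    unfolding h_def using H_w[OF that, of j] by (auto simp: H_def intro: someI)
  have r0: "r \<longlonglongrightarrow> 0" unfolding r_def by (rule LIMSEQ_inverse_real_of_nat)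
  have Cau: "Cauchy (\<lambda>j. h (w x j))" if x: "x \<in> space M" for x
  proof (rule metric_CauchyI)
    fix e :: real assume "e > 0"
    then obtain N where N: "2 * r N < e"
      using order_tendstoD(2)[OF tendsto_mult_right_zero[OF r0, of 2], of e]
      by (auto simp: eventually_sequentially)
    show "\<exists>M. \<forall>m\<ge>M. \<forall>n\<ge>M. dist (h (w x m)) (h (w x n)) < e"
    proof (intro exI allI impI)
      fix m n assume "Suc N \<le> m" "Suc N \<le> n"
      then show "dist (h (w x m)) (h (w x n)) < e"
        using small[of "h (w x m)" x N "h (w x n)"] h[OF x] B_dec N by (meson order_le_less_trans subsetD)
    qed
  qed
  define g where "g x = lim (\<lambda>j. h (w x j))" for x
  have g_lim: "(\<lambda>j. h (w x j)) \<longlonglongrightarrow> g x" if "x \<in> space M" for x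
    unfolding g_def using Cauchy_convergent[OF Cau[OF that]] by (simp add: convergent_LIMSEQ_iff)
  have "g \<in> borel_measurable M"
  proof (rule borel_measurable_LIMSEQ_metric)
    show "(\<lambda>x. h (w x j)) \<in> borel_measurable M" for j
      by (rule measurable_compose[OF w_meas]) simp
  qed (rule g_lim)
  moreover have "g x \<in> K \<and> (\<forall>v\<in>K. f x v \<le> f x (g x))" if x: "x \<in> space M" for x
  proof -
    \<comment> \<open>The points \<open>h (w x j)\<close> need not be maximizers. Maximizers
      \<open>u j\<close> taken from the same shrinking sets have the same limit, and continuity of
      the objective passes maximality on to it.\<close>
    have "\<exists>u. \<forall>j. u j \<in> B (w x j) \<and> (\<forall>v\<in>K. f x v \<le> f x (u j))"
      using H_w[OF x] unfolding H_def by (intro choice) blast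
    then obtain u where u: "\<And>j. u j \<in> B (w x j)" "\<And>j v. v \<in> K \<Longrightarrow> f x v \<le> f x (u j)" by auto
    have "(\<lambda>j. dist (u (Suc j)) (h (w x (Suc j)))) \<longlonglongrightarrow> 0"
      by (intro tendsto_sandwich[OF _ _ tendsto_const tendsto_mult_right_zero[OF r0, of 2]])
        (auto intro!: always_eventually small u(1) h[OF x])
    then have "(\<lambda>j. u (Suc j) - h (w x (Suc j))) \<longlonglongrightarrow> 0"
      by (simp add: dist_norm tendsto_norm_zero_iff)
    from tendsto_add[OF this LIMSEQ_Suc[OF g_lim[OF x]]]
    have "(\<lambda>j. u (Suc j)) \<longlonglongrightarrow> g x" by simp
    moreover have "isCont (f x) (g x)" using cont[OF x] by (simp add: continuous_on_eq_continuous_at)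
    ultimately have "(\<lambda>j. f x (u (Suc j))) \<longlonglongrightarrow> f x (g x)" by (rule isCont_tendsto_compose[rotated])
    then have "f x v \<le> f x (g x)" if "v \<in> K" for v
      by (rule LIMSEQ_le_const) (use u(2) that in auto)
    moreover have "g x \<in> K"
      using compact_imp_closed[OF K(1)] _ g_lim[OF x]
      by (rule closed_sequentially) (use h[OF x] in \<open>auto simp: B_def\<close>)
    ultimately show ?thesis by blast
  qed
  ultimately show ?thesis using that by blast
qed

text \<open>Glues a maximizer over \<open>K\<close> and one over \<open>C\<close> along the
  measurable event that \<open>C\<close> contains a global maximizer; on this event a maximizer over
  \<open>C\<close> is global. Later \<open>K\<close> is the orthogonal group and \<open>C\<close>
  its part within distance 1/2 of the identity.\<close>

lemma measurable_argmax_preferring: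
  fixes f :: "'a \<Rightarrow> 'b::euclidean_space \<Rightarrow> real"
  assumes K: "compact K" and C: "compact C" "C \<noteq> {}" "C \<subseteq> K"
    and meas: "\<And>u. (\<lambda>x. f x u) \<in> borel_measurable M"
    and cont: "\<And>x. x \<in> space M \<Longrightarrow> continuous_on UNIV (f x)"
  obtains g where "g \<in> borel_measurable M"
    "\<And>x. x \<in> space M \<Longrightarrow> g x \<in> K \<and> (\<forall>v\<in>K. f x v \<le> f x (g x))"
    "\<And>x u. x \<in> space M \<Longrightarrow> u \<in> C \<Longrightarrow> (\<forall>v\<in>K. f x v \<le> f x u) \<Longrightarrow> g x \<in> C"
proof -
  have K0: "K \<noteq> {}" using C by auto
  obtain gK where gK: "gK \<in> borel_measurable M"
    "\<And>x. x \<in> space M \<Longrightarrow> gK x \<in> K \<and> (\<forall>v\<in>K. f x v \<le> f x (gK x))"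
    using measurable_argmax[OF K K0 meas cont] by metis
  obtain gC where gC: "gC \<in> borel_measurable M"
    "\<And>x. x \<in> space M \<Longrightarrow> gC x \<in> C \<and> (\<forall>v\<in>C. f x v \<le> f x (gC x))"
    using measurable_argmax[OF C(1,2) meas cont] by metis
  define P where "P x \<longleftrightarrow> (SUP u\<in>K. f x u) \<le> (SUP u\<in>C. f x u)" for x
  have P: "P x \<longleftrightarrow> (\<exists>u\<in>C. \<forall>v\<in>K. f x v \<le> f x u)" if "x \<in> space M" for x
    unfolding P_def using compact_attains_Sup_iff[OF C K cont[OF that]] by simp
  have [measurable]: "Measurable.pred M P"
    unfolding P_def
    using borel_measurable_Sup_compact[OF K K0 meas cont]
      borel_measurable_Sup_compact[OF C(1,2) meas cont] by measurable
  have "(\<lambda>x. if P x then gC x else gK x) \<in> borel_measurable M"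
    using gK(1) gC(1) by measurable
  moreover have "(if P x then gC x else gK x) \<in> K \<and> (\<forall>v\<in>K. f x v \<le> f x (if P x then gC x else gK x))"
    if x: "x \<in> space M" for x
  proof (cases "P x")
    case True
    then obtain u where "u \<in> C" "\<forall>v\<in>K. f x v \<le> f x u" using P[OF x] by auto
    then show ?thesis using True gC(2)[OF x] C(3) by (auto intro: order_trans)
  qed (use gK(2)[OF x] in auto)
  moreover have "(if P x then gC x else gK x) \<in> C"
    if "x \<in> space M" "u \<in> C" "\<forall>v\<in>K. f x v \<le> f x u" for x u
    using P[OF that(1)] that gC(2) by auto
  ultimately show ?thesis using that[of "\<lambda>x. if P x then gC x else gK x"] by blast
qed

section \<open>Maximizers of the compound objective\<close>

lemma orthogonal_matrix_inner_rows:
  fixes U :: "real^'n^'n"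
  assumes "orthogonal_matrix U"
  shows "(\<Sum>a\<in>UNIV. U $ i $ a * U $ j $ a) = (if i = j then 1 else 0)"
proof -
  have "(U ** transpose U) $ i $ j = (mat 1 :: real^'n^'n) $ i $ j"
    using assms by (simp add: orthogonal_matrix_def)
  then show ?thesis by (simp add: matrix_matrix_mult_def transpose_def mat_def)
qed

lemma orthogonal_matrix_inner_columns:
  fixes U :: "real^'n^'n"
  assumes "orthogonal_matrix U"
  shows "(\<Sum>a\<in>UNIV. U $ a $ i * U $ a $ j) = (if i = j then 1 else 0)"
proof -
  have "orthogonal_matrix (transpose U)" using assms by simp
  from orthogonal_matrix_inner_rows[OF this, of i j] show ?thesis by (simp add: transpose_def)
qed

lemma orthogonal_matrixI_rows:
  fixes U :: "real^'n^'n"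
  assumes "\<And>i j. (\<Sum>a\<in>UNIV. U $ i $ a * U $ j $ a) = (if i = j then 1 else 0)"
  shows "orthogonal_matrix U"
proof -
  have "U ** transpose U = mat 1"
    using assms by (simp add: vec_eq_iff matrix_matrix_mult_def transpose_def mat_def)
  then show ?thesis
    using matrix_left_right_inverse orthogonal_matrix by blast
qed

lemma compact_orthogonal_matrix: "compact {U :: real^'n^'n. orthogonal_matrix U}"
proof -
  have eq: "{U :: real^'n^'n. orthogonal_matrix U} =
      (\<Inter>i. \<Inter>j. {U. (\<Sum>a\<in>UNIV. U $ i $ a * U $ j $ a) = (if i = j then 1 else 0)})"
    (is "?L = ?R")
  proof (rule set_eqI)
    fix U :: "real^'n^'n"
    have "orthogonal_matrix U \<longleftrightarrow> (\<forall>i j. (\<Sum>a\<in>UNIV. U $ i $ a * U $ j $ a) = (if i = j then 1 else 0))"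
      using orthogonal_matrix_inner_rows[of U] orthogonal_matrixI_rows[of U] by (intro iffI allI) simp_all
    then show "U \<in> ?L \<longleftrightarrow> U \<in> ?R"
      by (simp only: mem_Collect_eq INT_iff UNIV_I simp_thms ball_UNIV)
  qed
  have cont: "continuous_on UNIV (\<lambda>U :: real^'n^'n. (\<Sum>a\<in>UNIV. U $ i $ a * U $ j $ a))" for i j
    by (intro continuous_on_sum continuous_on_mult continuous_on_component continuous_on_id)
  have "closed {U :: real^'n^'n. orthogonal_matrix U}"
    unfolding eq by (rule closed_INT, rule ballI)+ (rule closed_Collect_eq[OF cont continuous_on_const])
  moreover have "norm U \<le> real CARD('n)" if "orthogonal_matrix U" for U :: "real^'n^'n"
  proof -
    have "norm (U $ i) = 1" for i
      using orthogonal_matrix_inner_rows[OF that, of i i] by (simp add: norm_eq_1 inner_vec_def)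
    then show ?thesis
      using L2_set_le_sum[of UNIV "\<lambda>i. norm (U $ i)"] by (simp add: norm_vec_def)
  qed
  then have "bounded {U :: real^'n^'n. orthogonal_matrix U}" by (auto simp: bounded_iff)
  ultimately show ?thesis by (simp add: compact_eq_bounded_closed)
qed

section \<open>The objective in terms of diagonals of conjugated matrices\<close>

lemma conj_matrix_component:
  fixes U A :: "real^'n^'n"
  shows "(U ** A ** transpose U) $ k $ l = (\<Sum>a\<in>UNIV. \<Sum>b\<in>UNIV. U $ k $ a * U $ l $ b * A $ a $ b)"
  by (simp add: matrix_matrix_mult_def transpose_def sum_distrib_right sum_distrib_left ac_simps)
     (rule sum.swap)

lemma norm_diag_part: "(norm (diag_part A))\<^sup>2 = (\<Sum>k\<in>UNIV. (A $ k $ k)\<^sup>2)"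
proof -
  have "(\<Sum>j\<in>UNIV. (if i = j then A $ i $ j else 0) * (if i = j then A $ i $ j else 0)) = (A $ i $ i)\<^sup>2" for i
    by (subst sum.cong[OF refl, of _ _ "\<lambda>j. if i = j then (A $ i $ i)\<^sup>2 else 0"])
       (auto simp: power2_eq_square)
  then show ?thesis
    by (simp add: power2_norm_eq_inner inner_vec_def diag_part_def)
qed

lemma compound_objective_eq:
  "compound_objective \<alpha> A B U =
     (\<Sum>k\<in>UNIV. \<alpha> * ((U ** A ** transpose U) $ k $ k)\<^sup>2 + (1 - \<alpha>) * ((U ** B ** transpose U) $ k $ k)\<^sup>2)"
  by (simp add: compound_objective_def norm_diag_part sum.distrib sum_distrib_left)

lemma tendsto_conj_matrix:
  fixes A U :: "'a \<Rightarrow> real^'n^'n"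
  assumes "(A \<longlongrightarrow> A') F" "(U \<longlongrightarrow> U') F"
  shows "((\<lambda>n. (U n ** A n ** transpose (U n)) $ k $ l) \<longlongrightarrow> (U' ** A' ** transpose U') $ k $ l) F"
  unfolding conj_matrix_component by (intro tendsto_intros assms)

lemma tendsto_compound_objective:
  assumes "(A \<longlongrightarrow> A') F" "(B \<longlongrightarrow> B') F" "(U \<longlongrightarrow> U') F"
  shows "((\<lambda>n. compound_objective \<alpha> (A n) (B n) (U n)) \<longlongrightarrow> compound_objective \<alpha> A' B' U') F"
  unfolding compound_objective_eq by (intro tendsto_intros tendsto_conj_matrix assms)

lemma continuous_on_compound_objective: "continuous_on S (compound_objective \<alpha> A B)"
  unfolding continuous_on_def
  by (auto intro!: tendsto_compound_objective tendsto_const tendsto_ident_at)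

lemma compound_objective_attains_max:
  obtains U where "is_arg_max (compound_objective \<alpha> A B) orthogonal_matrix U"
proof -
  have "{U :: real^'n^'n. orthogonal_matrix U} \<noteq> {}" using orthogonal_matrix_id by blast
  from continuous_attains_sup[OF compact_orthogonal_matrix this continuous_on_compound_objective]
  show ?thesis using that unfolding is_arg_max_def by (metis mem_Collect_eq not_less)
qed

lemma is_arg_maxD:
  assumes "is_arg_max (f :: 'a \<Rightarrow> real) P U"
  shows "P U" "P V \<Longrightarrow> f V \<le> f U"
  using assms by (auto simp: is_arg_max_def not_less)

text \<open>The first-order condition for the Givens rotations in the plane of the coordinates \<open>k\<close> and
  \<open>l\<close>.\<close>

lemma compound_objective_stationary:
  fixes A B U :: "real^'n^'n"
  assumes max: "is_arg_max (compound_objective \<alpha> A B) orthogonal_matrix U"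
    and sym: "\<And>i j. A $ i $ j = A $ j $ i" "\<And>i j. B $ i $ j = B $ j $ i" and kl: "k \<noteq> l"
  defines "A' \<equiv> U ** A ** transpose U" and "B' \<equiv> U ** B ** transpose U"
  shows "\<alpha> * (A' $ k $ l * (A' $ k $ k - A' $ l $ l)) + (1 - \<alpha>) * (B' $ k $ l * (B' $ k $ k - B' $ l $ l)) = 0"
proof -
  have U: "orthogonal_matrix U" using max by (rule is_arg_maxD)
  \<comment> \<open>This is U multiplied from the left by a rotation in the plane (k, l), so only
    the diagonal entries k and l of the conjugated matrices move, and \<open>R 0\<close> is
    U.\<close>
  define R where "R t = (\<chi> i. if i = k then cos t *\<^sub>R U $ k + sin t *\<^sub>R U $ l
      else if i = l then cos t *\<^sub>R U $ l - sin t *\<^sub>R U $ k else U $ i)" for t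
  have sc: "cos t * cos t + sin t * sin t = 1" for t :: real
    using sin_cos_squared_add2[of t] by (simp add: power2_eq_square)
  have inner: "U $ i \<bullet> U $ j = (if i = j then 1 else 0)" for i j
    using orthogonal_matrix_inner_rows[OF U] by (simp add: inner_vec_def)
  have "R t $ i \<bullet> R t $ j = (if i = j then 1 else 0)" for i j t
    using sc[of t] kl by (simp add: R_def inner_add_left inner_add_right inner_diff_left inner_diff_right inner)
  then have R: "orthogonal_matrix (R t)" for t
    by (intro orthogonal_matrixI_rows) (simp add: inner_vec_def)
  have symc: "(U ** X ** transpose U) $ l $ k = (U ** X ** transpose U) $ k $ l"
    if X: "\<And>i j. X $ i $ j = X $ j $ i" for X
    unfolding conj_matrix_component by (subst sum.swap) (simp add: X[symmetric] mult_ac)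
  define Q where "Q X x y = (\<Sum>a\<in>UNIV. \<Sum>b\<in>UNIV. x $ a * y $ b * X $ a $ b)" for X :: "real^'n^'n" and x y
  have Q: "(V ** X ** transpose V) $ i $ j = Q X (V $ i) (V $ j)" for V X :: "real^'n^'n" and i j
    by (simp add: Q_def conj_matrix_component)
  have Q_lin: "Q X (x *\<^sub>R u + y *\<^sub>R v) (x *\<^sub>R u + y *\<^sub>R v) =
      x\<^sup>2 * Q X u u + x * y * (Q X u v + Q X v u) + y\<^sup>2 * Q X v v" for X x y u v
  proof -
    have l: "Q X (x *\<^sub>R u + y *\<^sub>R v) z = x * Q X u z + y * Q X v z" for u v z
      unfolding Q_def sum_distrib_left sum.distrib[symmetric]
      by (intro sum.cong refl) (simp add: distrib_right mult.assoc)
    have r: "Q X z (x *\<^sub>R u + y *\<^sub>R v) = x * Q X z u + y * Q X z v" for u v z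
      unfolding Q_def sum_distrib_left sum.distrib[symmetric]
      by (intro sum.cong refl) (simp add: algebra_simps)
    show ?thesis unfolding l r by (simp add: algebra_simps power2_eq_square)
  qed
  define c where "c X t = (cos t)\<^sup>2 * X $ k $ k + 2 * cos t * sin t * X $ k $ l + (sin t)\<^sup>2 * X $ l $ l"
    for X :: "real^'n^'n" and t
  define d where "d X t = (cos t)\<^sup>2 * X $ l $ l - 2 * cos t * sin t * X $ k $ l + (sin t)\<^sup>2 * X $ k $ k"
    for X :: "real^'n^'n" and t
  have Rk: "(R t ** X ** transpose (R t)) $ k $ k = c (U ** X ** transpose U) t"
    and Rl: "(R t ** X ** transpose (R t)) $ l $ l = d (U ** X ** transpose U) t"
    if X: "\<And>i j. X $ i $ j = X $ j $ i" for X t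
  proof -
    have "(R t ** X ** transpose (R t)) $ k $ k = Q X (cos t *\<^sub>R U $ k + sin t *\<^sub>R U $ l) (cos t *\<^sub>R U $ k + sin t *\<^sub>R U $ l)"
      by (simp add: Q R_def)
    then show "(R t ** X ** transpose (R t)) $ k $ k = c (U ** X ** transpose U) t"
      unfolding Q_lin c_def using symc[OF X] by (simp add: Q)
    have "(R t ** X ** transpose (R t)) $ l $ l = Q X (cos t *\<^sub>R U $ l + (- sin t) *\<^sub>R U $ k) (cos t *\<^sub>R U $ l + (- sin t) *\<^sub>R U $ k)"
      using kl by (simp add: Q R_def)
    then show "(R t ** X ** transpose (R t)) $ l $ l = d (U ** X ** transpose U) t"
      unfolding Q_lin d_def using symc[OF X] by (simp add: Q)
  qed
  have Ro: "(R t ** X ** transpose (R t)) $ i $ i = (U ** X ** transpose U) $ i $ i"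
    if "i \<noteq> k" "i \<noteq> l" for X t i
    using that by (simp add: Q R_def)
  define r where "r = (\<Sum>i\<in>UNIV - {k, l}. \<alpha> * (A' $ i $ i)\<^sup>2 + (1 - \<alpha>) * (B' $ i $ i)\<^sup>2)"
  define g where "g t = (\<alpha> * (c A' t)\<^sup>2 + (1 - \<alpha>) * (c B' t)\<^sup>2) + (\<alpha> * (d A' t)\<^sup>2 + (1 - \<alpha>) * (d B' t)\<^sup>2) + r" for t
  have obj: "compound_objective \<alpha> A B (R t) = g t" for t
  proof -
    have split: "(\<Sum>i\<in>UNIV. h i) = h k + h l + (\<Sum>i\<in>UNIV - {k, l}. h i)" for h :: "'n \<Rightarrow> real"
      using sum.subset_diff[of "{k, l}" UNIV h] kl by simp
    show ?thesis
      unfolding compound_objective_eq g_def r_def A'_def B'_def split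
        Rk[OF sym(1)] Rl[OF sym(1)] Rk[OF sym(2)] Rl[OF sym(2)]
      by (rule arg_cong[where f = "(+) _"], rule sum.cong[OF refl]) (simp add: Ro)
  qed
  have R0: "R 0 = U" by (simp add: R_def vec_eq_iff)
  have max0: "g t \<le> g 0" for t
    using is_arg_maxD(2)[OF max R[of t]] obj[of t] obj[of 0] by (simp add: R0)
  \<comment> \<open>The two diagonal entries move at opposite rates, each twice the off-diagonal
    entry; differentiating their squares therefore produces the difference of the diagonal
    entries.\<close>
  have dc: "DERIV (c X) 0 :> 2 * X $ k $ l" and dd: "DERIV (d X) 0 :> - 2 * X $ k $ l" for X
    unfolding c_def d_def by (auto intro!: derivative_eq_intros)
  have c0: "c X 0 = X $ k $ k" and d0: "d X 0 = X $ l $ l" for X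
    by (simp_all add: c_def d_def)
  have "DERIV g 0 :> 4 * (\<alpha> * (A' $ k $ l * (A' $ k $ k - A' $ l $ l)) + (1 - \<alpha>) * (B' $ k $ l * (B' $ k $ k - B' $ l $ l)))"
    unfolding g_def
    by (rule derivative_eq_intros dc dd refl)+ (simp add: c0 d0 algebra_simps)
  from DERIV_local_max[OF this, of 1] max0 have "4 * (\<alpha> * (A' $ k $ l * (A' $ k $ k - A' $ l $ l)) + (1 - \<alpha>) * (B' $ k $ l * (B' $ k $ k - B' $ l $ l))) = 0"
    by simp
  then show ?thesis by simp
qed

text \<open>For an orthogonal matrix this characterizes signed permutations: rows are nonzero, so
  each has exactly one nonzero entry. Vanishing products within a row are what the analysis of the
  maximizers delivers.\<close>

definition monomial_matrix :: "real^'n^'n \<Rightarrow> bool" where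
  "monomial_matrix Q \<longleftrightarrow> (\<forall>k a b. a \<noteq> b \<longrightarrow> Q $ k $ a * Q $ k $ b = 0)"

text \<open>Conjugation by a signed permutation permutes the diagonal, since each sign occurs twice,
  and the objective is symmetric in the diagonal entries.\<close>

lemma compound_objective_monomial_mult:
  fixes Q :: "real^'n^'n"
  assumes Q: "orthogonal_matrix Q" "monomial_matrix Q"
  shows "compound_objective \<alpha> A B (Q ** U) = compound_objective \<alpha> A B U"
proof -
  have "\<exists>a. Q $ k $ a \<noteq> 0" for k
  proof (rule ccontr)
    assume "\<nexists>a. Q $ k $ a \<noteq> 0"
    then show False using orthogonal_matrix_inner_rows[OF Q(1), of k k] by simp
  qed
  then obtain \<sigma> where \<sigma>: "\<And>k. Q $ k $ \<sigma> k \<noteq> 0" by metis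
  have Q0: "Q $ k $ a = 0" if "a \<noteq> \<sigma> k" for k a
    using Q(2) \<sigma>[of k] that unfolding monomial_matrix_def by (metis mult_eq_0_iff)
  have S: "(\<Sum>a\<in>UNIV. Q $ k $ a * f a) = Q $ k $ \<sigma> k * f (\<sigma> k)" for k and f :: "'n \<Rightarrow> real"
    by (subst sum.remove[of _ "\<sigma> k"]) (auto simp: Q0 intro!: sum.neutral)
  have Q1: "Q $ k $ \<sigma> k * Q $ k $ \<sigma> k = 1" for k
    using orthogonal_matrix_inner_rows[OF Q(1), of k k] S[of k "\<lambda>a. Q $ k $ a"] by simp
  have "inj \<sigma>"
  proof (rule injI, rule ccontr)
    fix i j assume ij: "\<sigma> i = \<sigma> j" "i \<noteq> j"
    then show False
      using orthogonal_matrix_inner_rows[OF Q(1), of i j] S[of i "\<lambda>a. Q $ j $ a"] \<sigma>[of i] \<sigma>[of j] by simp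
  qed
  then have bij: "bij \<sigma>" using finite_UNIV_inj_surj[OF finite] by (simp add: bij_def)
  have row: "(Q ** U) $ k $ a = Q $ k $ \<sigma> k * U $ \<sigma> k $ a" for k a
    using S[of k "\<lambda>b. U $ b $ a"] by (simp add: matrix_matrix_mult_def)
  have "((Q ** U) ** X ** transpose (Q ** U)) $ k $ k = (U ** X ** transpose U) $ \<sigma> k $ \<sigma> k" for X k
  proof -
    have "((Q ** U) ** X ** transpose (Q ** U)) $ k $ k =
        (\<Sum>a\<in>UNIV. \<Sum>b\<in>UNIV. (Q $ k $ \<sigma> k * Q $ k $ \<sigma> k) * (U $ \<sigma> k $ a * U $ \<sigma> k $ b * X $ a $ b))"
      unfolding conj_matrix_component row by (intro sum.cong refl) (simp only: mult_ac)
    then show ?thesis by (simp add: Q1 conj_matrix_component)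
  qed
  then show ?thesis
    unfolding compound_objective_eq
    by (simp only: sum.reindex_bij_betw[OF bij, of "\<lambda>k. \<alpha> * ((U ** A ** transpose U) $ k $ k)\<^sup>2 + (1 - \<alpha>) * ((U ** B ** transpose U) $ k $ k)\<^sup>2"])
qed

section \<open>The population problem and its stability\<close>

abbreviation diag_matrix :: "('n \<Rightarrow> real) \<Rightarrow> real^'n^'n" where
  "diag_matrix a \<equiv> \<chi> i j. if i = j then a i else 0"

lemma conj_diag_matrix_component:
  fixes U :: "real^'n^'n"
  shows "(U ** diag_matrix d ** transpose U) $ k $ l = (\<Sum>a\<in>UNIV. U $ k $ a * U $ l $ a * d a)"
proof -
  have "(\<Sum>b\<in>UNIV. U $ k $ a * U $ l $ b * diag_matrix d $ a $ b) = U $ k $ a * U $ l $ a * d a" for a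
    by (subst sum.remove[of _ a]) (auto intro!: sum.neutral)
  then show ?thesis by (simp only: conj_matrix_component)
qed

text \<open>A variance is half the mean squared difference of two independent copies. In this form
  the loss of the objective away from signed permutations becomes a sum of explicit terms.\<close>

lemma weighted_variance_identity:
  fixes w d :: "'n::finite \<Rightarrow> real"
  assumes "(\<Sum>a\<in>UNIV. w a) = 1"
  shows "(\<Sum>a\<in>UNIV. w a * (d a)\<^sup>2) - (\<Sum>a\<in>UNIV. w a * d a)\<^sup>2 =
    (\<Sum>a\<in>UNIV. \<Sum>b\<in>UNIV. w a * w b * (d a - d b)\<^sup>2) / 2"
proof -
  have "(\<Sum>a\<in>UNIV. \<Sum>b\<in>UNIV. w a * w b * (d a - d b)\<^sup>2) =
     (\<Sum>a\<in>UNIV. \<Sum>b\<in>UNIV. (w a * (d a)\<^sup>2) * w b + w a * (w b * (d b)\<^sup>2) - (2 * (w a * d a)) * (w b * d b))"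
    by (intro sum.cong refl) (simp add: algebra_simps power2_eq_square)
  also have "\<dots> = (\<Sum>a\<in>UNIV. w a * (d a)\<^sup>2) * (\<Sum>b\<in>UNIV. w b) + (\<Sum>a\<in>UNIV. w a) * (\<Sum>b\<in>UNIV. w b * (d b)\<^sup>2)
      - (\<Sum>a\<in>UNIV. 2 * (w a * d a)) * (\<Sum>b\<in>UNIV. w b * d b)"
    by (simp only: sum.distrib sum_subtractf sum_product)
  finally show ?thesis using assms by (simp add: power2_eq_square sum_distrib_left[symmetric])
qed

text \<open>The squared entries of an orthogonal matrix are doubly stochastic. Column sums turn the
  value at the identity into a sum of weighted means of squares, while the value at U is a sum of
  squared weighted means, so the gap is a sum of variances. If the gap is not positive, all products
  of weights at two distinct positions of a row vanish, because their factors in \<open>sep\<close>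
  do not.\<close>

lemma diagonal_maximizer_monomial:
  fixes U :: "real^'n^'n"
  assumes U: "orthogonal_matrix U" and \<alpha>: "0 \<le> \<alpha>" "\<alpha> \<le> 1"
    and sep: "\<And>k l. k \<noteq> l \<Longrightarrow> \<alpha> * (c k - c l)\<^sup>2 + (1 - \<alpha>) * (d k - d l)\<^sup>2 \<noteq> 0"
    and le: "compound_objective \<alpha> (diag_matrix c) (diag_matrix d) (mat 1)
      \<le> compound_objective \<alpha> (diag_matrix c) (diag_matrix d) U"
  shows "monomial_matrix U"
proof -
  define w where "w k a = (U $ k $ a)\<^sup>2" for k a
  have w0: "w k a \<ge> 0" for k a by (simp add: w_def)
  have row: "(\<Sum>a\<in>UNIV. w k a) = 1" for k
    using orthogonal_matrix_inner_rows[OF U, of k k] by (simp add: w_def power2_eq_square)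
  have col: "(\<Sum>k\<in>UNIV. w k a) = 1" for a
    using orthogonal_matrix_inner_columns[OF U, of a a] by (simp add: w_def power2_eq_square)
  have obj: "compound_objective \<alpha> (diag_matrix c) (diag_matrix d) U =
      (\<Sum>k\<in>UNIV. \<alpha> * (\<Sum>a\<in>UNIV. w k a * c a)\<^sup>2 + (1 - \<alpha>) * (\<Sum>a\<in>UNIV. w k a * d a)\<^sup>2)"
    by (simp add: compound_objective_eq conj_diag_matrix_component w_def power2_eq_square)
  have total: "(\<Sum>k\<in>UNIV. \<Sum>a\<in>UNIV. w k a * x a) = (\<Sum>a\<in>UNIV. x a)" for x
    by (subst sum.swap) (simp add: sum_distrib_right[symmetric] col)
  have obj1: "compound_objective \<alpha> (diag_matrix c) (diag_matrix d) (mat 1) =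
      (\<Sum>k\<in>UNIV. \<alpha> * (\<Sum>a\<in>UNIV. w k a * (c a)\<^sup>2) + (1 - \<alpha>) * (\<Sum>a\<in>UNIV. w k a * (d a)\<^sup>2))"
  proof -
    have "(mat 1 ** X ** transpose (mat 1)) $ k $ k = X $ k $ k" for X :: "real^'n^'n" and k
      by (simp add: transpose_mat)
    then have "compound_objective \<alpha> (diag_matrix c) (diag_matrix d) (mat 1) =
        \<alpha> * (\<Sum>k\<in>UNIV. (c k)\<^sup>2) + (1 - \<alpha>) * (\<Sum>k\<in>UNIV. (d k)\<^sup>2)"
      by (simp add: compound_objective_eq sum.distrib sum_distrib_left)
    then show ?thesis by (simp add: sum.distrib sum_distrib_left[symmetric] total)
  qed
  define v where "v k a b = w k a * w k b * (\<alpha> * (c a - c b)\<^sup>2 + (1 - \<alpha>) * (d a - d b)\<^sup>2)" for k a b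
  have v0: "v k a b \<ge> 0" for k a b
    unfolding v_def using w0 \<alpha> by (intro mult_nonneg_nonneg add_nonneg_nonneg) auto
  have V: "(\<Sum>k\<in>UNIV. \<Sum>a\<in>UNIV. \<Sum>b\<in>UNIV. v k a b) / 2 =
    (\<Sum>k\<in>UNIV. \<alpha> * ((\<Sum>a\<in>UNIV. \<Sum>b\<in>UNIV. w k a * w k b * (c a - c b)\<^sup>2) / 2)
      + (1 - \<alpha>) * ((\<Sum>a\<in>UNIV. \<Sum>b\<in>UNIV. w k a * w k b * (d a - d b)\<^sup>2) / 2))"
    by (simp add: v_def sum_distrib_left sum_divide_distrib sum.distrib[symmetric] field_simps)
  have "a * (x - y) + b * (x' - y') = a * x + b * x' - (a * y + b * y')" for a b x y x' y' :: real
    by (simp add: algebra_simps)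
  then have "(\<Sum>k\<in>UNIV. \<alpha> * ((\<Sum>a\<in>UNIV. \<Sum>b\<in>UNIV. w k a * w k b * (c a - c b)\<^sup>2) / 2)
      + (1 - \<alpha>) * ((\<Sum>a\<in>UNIV. \<Sum>b\<in>UNIV. w k a * w k b * (d a - d b)\<^sup>2) / 2))
    = compound_objective \<alpha> (diag_matrix c) (diag_matrix d) (mat 1)
      - compound_objective \<alpha> (diag_matrix c) (diag_matrix d) U"
    unfolding obj obj1 sum_subtractf[symmetric]
    unfolding weighted_variance_identity[OF row, symmetric]
    by (intro sum.cong refl) blast
  with V have "(\<Sum>k\<in>UNIV. \<Sum>a\<in>UNIV. \<Sum>b\<in>UNIV. v k a b) \<le> 0" using le by simp
  then have "(\<Sum>k\<in>UNIV. \<Sum>a\<in>UNIV. \<Sum>b\<in>UNIV. v k a b) = 0"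
    by (intro antisym sum_nonneg v0)
  then have "v k a b = 0" for k a b
    by (simp add: sum_nonneg_eq_0_iff sum_nonneg v0)
  then show ?thesis
    using sep unfolding monomial_matrix_def v_def w_def by fastforce
qed

text \<open>Entries of a signed permutation are 0, 1 or -1, so the identity is isolated among them.
  Radius 1/2 forces diagonal entries of at least 1/2, hence equal to 1; the same radius is used in
  the selection of maximizers.\<close>

lemma monomial_near_identity:
  fixes Q :: "real^'n^'n"
  assumes Q: "orthogonal_matrix Q" "monomial_matrix Q" and near: "norm (Q - mat 1) \<le> 1/2"
  shows "Q = mat 1"
proof -
  have d: "Q $ k $ k \<ge> 1/2" for k
  proof -
    have "\<bar>(Q - mat 1) $ k $ k\<bar> \<le> norm (Q - mat 1)"
      using component_le_norm_cart[of "(Q - mat 1) $ k" k] Finite_Cartesian_Product.norm_nth_le[of "Q - mat 1" k] by linarith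
    then show ?thesis using near by (simp add: mat_def abs_le_iff)
  qed
  have o: "Q $ k $ a = 0" if "a \<noteq> k" for k a
  proof -
    have "Q $ k $ a * Q $ k $ k = 0" using Q(2) that by (simp add: monomial_matrix_def)
    then show ?thesis using d[of k] by auto
  qed
  have "Q $ k $ k * Q $ k $ k = 1" for k
    using orthogonal_matrix_inner_rows[OF Q(1), of k k] sum.remove[of UNIV k "\<lambda>a. Q $ k $ a * Q $ k $ a"]
    by (simp add: o)
  then have "Q $ k $ k = 1" for k
    using d[of k] square_eq_1_iff[of "Q $ k $ k"] by fastforce
  then show ?thesis by (simp add: vec_eq_iff mat_def o)
qed

text \<open>Solutions are determined only up to the action of signed permutations, so one may move a
  solution by the inverse of the limiting signed permutation.\<close>

lemma maximizers_near_identity: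
  fixes c d :: "'n::finite \<Rightarrow> real"
  assumes \<alpha>: "0 \<le> \<alpha>" "\<alpha> \<le> 1"
    and sep: "\<And>k l. k \<noteq> l \<Longrightarrow> \<alpha> * (c k - c l)\<^sup>2 + (1 - \<alpha>) * (d k - d l)\<^sup>2 \<noteq> 0"
    and \<epsilon>: "\<epsilon> > 0"
  shows "\<exists>\<delta>>0. \<forall>A B. norm (A - diag_matrix c) < \<delta> \<and> norm (B - diag_matrix d) < \<delta> \<longrightarrow>
    (\<exists>U. is_arg_max (compound_objective \<alpha> A B) orthogonal_matrix U \<and> norm (U - mat 1) \<le> \<epsilon>) \<and>
    (\<forall>U. is_arg_max (compound_objective \<alpha> A B) orthogonal_matrix U \<and> norm (U - mat 1) \<le> 1/2
      \<longrightarrow> norm (U - mat 1) \<le> \<epsilon>)"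
proof (rule ccontr)
  assume neg: "\<not> ?thesis"
  \<comment> \<open>The failure of the claim at tolerance 1 / (n + 1). A maximizer U is recorded in
    both cases, also when it is the existence of a close maximizer that fails.\<close>
  define P where "P n A B U \<longleftrightarrow> norm (A - diag_matrix c) < inverse (real (Suc n)) \<and>
      norm (B - diag_matrix d) < inverse (real (Suc n)) \<and>
      is_arg_max (compound_objective \<alpha> A B) orthogonal_matrix U \<and>
      ((\<forall>V. is_arg_max (compound_objective \<alpha> A B) orthogonal_matrix V \<longrightarrow> \<not> norm (V - mat 1) \<le> \<epsilon>) \<or>
        (norm (U - mat 1) \<le> 1/2 \<and> \<not> norm (U - mat 1) \<le> \<epsilon>))" for n A B U
  have "\<exists>A B U. P n A B U" for n
  proof -
    have "inverse (real (Suc n)) > 0" by simp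
    then obtain A B where AB: "norm (A - diag_matrix c) < inverse (real (Suc n))"
        "norm (B - diag_matrix d) < inverse (real (Suc n))"
      and or: "(\<forall>V. is_arg_max (compound_objective \<alpha> A B) orthogonal_matrix V \<longrightarrow> \<not> norm (V - mat 1) \<le> \<epsilon>) \<or>
        (\<exists>U. is_arg_max (compound_objective \<alpha> A B) orthogonal_matrix U \<and> norm (U - mat 1) \<le> 1/2 \<and> \<not> norm (U - mat 1) \<le> \<epsilon>)"
      using neg by meson
    obtain U0 where "is_arg_max (compound_objective \<alpha> A B) orthogonal_matrix U0"
      by (rule compound_objective_attains_max)
    then show ?thesis using AB or unfolding P_def by blast
  qed
  then obtain A B U where P: "\<And>n. P n (A n) (B n) (U n)" by metis
  then have A: "\<And>n. norm (A n - diag_matrix c) < inverse (real (Suc n))"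
    and B: "\<And>n. norm (B n - diag_matrix d) < inverse (real (Suc n))"
    and U: "\<And>n. is_arg_max (compound_objective \<alpha> (A n) (B n)) orthogonal_matrix (U n)"
    and or: "\<And>n. (\<forall>V. is_arg_max (compound_objective \<alpha> (A n) (B n)) orthogonal_matrix V \<longrightarrow> \<not> norm (V - mat 1) \<le> \<epsilon>) \<or>
        (norm (U n - mat 1) \<le> 1/2 \<and> \<not> norm (U n - mat 1) \<le> \<epsilon>)"
    unfolding P_def by blast+
  have inv0: "(\<lambda>n. inverse (real (Suc n))) \<longlonglongrightarrow> 0" by (rule LIMSEQ_inverse_real_of_nat)
  have "(\<lambda>n. A n - diag_matrix c) \<longlonglongrightarrow> 0"
    by (rule Lim_null_comparison[OF _ inv0]) (use A in \<open>auto intro!: always_eventually less_imp_le\<close>)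
  then have A_lim: "A \<longlonglongrightarrow> diag_matrix c" by (simp add: LIM_zero_iff)
  have "(\<lambda>n. B n - diag_matrix d) \<longlonglongrightarrow> 0"
    by (rule Lim_null_comparison[OF _ inv0]) (use B in \<open>auto intro!: always_eventually less_imp_le\<close>)
  then have B_lim: "B \<longlonglongrightarrow> diag_matrix d" by (simp add: LIM_zero_iff)
  have orth: "orthogonal_matrix (U n)" for n using U by (rule is_arg_maxD)
  then obtain Q \<rho> where Q: "orthogonal_matrix Q" and \<rho>: "strict_mono \<rho>" and U_lim: "(U \<circ> \<rho>) \<longlonglongrightarrow> Q"
    using compact_orthogonal_matrix unfolding compact_def by (metis mem_Collect_eq)
  have A_lim': "(\<lambda>n. A (\<rho> n)) \<longlonglongrightarrow> diag_matrix c" and B_lim': "(\<lambda>n. B (\<rho> n)) \<longlonglongrightarrow> diag_matrix d"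
    using LIMSEQ_subseq_LIMSEQ[OF A_lim \<rho>] LIMSEQ_subseq_LIMSEQ[OF B_lim \<rho>] by (simp_all add: o_def)
  have U_lim': "(\<lambda>n. U (\<rho> n)) \<longlonglongrightarrow> Q" using U_lim by (simp add: o_def)
  have "compound_objective \<alpha> (diag_matrix c) (diag_matrix d) (mat 1)
      \<le> compound_objective \<alpha> (diag_matrix c) (diag_matrix d) Q"
    by (rule tendsto_le[OF _ tendsto_compound_objective[OF A_lim' B_lim' U_lim']
          tendsto_compound_objective[OF A_lim' B_lim' tendsto_const]])
       (auto intro!: always_eventually is_arg_maxD(2)[OF U] orthogonal_matrix_id)
  then have Qm: "monomial_matrix Q"
    by (intro diagonal_maximizer_monomial[where \<alpha> = \<alpha> and c = c and d = d] Q \<alpha> sep)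
  have V: "is_arg_max (compound_objective \<alpha> (A n) (B n)) orthogonal_matrix (transpose Q ** U n)" for n
  proof -
    have "Q ** (transpose Q ** U n) = U n"
      using Q by (simp add: matrix_mul_assoc orthogonal_matrix_def)
    then have "compound_objective \<alpha> (A n) (B n) (transpose Q ** U n) = compound_objective \<alpha> (A n) (B n) (U n)"
      using compound_objective_monomial_mult[OF Q Qm, of \<alpha> "A n" "B n" "transpose Q ** U n"] by simp
    moreover have "orthogonal_matrix (transpose Q ** U n)"
      using Q orth[of n] by (simp add: orthogonal_matrix_mul)
    ultimately show ?thesis using U[of n] by (simp add: is_arg_max_def)
  qed
  \<comment> \<open>The transported maximizers tend to Q^T Q = I, so along the subsequence close
    maximizers do exist and only the second alternative of \<open>or\<close> is left.\<close>
  have "(\<lambda>n. transpose Q ** U (\<rho> n)) \<longlonglongrightarrow> transpose Q ** Q"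
    by (intro vec_tendstoI) (simp add: matrix_matrix_mult_def,
        intro tendsto_sum tendsto_mult tendsto_const tendsto_vec_nth U_lim')
  then have "(\<lambda>n. transpose Q ** U (\<rho> n) - mat 1) \<longlonglongrightarrow> 0"
    using Q by (simp add: orthogonal_matrix_def LIM_zero_iff)
  then have "\<forall>\<^sub>F n in sequentially. norm (transpose Q ** U (\<rho> n) - mat 1) < \<epsilon>"
    using order_tendstoD(2)[OF tendsto_norm_zero \<epsilon>] by blast
  then have ev: "\<forall>\<^sub>F n in sequentially. norm (U (\<rho> n) - mat 1) \<le> 1/2 \<and> \<not> norm (U (\<rho> n) - mat 1) \<le> \<epsilon>"
    by eventually_elim (use or V less_imp_le in blast)
  have N: "(\<lambda>n. norm (U (\<rho> n) - mat 1)) \<longlonglongrightarrow> norm (Q - mat 1)"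
    by (intro tendsto_intros U_lim')
  \<comment> \<open>The limit Q inherits the bound 1/2; as a signed permutation it must be I, which
    contradicts that the U stay farther than \<epsilon> from I.\<close>
  have "norm (Q - mat 1) \<le> 1/2"
    by (rule tendsto_upperbound[OF N]) (use ev in \<open>auto elim: eventually_mono\<close>)
  then have "Q = mat 1" by (rule monomial_near_identity[OF Q Qm])
  then have "(\<lambda>n. norm (U (\<rho> n) - mat 1)) \<longlonglongrightarrow> 0" using N by simp
  then have "\<forall>\<^sub>F n in sequentially. norm (U (\<rho> n) - mat 1) < \<epsilon>" using \<epsilon> by (rule order_tendstoD)
  with ev have "\<forall>\<^sub>F n in sequentially. False" by eventually_elim auto
  then show False by simp
qed

section \<open>First-order expansions along a filter\<close>

text \<open>Stands for x = x0 + \<tau> x' + o(\<tau>). The coefficient x' is a bounded function and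
  not a number, because it will be a scaled random deviation; it is determined up to o(1).\<close>

definition expands :: "'a filter \<Rightarrow> ('a \<Rightarrow> real) \<Rightarrow> ('a \<Rightarrow> real) \<Rightarrow> real \<Rightarrow> ('a \<Rightarrow> real) \<Rightarrow> bool" where
  "expands F \<tau> x x0 x' \<longleftrightarrow> Bfun x' F \<and> ((\<lambda>p. (x p - x0) / \<tau> p - x' p) \<longlongrightarrow> 0) F"

section \<open>Bounded and null functions along a filter, and rules for expansions\<close>

lemma Bfun_real_iff: "Bfun (f :: 'a \<Rightarrow> real) F \<longleftrightarrow> (\<exists>K. \<forall>\<^sub>F x in F. \<bar>f x\<bar> \<le> K)"
proof
  assume "Bfun f F"
  then show "\<exists>K. \<forall>\<^sub>F x in F. \<bar>f x\<bar> \<le> K" unfolding Bfun_def real_norm_def by blast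
next
  assume "\<exists>K. \<forall>\<^sub>F x in F. \<bar>f x\<bar> \<le> K"
  then show "Bfun f F" by (metis (mono_tags, lifting) BfunI eventually_mono real_norm_def)
qed

lemma Bfun_real_add:
  fixes f g :: "'a \<Rightarrow> real"
  assumes "Bfun f F" "Bfun g F"
  shows "Bfun (\<lambda>x. f x + g x) F"
proof -
  obtain K L where "\<forall>\<^sub>F x in F. \<bar>f x\<bar> \<le> K" "\<forall>\<^sub>F x in F. \<bar>g x\<bar> \<le> L"
    using assms by (auto simp: Bfun_real_iff)
  then have "\<forall>\<^sub>F x in F. \<bar>f x + g x\<bar> \<le> K + L" by eventually_elim linarith
  then show ?thesis by (auto simp: Bfun_real_iff)
qed

lemma Bfun_real_mult:
  fixes f g :: "'a \<Rightarrow> real"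
  assumes "Bfun f F" "Bfun g F"
  shows "Bfun (\<lambda>x. f x * g x) F"
proof -
  obtain K L where "\<forall>\<^sub>F x in F. \<bar>f x\<bar> \<le> K" "\<forall>\<^sub>F x in F. \<bar>g x\<bar> \<le> L"
    using assms by (auto simp: Bfun_real_iff)
  then have "\<forall>\<^sub>F x in F. \<bar>f x * g x\<bar> \<le> K * L"
    by eventually_elim (auto simp: abs_mult intro!: mult_mono)
  then show ?thesis by (auto simp: Bfun_real_iff)
qed

lemma Bfun_real_sum:
  fixes f :: "'i \<Rightarrow> 'a \<Rightarrow> real"
  assumes "\<And>i. i \<in> I \<Longrightarrow> Bfun (f i) F"
  shows "Bfun (\<lambda>x. \<Sum>i\<in>I. f i x) F"
  using assms by (induction I rule: infinite_finite_induct) (auto intro: Bfun_real_add)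

lemma Bfun_real_diff:
  fixes f g :: "'a \<Rightarrow> real"
  assumes "Bfun f F" "Bfun g F"
  shows "Bfun (\<lambda>x. f x - g x) F"
  using Bfun_real_add[OF assms(1) Bfun_real_mult[OF Bfun_const[of "-1"] assms(2)]] by simp

lemma tendsto_0_Bfun: "(f \<longlongrightarrow> (0::real)) F \<Longrightarrow> Bfun f F"
proof -
  assume "(f \<longlongrightarrow> 0) F"
  then have "\<forall>\<^sub>F x in F. dist (f x) 0 < 1" by (rule tendstoD) simp
  then have "\<forall>\<^sub>F x in F. \<bar>f x\<bar> \<le> 1" by eventually_elim simp
  then show ?thesis by (auto simp: Bfun_real_iff)
qed

lemma tendsto_0_mult_Bfun:
  fixes f g :: "'a \<Rightarrow> real"
  assumes "(f \<longlongrightarrow> 0) F" "Bfun g F"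
  shows "((\<lambda>x. f x * g x) \<longlongrightarrow> 0) F"
proof -
  obtain K where K: "\<forall>\<^sub>F x in F. \<bar>g x\<bar> \<le> K" using assms(2) by (auto simp: Bfun_real_iff)
  have "((\<lambda>x. \<bar>f x\<bar> * K) \<longlongrightarrow> 0) F"
    by (rule tendsto_mult_left_zero[OF tendsto_rabs_zero[OF assms(1)]])
  moreover have "\<forall>\<^sub>F x in F. norm (f x * g x) \<le> \<bar>f x\<bar> * K"
    using K by eventually_elim (auto simp: abs_mult intro!: mult_left_mono)
  ultimately show ?thesis by (rule Lim_null_comparison[rotated])
qed

lemma expands_quotient_Bfun: "expands F \<tau> x x0 x' \<Longrightarrow> Bfun (\<lambda>p. (x p - x0) / \<tau> p) F"
  unfolding expands_def using Bfun_real_add[of "\<lambda>p. (x p - x0) / \<tau> p - x' p" F x'] tendsto_0_Bfun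
  by auto

lemma expands_const: "expands F \<tau> (\<lambda>_. c) c (\<lambda>_. 0)"
  by (simp add: expands_def)

lemma expands_quotient:
  "Bfun (\<lambda>p. (x p - x0) / \<tau> p) F \<Longrightarrow> expands F \<tau> x x0 (\<lambda>p. (x p - x0) / \<tau> p)"
  by (simp add: expands_def)

lemma expands_cong_deriv:
  assumes "expands F \<tau> x x0 x'" "((\<lambda>p. x' p - x'' p) \<longlongrightarrow> 0) F"
  shows "expands F \<tau> x x0 x''"
proof -
  have "Bfun (\<lambda>p. x' p - (x' p - x'' p)) F"
    by (rule Bfun_real_diff[OF _ tendsto_0_Bfun[OF assms(2)]]) (use assms(1) in \<open>simp add: expands_def\<close>)
  moreover have "((\<lambda>p. ((x p - x0) / \<tau> p - x' p) + (x' p - x'' p)) \<longlongrightarrow> 0 + 0) F"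
    by (rule tendsto_add[OF _ assms(2)]) (use assms(1) in \<open>simp add: expands_def\<close>)
  ultimately show ?thesis by (simp add: expands_def)
qed

text \<open>Converts an exact equation, such as whitening or stationarity, into an asymptotic linear
  relation between first-order coefficients.\<close>

lemma expands_eventually_const:
  assumes "expands F \<tau> x x0 x'" "\<forall>\<^sub>F p in F. x p = x0"
  shows "(x' \<longlongrightarrow> 0) F"
proof -
  have "\<forall>\<^sub>F p in F. (x p - x0) / \<tau> p - x' p = - x' p"
    using assms(2) by eventually_elim simp
  from tendsto_cong[OF this] have "((\<lambda>p. - x' p) \<longlongrightarrow> 0) F"
    using assms(1) unfolding expands_def by blast
  then show ?thesis using tendsto_minus_cancel[of x' 0 F] by simp
qed

lemma expands_add:
  assumes "expands F \<tau> x x0 x'" "expands F \<tau> y y0 y'"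
  shows "expands F \<tau> (\<lambda>p. x p + y p) (x0 + y0) (\<lambda>p. x' p + y' p)"
proof -
  have "((\<lambda>p. ((x p - x0) / \<tau> p - x' p) + ((y p - y0) / \<tau> p - y' p)) \<longlongrightarrow> 0 + 0) F"
    using assms unfolding expands_def by (intro tendsto_add) auto
  then show ?thesis
    using assms by (simp add: expands_def Bfun_real_add algebra_simps add_divide_distrib diff_divide_distrib)
qed

lemma expands_mult:
  assumes x: "expands F \<tau> x x0 x'" and y: "expands F \<tau> y y0 y'" and \<tau>: "(\<tau> \<longlongrightarrow> 0) F"
  shows "expands F \<tau> (\<lambda>p. x p * y p) (x0 * y0) (\<lambda>p. x' p * y0 + x0 * y' p)"
proof -
  have B: "Bfun (\<lambda>p. (x p - x0) / \<tau> p * ((y p - y0) / \<tau> p)) F"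
    by (intro Bfun_real_mult expands_quotient_Bfun[OF x] expands_quotient_Bfun[OF y])
  have "((\<lambda>p. ((x p - x0) / \<tau> p - x' p) * y0 + x0 * ((y p - y0) / \<tau> p - y' p) +
      \<tau> p * ((x p - x0) / \<tau> p * ((y p - y0) / \<tau> p))) \<longlongrightarrow> 0 * y0 + x0 * 0 + 0) F"
    using x y unfolding expands_def
    by (intro tendsto_add tendsto_mult tendsto_const tendsto_0_mult_Bfun[OF \<tau> B]) auto
  \<comment> \<open>The product of the two deviations carries an extra factor \<tau>. The identity
    also holds at \<tau> = 0, where both quotients are 0 by convention.\<close>
  moreover have "(x p * y p - x0 * y0) / \<tau> p - (x' p * y0 + x0 * y' p) =
      ((x p - x0) / \<tau> p - x' p) * y0 + x0 * ((y p - y0) / \<tau> p - y' p) +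
      \<tau> p * ((x p - x0) / \<tau> p * ((y p - y0) / \<tau> p))" for p
    by (cases "\<tau> p = 0") (simp_all add: field_simps)
  moreover have "Bfun (\<lambda>p. x' p * y0 + x0 * y' p) F"
    using x y unfolding expands_def by (intro Bfun_real_add Bfun_real_mult Bfun_const) auto
  ultimately show ?thesis by (simp add: expands_def)
qed

lemma expands_cmult:
  assumes "expands F \<tau> x x0 x'"
  shows "expands F \<tau> (\<lambda>p. c * x p) (c * x0) (\<lambda>p. c * x' p)"
proof -
  have "((\<lambda>p. c * ((x p - x0) / \<tau> p - x' p)) \<longlongrightarrow> c * 0) F"
    using assms unfolding expands_def by (intro tendsto_mult tendsto_const) auto
  moreover have "c * ((x p - x0) / \<tau> p - x' p) = (c * x p - c * x0) / \<tau> p - c * x' p" for p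
    by (simp add: right_diff_distrib)
  ultimately show ?thesis
    using assms by (simp add: expands_def Bfun_real_mult)
qed

lemma expands_diff:
  assumes "expands F \<tau> x x0 x'" "expands F \<tau> y y0 y'"
  shows "expands F \<tau> (\<lambda>p. x p - y p) (x0 - y0) (\<lambda>p. x' p - y' p)"
  using expands_add[OF assms(1) expands_cmult[OF assms(2), of "-1"]] by simp

lemma expands_sum:
  assumes "\<And>i. i \<in> I \<Longrightarrow> expands F \<tau> (x i) (x0 i) (x' i)"
  shows "expands F \<tau> (\<lambda>p. \<Sum>i\<in>I. x i p) (\<Sum>i\<in>I. x0 i) (\<lambda>p. \<Sum>i\<in>I. x' i p)"
  using assms by (induction I rule: infinite_finite_induct) (auto intro: expands_add expands_const)

lemma expands_eq:
  "expands F \<tau> x x0 x' \<Longrightarrow> x0 = y0 \<Longrightarrow> (\<And>p. x' p = y' p) \<Longrightarrow> expands F \<tau> x y0 y'"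
  by (metis ext)

lemma expands_tendsto:
  assumes x: "expands F \<tau> x x0 x'" and \<tau>: "(\<tau> \<longlongrightarrow> 0) F" and pos: "\<forall>\<^sub>F p in F. \<tau> p > 0"
  shows "(x \<longlongrightarrow> x0) F"
proof -
  have "((\<lambda>p. x0 + \<tau> p * ((x p - x0) / \<tau> p)) \<longlongrightarrow> x0 + 0) F"
    by (intro tendsto_add tendsto_const tendsto_0_mult_Bfun[OF \<tau> expands_quotient_Bfun[OF x]])
  moreover have "\<forall>\<^sub>F p in F. x0 + \<tau> p * ((x p - x0) / \<tau> p) = x p"
    using pos by eventually_elim simp
  ultimately show ?thesis by (simp add: tendsto_cong)
qed

lemma sum_delta_mult:
  fixes f :: "'n::finite \<Rightarrow> real"
  shows "(\<Sum>a\<in>UNIV. (if k = a then 1 else 0) * f a) = f k" "(\<Sum>a\<in>UNIV. (if a = k then 1 else 0) * f a) = f k"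
    "(\<Sum>a\<in>UNIV. f a * (if k = a then 1 else 0)) = f k" "(\<Sum>a\<in>UNIV. f a * (if a = k then 1 else 0)) = f k"
  by (simp_all add: if_distrib[of "\<lambda>x. x * _"] if_distrib[of "\<lambda>x. _ * x"] cong: if_cong)

text \<open>The first variation of W S W^T at W = I and S = D diagonal is S' + W' D + D W'^T, read
  off componentwise.\<close>

lemma expands_congruence:
  fixes W :: "'n::finite \<Rightarrow> 'n \<Rightarrow> 'a \<Rightarrow> real"
  assumes W: "\<And>i j. expands F \<tau> (W i j) (if i = j then 1 else 0) (W' i j)"
    and S: "\<And>i j. expands F \<tau> (S i j) (if i = j then d i else 0) (S' i j)" and \<tau>: "(\<tau> \<longlongrightarrow> 0) F"
  shows "expands F \<tau> (\<lambda>p. \<Sum>a\<in>UNIV. \<Sum>b\<in>UNIV. W k a p * W l b p * S a b p)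
    (if k = l then d k else 0) (\<lambda>p. S' k l p + W' k l p * d l + W' l k p * d k)"
proof -
  have 1: "expands F \<tau> (\<lambda>p. \<Sum>a\<in>UNIV. W k a p * S a b p) (if k = b then d k else 0)
      (\<lambda>p. W' k b p * d b + S' k b p)" for k b
    by (rule expands_eq[OF expands_sum[OF expands_mult[OF W S \<tau>]]])
      (simp_all add: sum_delta_mult sum.distrib
        if_distrib[of "\<lambda>x. _ * x"] cong: if_cong)
  have 2: "expands F \<tau> (\<lambda>p. \<Sum>b\<in>UNIV. W l b p * (\<Sum>a\<in>UNIV. W k a p * S a b p)) (if k = l then d k else 0)
      (\<lambda>p. S' k l p + W' k l p * d l + W' l k p * d k)"
    by (rule expands_eq[OF expands_sum[OF expands_mult[OF W 1 \<tau>]]])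
      (auto simp: sum_delta_mult sum.distrib
        if_distrib[of "\<lambda>x. _ * x"] cong: if_cong)
  have "(\<Sum>b\<in>UNIV. W l b p * (\<Sum>a\<in>UNIV. W k a p * S a b p)) =
      (\<Sum>a\<in>UNIV. \<Sum>b\<in>UNIV. W k a p * W l b p * S a b p)" for p
    by (subst sum.swap) (simp add: sum_distrib_left mult_ac)
  then show ?thesis using 2 by simp
qed

text \<open>The central sample moments of order at most four as polynomials in the raw ones.\<close>

definition cen2 :: "('n \<Rightarrow> real) \<Rightarrow> ('n \<Rightarrow> 'n \<Rightarrow> real) \<Rightarrow> 'n \<Rightarrow> 'n \<Rightarrow> real" where
  "cen2 m1 m2 i j = m2 i j - m1 i * m1 j"

definition cen3 :: "('n \<Rightarrow> real) \<Rightarrow> ('n \<Rightarrow> 'n \<Rightarrow> real) \<Rightarrow> ('n \<Rightarrow> 'n \<Rightarrow> 'n \<Rightarrow> real) \<Rightarrow> 'n \<Rightarrow> 'n \<Rightarrow> 'n \<Rightarrow> real" where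
  "cen3 m1 m2 m3 i j k = m3 i j k - m1 i * m2 j k - m1 j * m2 i k - m1 k * m2 i j
     + 2 * (m1 i * (m1 j * m1 k))"

definition cen4 :: "('n \<Rightarrow> real) \<Rightarrow> ('n \<Rightarrow> 'n \<Rightarrow> real) \<Rightarrow> ('n \<Rightarrow> 'n \<Rightarrow> 'n \<Rightarrow> real) \<Rightarrow>
    ('n \<Rightarrow> 'n \<Rightarrow> 'n \<Rightarrow> 'n \<Rightarrow> real) \<Rightarrow> 'n \<Rightarrow> 'n \<Rightarrow> 'n \<Rightarrow> 'n \<Rightarrow> real" where
  "cen4 m1 m2 m3 m4 i j k l = m4 i j k l
     - m1 i * m3 j k l - m1 j * m3 i k l - m1 k * m3 i j l - m1 l * m3 i j k
     + m1 i * (m1 j * m2 k l) + m1 i * (m1 k * m2 j l) + m1 i * (m1 l * m2 j k)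
     + m1 j * (m1 k * m2 i l) + m1 j * (m1 l * m2 i k) + m1 k * (m1 l * m2 i j)
     - 3 * (m1 i * (m1 j * (m1 k * m1 l)))"

text \<open>The joint moments of independent standardized variables with third moments \<open>\<gamma>\<close> and excess
  kurtoses \<open>\<kappa>\<close>.\<close>

definition mom2 :: "'n \<Rightarrow> 'n \<Rightarrow> real" where
  "mom2 i j = (if i = j then 1 else 0)"

definition mom3 :: "('n \<Rightarrow> real) \<Rightarrow> 'n \<Rightarrow> 'n \<Rightarrow> 'n \<Rightarrow> real" where
  "mom3 \<gamma> i j k = (if i = j \<and> j = k then \<gamma> i else 0)"

definition mom4 :: "('n \<Rightarrow> real) \<Rightarrow> 'n \<Rightarrow> 'n \<Rightarrow> 'n \<Rightarrow> 'n \<Rightarrow> real" where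
  "mom4 \<kappa> i j k l = mom2 i j * mom2 k l + mom2 i k * mom2 j l + mom2 i l * mom2 j k
     + (if i = j \<and> j = k \<and> k = l then \<kappa> i else 0)"

text \<open>The linear part of \<open>W - I\<close> in terms of the deviations of the raw sample moments.\<close>

definition lin_part :: "real \<Rightarrow> ('n::finite \<Rightarrow> real) \<Rightarrow> ('n \<Rightarrow> real) \<Rightarrow> 'n \<Rightarrow> 'n \<Rightarrow>
    ('n \<Rightarrow> real) \<Rightarrow> ('n \<Rightarrow> 'n \<Rightarrow> real) \<Rightarrow> ('n \<Rightarrow> 'n \<Rightarrow> 'n \<Rightarrow> real) \<Rightarrow>
    ('n \<Rightarrow> 'n \<Rightarrow> 'n \<Rightarrow> 'n \<Rightarrow> real) \<Rightarrow> real" where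
  "lin_part \<alpha> \<gamma> \<kappa> k l a1 a2 a3 a4 =
    (if k = l then - (a2 k k / 2) else
      (\<alpha> * ((\<gamma> k - \<gamma> l) * ((\<Sum>j\<in>UNIV. a3 j k l) - a1 k - a1 l - \<gamma> k * a2 k l))
       + (1 - \<alpha>) * ((\<kappa> k - \<kappa> l) * ((\<Sum>j\<in>UNIV. a4 j j k l) - \<gamma> l * a1 k - \<gamma> k * a1 l
           - (\<kappa> k + real CARD('n) + 4) * a2 k l)))
      / (\<alpha> * (\<gamma> k - \<gamma> l)\<^sup>2 + (1 - \<alpha>) * (\<kappa> k - \<kappa> l)\<^sup>2))"

lemma lin_part_scale:
  "lin_part \<alpha> \<gamma> \<kappa> k l (\<lambda>i. c * a1 i) (\<lambda>i j. c * a2 i j) (\<lambda>i j h. c * a3 i j h) (\<lambda>i j h m. c * a4 i j h m)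
    = c * lin_part \<alpha> \<gamma> \<kappa> k l a1 a2 a3 a4"
  by (simp add: lin_part_def sum_distrib_left[symmetric] algebra_simps add_divide_distrib diff_divide_distrib)

section \<open>Linearized whitening and stationarity at an arbitrary scale\<close>

context
  fixes F :: "'a filter" and \<tau> :: "'a \<Rightarrow> real"
    and m1 :: "'n::finite \<Rightarrow> 'a \<Rightarrow> real" and m2 :: "'n \<Rightarrow> 'n \<Rightarrow> 'a \<Rightarrow> real"
    and m3 :: "'n \<Rightarrow> 'n \<Rightarrow> 'n \<Rightarrow> 'a \<Rightarrow> real" and m4 :: "'n \<Rightarrow> 'n \<Rightarrow> 'n \<Rightarrow> 'n \<Rightarrow> 'a \<Rightarrow> real"
    and m1' :: "'n::finite \<Rightarrow> 'a \<Rightarrow> real" and m2' :: "'n \<Rightarrow> 'n \<Rightarrow> 'a \<Rightarrow> real"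
    and m3' :: "'n \<Rightarrow> 'n \<Rightarrow> 'n \<Rightarrow> 'a \<Rightarrow> real" and m4' :: "'n \<Rightarrow> 'n \<Rightarrow> 'n \<Rightarrow> 'n \<Rightarrow> 'a \<Rightarrow> real"
    and \<gamma> \<kappa> :: "'n \<Rightarrow> real" and \<alpha> :: real
    and V W V' W' :: "'n \<Rightarrow> 'n \<Rightarrow> 'a \<Rightarrow> real"
  assumes \<tau>: "(\<tau> \<longlongrightarrow> 0) F"
    and m1: "\<And>i. expands F \<tau> (m1 i) 0 (m1' i)"
    and m2: "\<And>i j. expands F \<tau> (m2 i j) (mom2 i j) (m2' i j)"
    and m3: "\<And>i j k. expands F \<tau> (m3 i j k) (mom3 \<gamma> i j k) (m3' i j k)"
    and m4: "\<And>i j k l. \<alpha> \<noteq> 1 \<Longrightarrow> expands F \<tau> (m4 i j k l) (mom4 \<kappa> i j k l) (m4' i j k l)"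
    and V: "\<And>i j. expands F \<tau> (V i j) (if i = j then 1 else 0) (V' i j)"
    and W: "\<And>i j. expands F \<tau> (W i j) (if i = j then 1 else 0) (W' i j)"
    and m2'_sym: "\<And>i j p. m2' i j p = m2' j i p"
begin

private abbreviation "c2 i j p \<equiv> cen2 (\<lambda>i. m1 i p) (\<lambda>i j. m2 i j p) i j"
private abbreviation "c3 i j k p \<equiv> cen3 (\<lambda>i. m1 i p) (\<lambda>i j. m2 i j p) (\<lambda>i j k. m3 i j k p) i j k"
private abbreviation "c4 i j k l p \<equiv> cen4 (\<lambda>i. m1 i p) (\<lambda>i j. m2 i j p) (\<lambda>i j k. m3 i j k p)
  (\<lambda>i j k l. m4 i j k l p) i j k l"

lemma expands_cen2: "expands F \<tau> (c2 i j) (if i = j then 1 else 0) (m2' i j)"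
  unfolding cen2_def
  by (rule expands_eq[OF expands_diff[OF m2 expands_mult[OF m1 m1 \<tau>]]]) (simp_all add: mom2_def)

lemma expands_cen3: "expands F \<tau> (c3 i j k) (mom3 \<gamma> i j k)
   (\<lambda>p. m3' i j k p - m1' i p * mom2 j k - m1' j p * mom2 i k - m1' k p * mom2 i j)"
  unfolding cen3_def
  by (rule expands_eq, (rule expands_add expands_diff expands_cmult expands_mult[OF _ _ \<tau>] m1 m2 m3)+) simp_all

lemma expands_cen4:
  assumes "\<alpha> \<noteq> 1"
  shows "expands F \<tau> (c4 i j k l) (mom4 \<kappa> i j k l)
   (\<lambda>p. m4' i j k l p - m1' i p * mom3 \<gamma> j k l - m1' j p * mom3 \<gamma> i k l - m1' k p * mom3 \<gamma> i j l
      - m1' l p * mom3 \<gamma> i j k)"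
  unfolding cen4_def
  by (rule expands_eq, (rule expands_add expands_diff expands_cmult expands_mult[OF _ _ \<tau>] m1 m2 m3 m4[OF assms])+) simp_all

text \<open>\<open>SA\<close> and \<open>SB\<close> are third- and fourth-order matrices in the
  original coordinates, with the sum over standardized components pulled back through V. For W = U V
  their congruence by W is the rotated C3, respectively the rotated C4 plus (p + 2) I.\<close>

private abbreviation "SA a b p \<equiv> \<Sum>j\<in>UNIV. (\<Sum>m\<in>UNIV. V m j p) * c3 j a b p"
private abbreviation "SB a b p \<equiv> \<Sum>i\<in>UNIV. \<Sum>j\<in>UNIV. (\<Sum>m\<in>UNIV. V m i p * V m j p) * c4 i j a b p"
private abbreviation "A k l p \<equiv> \<Sum>a\<in>UNIV. \<Sum>b\<in>UNIV. W k a p * W l b p * SA a b p"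
private abbreviation "B k l p \<equiv> \<Sum>a\<in>UNIV. \<Sum>b\<in>UNIV. W k a p * W l b p * SB a b p"

text \<open>Whitening fixes the symmetric part of the deviation of X from I; it is applied to V as
  well as to W. The rest of W' has to come from stationarity.\<close>

lemma covariance_linearization:
  assumes X: "\<And>i j. expands F \<tau> (X i j) (if i = j then 1 else 0) (X' i j)"
    and cov: "\<forall>\<^sub>F p in F. (\<Sum>a\<in>UNIV. \<Sum>b\<in>UNIV. X k a p * X l b p * c2 a b p) = (if k = l then 1 else 0)"
  shows "((\<lambda>p. m2' k l p + X' k l p + X' l k p) \<longlongrightarrow> 0) F"
proof -
  have "expands F \<tau> (\<lambda>p. \<Sum>a\<in>UNIV. \<Sum>b\<in>UNIV. X k a p * X l b p * c2 a b p)
      (if k = l then 1 else 0) (\<lambda>p. m2' k l p + X' k l p + X' l k p)"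
    by (rule expands_eq[OF expands_congruence[OF X expands_cen2 \<tau>]]) auto
  from expands_eventually_const[OF this cov] show ?thesis .
qed

text \<open>The deviation of V multiplies \<open>mom3 \<gamma> j a b\<close>, which is 0 for a
  \<noteq> b. Off the diagonal, the only place where the first-order term will be used, V is
  therefore invisible.\<close>

lemma expands_SA:
  "\<exists>s. (\<forall>a b. expands F \<tau> (SA a b) (if a = b then \<gamma> a else 0) (s a b)) \<and>
    (\<forall>a b p. a \<noteq> b \<longrightarrow> s a b p = (\<Sum>j\<in>UNIV. m3' j a b p) - m1' a p - m1' b p)"
proof -
  define d where "d j a b p = m3' j a b p - m1' j p * mom2 a b - m1' a p * mom2 j b - m1' b p * mom2 j a" for j a b p
  define s where "s a b p = (\<Sum>j\<in>UNIV. (\<Sum>m\<in>UNIV. V' m j p) * mom3 \<gamma> j a b + d j a b p)" for a b p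
  have v: "expands F \<tau> (\<lambda>p. \<Sum>m\<in>UNIV. V m j p) 1 (\<lambda>p. \<Sum>m\<in>UNIV. V' m j p)" for j
    by (rule expands_eq[OF expands_sum[OF V]]) simp_all
  have mom3_sum: "(\<Sum>j\<in>UNIV. mom3 \<gamma> j a b) = (if a = b then \<gamma> a else 0)" for a b
    by (cases "a = b") (simp_all add: mom3_def)
  have "expands F \<tau> (SA a b) (if a = b then \<gamma> a else 0) (s a b)" for a b
    by (rule expands_eq[OF expands_sum[OF expands_mult[OF v expands_cen3 \<tau>]]])
      (simp_all add: mom3_sum s_def d_def)
  moreover have "s a b p = (\<Sum>j\<in>UNIV. m3' j a b p) - m1' a p - m1' b p" if "a \<noteq> b" for a b p
  proof -
    have "s a b p = (\<Sum>j\<in>UNIV. m3' j a b p - m1' a p * mom2 j b - m1' b p * mom2 j a)"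
      unfolding s_def d_def using that by (intro sum.cong) (auto simp: mom3_def mom2_def)
    then show ?thesis by (simp add: sum_subtractf mom2_def sum_distrib_left[symmetric])
  qed
  ultimately show ?thesis by blast
qed

text \<open>V occurs only in V^T V, whose linear part is \<open>- m2'\<close> by whitening.
  Contracted with the pairings in \<open>mom4\<close> this yields the term \<open>- 2 * m2'\<close>,
  which raises p + 2 to the constant p + 4 of \<open>lin_part\<close>.\<close>

lemma expands_SB:
  assumes \<alpha>: "\<alpha> \<noteq> 1"
    and cov: "\<And>k l. \<forall>\<^sub>F p in F. (\<Sum>a\<in>UNIV. \<Sum>b\<in>UNIV. V k a p * V l b p * c2 a b p) = (if k = l then 1 else 0)"
  shows "\<exists>s. (\<forall>a b. expands F \<tau> (SB a b) (if a = b then \<kappa> a + real CARD('n) + 2 else 0) (s a b)) \<and>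
    (\<forall>a b p. a \<noteq> b \<longrightarrow>
      s a b p = (\<Sum>i\<in>UNIV. m4' i i a b p) - \<gamma> b * m1' a p - \<gamma> a * m1' b p - 2 * m2' a b p)"
proof -
  have q: "expands F \<tau> (\<lambda>p. \<Sum>m\<in>UNIV. V m i p * V m j p) (mom2 i j) (\<lambda>p. - m2' i j p)" for i j
  proof (rule expands_cong_deriv)
    show "expands F \<tau> (\<lambda>p. \<Sum>m\<in>UNIV. V m i p * V m j p) (mom2 i j) (\<lambda>p. V' j i p + V' i j p)"
      by (rule expands_eq[OF expands_sum[OF expands_mult[OF V V \<tau>]]])
        (auto simp: mom2_def sum_delta_mult sum.distrib)
    show "((\<lambda>p. V' j i p + V' i j p - - m2' i j p) \<longlongrightarrow> 0) F"
      using covariance_linearization[OF V cov, of i j] by (simp add: add_ac)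
  qed
  define d where "d i j a b p = m4' i j a b p - m1' i p * mom3 \<gamma> j a b - m1' j p * mom3 \<gamma> i a b
      - m1' a p * mom3 \<gamma> i j b - m1' b p * mom3 \<gamma> i j a" for i j a b p
  define s where "s a b p = (\<Sum>i\<in>UNIV. \<Sum>j\<in>UNIV. - m2' i j p * mom4 \<kappa> i j a b + mom2 i j * d i j a b p)" for a b p
  have sum_mom2: "(\<Sum>j\<in>UNIV. x j * mom2 j e) = x e" for x :: "'n \<Rightarrow> real" and e
    by (simp add: mom2_def sum_delta_mult)
  \<comment> \<open>The population value of E(|z|^2 z z^T): its diagonal entry is (p - 1) + \<beta>,
    that is \<kappa> + p + 2.\<close>
  have mom4_sum: "(\<Sum>i\<in>UNIV. \<Sum>j\<in>UNIV. mom2 i j * mom4 \<kappa> i j a b) = (if a = b then \<kappa> a + real CARD('n) + 2 else 0)" for a b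
  proof -
    have "(\<Sum>j\<in>UNIV. mom2 i j * mom4 \<kappa> i j a b) = mom4 \<kappa> i i a b" for i
      by (simp add: mom2_def sum_delta_mult)
    moreover have "mom4 \<kappa> i i a b = mom2 a b + (if i = a then 2 * mom2 a b else 0) + (if i = a then \<kappa> a * mom2 a b else 0)" for i
      by (auto simp: mom4_def mom2_def)
    ultimately show ?thesis by (simp add: sum.distrib mom2_def)
  qed
  have "expands F \<tau> (SB a b) (if a = b then \<kappa> a + real CARD('n) + 2 else 0) (s a b)" for a b
    by (rule expands_eq[OF expands_sum[OF expands_sum[OF expands_mult[OF q expands_cen4[OF \<alpha>] \<tau>]]]])
      (simp_all add: mom4_sum s_def d_def)
  moreover have "s a b p = (\<Sum>i\<in>UNIV. m4' i i a b p) - \<gamma> b * m1' a p - \<gamma> a * m1' b p - 2 * m2' a b p"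
    if ab: "a \<noteq> b" for a b p
  proof -
    have 1: "mom4 \<kappa> i j a b = mom2 i a * mom2 j b + mom2 i b * mom2 j a" for i j
      using ab by (auto simp: mom4_def mom2_def)
    have 2: "d i i a b p = m4' i i a b p - \<gamma> b * m1' a p * mom2 i b - \<gamma> a * m1' b p * mom2 i a" for i
      using ab by (auto simp: d_def mom3_def mom2_def)
    have "s a b p = (\<Sum>i\<in>UNIV. \<Sum>j\<in>UNIV. - m2' i j p * mom2 i a * mom2 j b)
        + (\<Sum>i\<in>UNIV. \<Sum>j\<in>UNIV. - m2' i j p * mom2 i b * mom2 j a) + (\<Sum>i\<in>UNIV. \<Sum>j\<in>UNIV. mom2 i j * d i j a b p)"
      unfolding s_def 1 by (simp add: sum.distrib[symmetric] algebra_simps)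
    also have "(\<Sum>i\<in>UNIV. \<Sum>j\<in>UNIV. mom2 i j * d i j a b p) = (\<Sum>i\<in>UNIV. d i i a b p)"
      by (simp add: mom2_def sum_delta_mult)
    also have "\<dots> = (\<Sum>i\<in>UNIV. m4' i i a b p) - \<gamma> b * m1' a p - \<gamma> a * m1' b p"
      unfolding 2 by (simp add: sum_subtractf mom2_def sum_delta_mult)
    also have "(\<Sum>i\<in>UNIV. \<Sum>j\<in>UNIV. - m2' i j p * mom2 i a * mom2 j b) = - m2' a b p"
      by (simp only: sum_mom2)
    also have "(\<Sum>i\<in>UNIV. \<Sum>j\<in>UNIV. - m2' i j p * mom2 i b * mom2 j a) = - m2' b a p"
      by (simp only: sum_mom2)
    finally show ?thesis using m2'_sym[of b a p] by simp
  qed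
  ultimately show ?thesis by blast
qed

text \<open>With V in place of W there is no rotation, so this is the convergence of the
  standardized third cumulant matrix itself, needed for consistency.\<close>

lemma skewness_limit:
  assumes \<tau>_pos: "\<forall>\<^sub>F p in F. \<tau> p > 0"
  shows "((\<lambda>p. \<Sum>a\<in>UNIV. \<Sum>b\<in>UNIV. V k a p * V l b p * SA a b p) \<longlongrightarrow> (if k = l then \<gamma> k else 0)) F"
proof -
  obtain s where s: "\<And>a b. expands F \<tau> (SA a b) (if a = b then \<gamma> a else 0) (s a b)"
    using expands_SA by blast
  show ?thesis by (rule expands_tendsto[OF expands_congruence[OF V s \<tau>] \<tau> \<tau>_pos])
qed

lemma kurtosis_limit:
  assumes \<alpha>: "\<alpha> \<noteq> 1" and \<tau>_pos: "\<forall>\<^sub>F p in F. \<tau> p > 0"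
    and cov: "\<And>k l. \<forall>\<^sub>F p in F. (\<Sum>a\<in>UNIV. \<Sum>b\<in>UNIV. V k a p * V l b p * c2 a b p) = (if k = l then 1 else 0)"
  shows "((\<lambda>p. \<Sum>a\<in>UNIV. \<Sum>b\<in>UNIV. V k a p * V l b p * SB a b p) \<longlongrightarrow>
    (if k = l then \<kappa> k + real CARD('n) + 2 else 0)) F"
proof -
  obtain s where s: "\<And>a b. expands F \<tau> (SB a b) (if a = b then \<kappa> a + real CARD('n) + 2 else 0) (s a b)"
    using expands_SB[OF \<alpha> cov] by blast
  show ?thesis by (rule expands_tendsto[OF expands_congruence[OF V s \<tau>] \<tau> \<tau>_pos])
qed

text \<open>Whitening and stationarity give two linear equations for \<open>W' k l\<close> and
  \<open>W' l k\<close>; eliminating the latter leaves the separation constant as coefficient. In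
  each product of stationarity the first factor vanishes in the limit, so the first-order part of
  the second factor does not contribute.\<close>

lemma linearization:
  assumes covV: "\<And>k l. \<forall>\<^sub>F p in F. (\<Sum>a\<in>UNIV. \<Sum>b\<in>UNIV. V k a p * V l b p * c2 a b p) = (if k = l then 1 else 0)"
    and covW: "\<And>k l. \<forall>\<^sub>F p in F. (\<Sum>a\<in>UNIV. \<Sum>b\<in>UNIV. W k a p * W l b p * c2 a b p) = (if k = l then 1 else 0)"
    and stat: "\<And>k l. k \<noteq> l \<Longrightarrow> \<forall>\<^sub>F p in F. \<alpha> * (A k l p * (A k k p - A l l p)) +
       (1 - \<alpha>) * (B k l p * (B k k p - B l l p)) = 0"
    and sep: "\<And>k l. k \<noteq> l \<Longrightarrow> \<alpha> * (\<gamma> k - \<gamma> l)\<^sup>2 + (1 - \<alpha>) * (\<kappa> k - \<kappa> l)\<^sup>2 \<noteq> 0"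
  shows "((\<lambda>p. W' k l p - lin_part \<alpha> \<gamma> \<kappa> k l (\<lambda>i. m1' i p) (\<lambda>i j. m2' i j p)
    (\<lambda>i j h. m3' i j h p) (\<lambda>i j h r. m4' i j h r p)) \<longlongrightarrow> 0) F"
proof (cases "k = l")
  case True
  have "((\<lambda>p. (m2' k k p + W' k k p + W' k k p) / 2) \<longlongrightarrow> 0 / 2) F"
    by (intro tendsto_divide covariance_linearization[OF W covW] tendsto_const) simp
  moreover have "(m2' k k p + W' k k p + W' k k p) / 2 = W' k k p - (- (m2' k k p / 2))" for p
    by simp
  ultimately show ?thesis by (simp only: True[symmetric] lin_part_def if_True simp_thms div_0)
next
  case kl: False
  obtain s where s: "\<And>a b. expands F \<tau> (SA a b) (if a = b then \<gamma> a else 0) (s a b)"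
    "\<And>a b p. a \<noteq> b \<Longrightarrow> s a b p = (\<Sum>j\<in>UNIV. m3' j a b p) - m1' a p - m1' b p"
    using expands_SA by blast
  have EA: "expands F \<tau> (A k l) (if k = l then \<gamma> k else 0) (\<lambda>p. s k l p + W' k l p * \<gamma> l + W' l k p * \<gamma> k)" for k l
    by (rule expands_congruence[OF W s(1) \<tau>])
  have PA: "expands F \<tau> (\<lambda>p. A k l p * (A k k p - A l l p)) 0
      (\<lambda>p. (s k l p + W' k l p * \<gamma> l + W' l k p * \<gamma> k) * (\<gamma> k - \<gamma> l))"
    by (rule expands_eq[OF expands_mult[OF EA expands_diff[OF EA EA] \<tau>]]) (use kl in auto)
  obtain t where t: "expands F \<tau> (\<lambda>p. (1 - \<alpha>) * (B k l p * (B k k p - B l l p))) 0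
      (\<lambda>p. (1 - \<alpha>) * ((t p + W' k l p * (\<kappa> l + real CARD('n) + 2) + W' l k p * (\<kappa> k + real CARD('n) + 2)) * (\<kappa> k - \<kappa> l)))"
    "\<And>p. t p = (\<Sum>i\<in>UNIV. m4' i i k l p) - \<gamma> l * m1' k p - \<gamma> k * m1' l p - 2 * m2' k l p"
  \<comment> \<open>For \<alpha> = 1 no expansion of fourth moments is available; the kurtosis term
    is then identically 0 because of its factor.\<close>
  proof (cases "\<alpha> = 1")
    case True
    then show ?thesis by (intro that[of "\<lambda>p. (\<Sum>i\<in>UNIV. m4' i i k l p) - \<gamma> l * m1' k p - \<gamma> k * m1' l p - 2 * m2' k l p"])
      (simp_all add: expands_const)
  next
    case False
    obtain u where u: "\<And>a b. expands F \<tau> (SB a b) (if a = b then \<kappa> a + real CARD('n) + 2 else 0) (u a b)"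
      "\<And>a b p. a \<noteq> b \<Longrightarrow> u a b p = (\<Sum>i\<in>UNIV. m4' i i a b p) - \<gamma> b * m1' a p - \<gamma> a * m1' b p - 2 * m2' a b p"
      using expands_SB[OF False covV] by blast
    have EB: "expands F \<tau> (B k l) (if k = l then \<kappa> k + real CARD('n) + 2 else 0)
        (\<lambda>p. u k l p + W' k l p * (\<kappa> l + real CARD('n) + 2) + W' l k p * (\<kappa> k + real CARD('n) + 2))" for k l
      by (rule expands_congruence[OF W u(1) \<tau>])
    have "expands F \<tau> (\<lambda>p. (1 - \<alpha>) * (B k l p * (B k k p - B l l p))) 0
      (\<lambda>p. (1 - \<alpha>) * ((u k l p + W' k l p * (\<kappa> l + real CARD('n) + 2) + W' l k p * (\<kappa> k + real CARD('n) + 2)) * (\<kappa> k - \<kappa> l)))"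
      by (rule expands_eq[OF expands_cmult[OF expands_mult[OF EB expands_diff[OF EB EB] \<tau>]]]) (use kl in auto)
    then show ?thesis using u(2)[OF kl] that by blast
  qed
  define D where "D p = \<alpha> * ((s k l p + W' k l p * \<gamma> l + W' l k p * \<gamma> k) * (\<gamma> k - \<gamma> l)) +
    (1 - \<alpha>) * ((t p + W' k l p * (\<kappa> l + real CARD('n) + 2) + W' l k p * (\<kappa> k + real CARD('n) + 2)) * (\<kappa> k - \<kappa> l))" for p
  have "expands F \<tau> (\<lambda>p. \<alpha> * (A k l p * (A k k p - A l l p)) + (1 - \<alpha>) * (B k l p * (B k k p - B l l p))) 0 D"
    unfolding D_def by (rule expands_eq[OF expands_add[OF expands_cmult[OF PA] t(1)]]) auto
  from expands_eventually_const[OF this stat[OF kl]] have D0: "(D \<longlongrightarrow> 0) F" .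
  define R where "R p = m2' k l p + W' k l p + W' l k p" for p
  have R0: "(R \<longlongrightarrow> 0) F" unfolding R_def by (rule covariance_linearization[OF W covW])
  \<comment> \<open>\<open>c\<close> is the coefficient of \<open>W' l k\<close> in
    \<open>D\<close>, so that subtracting \<open>D\<close> from \<open>c\<close> times the whitening
    relation \<open>R\<close> eliminates this unknown and leaves \<Delta> as coefficient of
    \<open>W' k l\<close>.\<close>
  define c where "c = \<alpha> * ((\<gamma> k - \<gamma> l) * \<gamma> k) + (1 - \<alpha>) * ((\<kappa> k - \<kappa> l) * (\<kappa> k + real CARD('n) + 2))"
  define \<Delta> where "\<Delta> = \<alpha> * (\<gamma> k - \<gamma> l)\<^sup>2 + (1 - \<alpha>) * (\<kappa> k - \<kappa> l)\<^sup>2"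
  have \<Delta>: "\<Delta> \<noteq> 0" unfolding \<Delta>_def by (rule sep[OF kl])
  have "((\<lambda>p. (c * R p - D p) / \<Delta>) \<longlongrightarrow> (c * 0 - 0) / \<Delta>) F"
    by (intro tendsto_divide tendsto_diff tendsto_mult tendsto_const D0 R0 \<Delta>)
  moreover have "(c * R p - D p) / \<Delta> = W' k l p - lin_part \<alpha> \<gamma> \<kappa> k l (\<lambda>i. m1' i p) (\<lambda>i j. m2' i j p)
    (\<lambda>i j h. m3' i j h p) (\<lambda>i j h r. m4' i j h r p)" for p
  proof -
    define N where "N = \<alpha> * ((\<gamma> k - \<gamma> l) * ((\<Sum>j\<in>UNIV. m3' j k l p) - m1' k p - m1' l p - \<gamma> k * m2' k l p))
       + (1 - \<alpha>) * ((\<kappa> k - \<kappa> l) * ((\<Sum>j\<in>UNIV. m4' j j k l p) - \<gamma> l * m1' k p - \<gamma> k * m1' l p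
           - (\<kappa> k + real CARD('n) + 4) * m2' k l p))"
    have "c * R p - D p = \<Delta> * W' k l p - N"
      unfolding c_def R_def D_def \<Delta>_def N_def t(2) s(2)[OF kl] by (simp add: algebra_simps power2_eq_square)
    moreover have "lin_part \<alpha> \<gamma> \<kappa> k l (\<lambda>i. m1' i p) (\<lambda>i j. m2' i j p)
        (\<lambda>i j h. m3' i j h p) (\<lambda>i j h r. m4' i j h r p) = N / \<Delta>"
      using kl by (simp add: lin_part_def N_def \<Delta>_def)
    ultimately show ?thesis using \<Delta> by (simp add: diff_divide_distrib)
  qed
  ultimately show ?thesis by simp
qed

end


text \<open>The rate \<open>W - I = O(s)\<close> is obtained by linearizing first at the scale \<open>s + |W - I|\<close>, at which
  \<open>W - I\<close> is bounded for trivial reasons.\<close>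

lemma consistent_solution_linearization:
  fixes F :: "'a filter" and s :: "'a \<Rightarrow> real"
    and m1 :: "'n::finite \<Rightarrow> 'a \<Rightarrow> real" and m2 :: "'n \<Rightarrow> 'n \<Rightarrow> 'a \<Rightarrow> real"
    and m3 :: "'n \<Rightarrow> 'n \<Rightarrow> 'n \<Rightarrow> 'a \<Rightarrow> real" and m4 :: "'n \<Rightarrow> 'n \<Rightarrow> 'n \<Rightarrow> 'n \<Rightarrow> 'a \<Rightarrow> real"
    and \<gamma> \<kappa> :: "'n \<Rightarrow> real" and \<alpha> :: real
    and V W :: "'n \<Rightarrow> 'n \<Rightarrow> 'a \<Rightarrow> real"
  defines "c2 \<equiv> \<lambda>i j p. cen2 (\<lambda>i. m1 i p) (\<lambda>i j. m2 i j p) i j"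
    and "c3 \<equiv> \<lambda>i j k p. cen3 (\<lambda>i. m1 i p) (\<lambda>i j. m2 i j p) (\<lambda>i j k. m3 i j k p) i j k"
    and "c4 \<equiv> \<lambda>i j k l p. cen4 (\<lambda>i. m1 i p) (\<lambda>i j. m2 i j p) (\<lambda>i j k. m3 i j k p) (\<lambda>i j k l. m4 i j k l p) i j k l"
  defines "A \<equiv> \<lambda>k l p. \<Sum>a\<in>UNIV. \<Sum>b\<in>UNIV. W k a p * W l b p * (\<Sum>j\<in>UNIV. (\<Sum>m\<in>UNIV. V m j p) * c3 j a b p)"
    and "B \<equiv> \<lambda>k l p. \<Sum>a\<in>UNIV. \<Sum>b\<in>UNIV. W k a p * W l b p *
      (\<Sum>i\<in>UNIV. \<Sum>j\<in>UNIV. (\<Sum>m\<in>UNIV. V m i p * V m j p) * c4 i j a b p)"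
  assumes s: "(s \<longlongrightarrow> 0) F" and s_pos: "\<forall>\<^sub>F p in F. s p > 0"
    and m1: "\<And>i. Bfun (\<lambda>p. m1 i p / s p) F"
    and m2: "\<And>i j. Bfun (\<lambda>p. (m2 i j p - mom2 i j) / s p) F"
    and m3: "\<And>i j k. Bfun (\<lambda>p. (m3 i j k p - mom3 \<gamma> i j k) / s p) F"
    and m4: "\<And>i j k l. \<alpha> \<noteq> 1 \<Longrightarrow> Bfun (\<lambda>p. (m4 i j k l p - mom4 \<kappa> i j k l) / s p) F"
    and m2_sym: "\<And>i j p. m2 i j p = m2 j i p"
    and V: "\<And>i j. Bfun (\<lambda>p. (V i j p - (if i = j then 1 else 0)) / s p) F"
    and W: "\<And>i j. ((\<lambda>p. W i j p) \<longlongrightarrow> (if i = j then 1 else 0)) F"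
    and covV: "\<And>k l. \<forall>\<^sub>F p in F. (\<Sum>a\<in>UNIV. \<Sum>b\<in>UNIV. V k a p * V l b p * c2 a b p) = (if k = l then 1 else 0)"
    and covW: "\<And>k l. \<forall>\<^sub>F p in F. (\<Sum>a\<in>UNIV. \<Sum>b\<in>UNIV. W k a p * W l b p * c2 a b p) = (if k = l then 1 else 0)"
    and stat: "\<And>k l. k \<noteq> l \<Longrightarrow> \<forall>\<^sub>F p in F. \<alpha> * (A k l p * (A k k p - A l l p)) +
       (1 - \<alpha>) * (B k l p * (B k k p - B l l p)) = 0"
    and sep: "\<And>k l. k \<noteq> l \<Longrightarrow> \<alpha> * (\<gamma> k - \<gamma> l)\<^sup>2 + (1 - \<alpha>) * (\<kappa> k - \<kappa> l)\<^sup>2 \<noteq> 0"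
  shows "((\<lambda>p. (W k l p - (if k = l then 1 else 0)) / s p - lin_part \<alpha> \<gamma> \<kappa> k l (\<lambda>i. m1 i p / s p)
    (\<lambda>i j. (m2 i j p - mom2 i j) / s p) (\<lambda>i j h. (m3 i j h p - mom3 \<gamma> i j h) / s p)
    (\<lambda>i j h r. (m4 i j h r p - mom4 \<kappa> i j h r) / s p)) \<longlongrightarrow> 0) F"
proof -
  define L where "L t k l p = lin_part \<alpha> \<gamma> \<kappa> k l (\<lambda>i. m1 i p / t p)
    (\<lambda>i j. (m2 i j p - mom2 i j) / t p) (\<lambda>i j h. (m3 i j h p - mom3 \<gamma> i j h) / t p)
    (\<lambda>i j h r. (m4 i j h r p - mom4 \<kappa> i j h r) / t p)" for t k l p
  define E where "E k l p = W k l p - (if k = l then 1 else 0)" for k l p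
  \<comment> \<open>The linearization at any null scale t that dominates both s and the deviation E
    of W from I. It is used twice: at s + |E|, and again at s once the rate is known.\<close>
  have main: "((\<lambda>p. E k l p / t p - L t k l p) \<longlongrightarrow> 0) F"
    if t: "(t \<longlongrightarrow> 0) F" and st: "Bfun (\<lambda>p. s p / t p) F" and Et: "\<And>i j. Bfun (\<lambda>p. E i j p / t p) F"
    for t k l
  proof -
    have B: "Bfun (\<lambda>p. x p / t p) F" if "Bfun (\<lambda>p. x p / s p) F" for x
    proof -
      have "Bfun (\<lambda>p. x p / s p * (s p / t p)) F" by (rule Bfun_real_mult[OF that st])
      then obtain K where "\<forall>\<^sub>F p in F. \<bar>x p / s p * (s p / t p)\<bar> \<le> K" by (auto simp: Bfun_real_iff)
      with s_pos have "\<forall>\<^sub>F p in F. \<bar>x p / t p\<bar> \<le> K" by eventually_elim simp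
      then show ?thesis by (auto simp: Bfun_real_iff)
    qed
    have m1': "expands F t (m1 i) 0 (\<lambda>p. m1 i p / t p)" for i
      using expands_quotient[of "m1 i" 0 t F] B[OF m1] by simp
    show ?thesis
      unfolding L_def E_def
      by (rule linearization[OF t m1' expands_quotient[OF B[OF m2]] expands_quotient[OF B[OF m3]]
            expands_quotient[OF B[OF m4]] expands_quotient[OF B[OF V]] expands_quotient[OF Et[unfolded E_def]] _
            covV[unfolded c2_def] covW[unfolded c2_def] stat[unfolded A_def B_def c3_def c4_def] sep])
        (auto simp: m2_sym mom2_def)
  qed
  define e where "e p = (\<Sum>i\<in>UNIV. \<Sum>j\<in>UNIV. \<bar>E i j p\<bar>)" for p
  have e0: "e p \<ge> 0" for p unfolding e_def by (intro sum_nonneg) auto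
  have E_le: "\<bar>E i j p\<bar> \<le> e p" for i j p
  proof -
    have "\<bar>E i j p\<bar> \<le> (\<Sum>j\<in>UNIV. \<bar>E i j p\<bar>)" by (rule member_le_sum) auto
    also have "\<dots> \<le> e p" unfolding e_def by (rule member_le_sum) (auto intro: sum_nonneg)
    finally show ?thesis .
  qed
  define t where "t p = s p + e p" for p
  have "((\<lambda>p. \<bar>E i j p\<bar>) \<longlongrightarrow> 0) F" for i j
    unfolding E_def using LIM_zero[OF W[of i j]] by (rule tendsto_rabs_zero)
  then have "(e \<longlongrightarrow> (\<Sum>i\<in>(UNIV::'n set). \<Sum>j\<in>(UNIV::'n set). 0)) F"
    unfolding e_def by (intro tendsto_sum)
  then have t0: "(t \<longlongrightarrow> 0) F" unfolding t_def using tendsto_add[OF s] by fastforce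
  have "\<forall>\<^sub>F p in F. \<bar>s p / t p\<bar> \<le> 1"
    using s_pos by eventually_elim (use e0 in \<open>auto simp: t_def divide_simps add_nonneg_nonneg add_pos_nonneg abs_if\<close>)
  then have st: "Bfun (\<lambda>p. s p / t p) F" by (auto simp: Bfun_real_iff)
  have "\<forall>\<^sub>F p in F. \<bar>E i j p / t p\<bar> \<le> 1" for i j
    using s_pos
  proof eventually_elim
    case (elim p)
    have "\<bar>E i j p\<bar> \<le> t p" "t p > 0" using E_le[of i j p] elim e0[of p] by (auto simp: t_def)
    then show ?case by (simp add: divide_simps)
  qed
  then have Et: "Bfun (\<lambda>p. E i j p / t p) F" for i j by (auto simp: Bfun_real_iff)
  have "\<exists>C. \<forall>\<^sub>F p in F. \<bar>L s i j p\<bar> \<le> C" for i j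
  proof -
    \<comment> \<open>The factor 1 - \<alpha> stays attached to the fourth moments, since for
      \<alpha> = 1 they alone are not bounded.\<close>
    have b4: "Bfun (\<lambda>p. (1 - \<alpha>) * ((m4 i j k l p - mom4 \<kappa> i j k l) / s p)) F" for i j k l
    proof (cases "\<alpha> = 1")
      case False
      then show ?thesis by (intro Bfun_real_mult Bfun_const m4)
    qed (simp add: Bfun_const)
    have "Bfun (L s i j) F"
    proof (cases "i = j")
      case True
      then have "L s i j = (\<lambda>p. - (1/2) * ((m2 i i p - mom2 i i) / s p))"
        by (simp add: fun_eq_iff L_def lin_part_def)
      then show ?thesis by (simp only:) (rule Bfun_real_mult[OF Bfun_const m2])
    next
      case False
      then have "L s i j = (\<lambda>p.
       (\<alpha> * (\<gamma> i - \<gamma> j) * ((\<Sum>h\<in>UNIV. (m3 h i j p - mom3 \<gamma> h i j) / s p) - m1 i p / s p - m1 j p / s p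
          - \<gamma> i * ((m2 i j p - mom2 i j) / s p))
       + (\<kappa> i - \<kappa> j) * ((\<Sum>h\<in>UNIV. (1 - \<alpha>) * ((m4 h h i j p - mom4 \<kappa> h h i j) / s p))
          - (1 - \<alpha>) * (\<gamma> j * (m1 i p / s p) + \<gamma> i * (m1 j p / s p)
           + (\<kappa> i + real CARD('n) + 4) * ((m2 i j p - mom2 i j) / s p))))
      * (1 / (\<alpha> * (\<gamma> i - \<gamma> j)\<^sup>2 + (1 - \<alpha>) * (\<kappa> i - \<kappa> j)\<^sup>2)))" (is "_ = ?g")
        unfolding L_def lin_part_def sum_distrib_left[symmetric]
        by (simp add: fun_eq_iff) (auto simp: algebra_simps)
      moreover have "Bfun ?g F"
        by (rule Bfun_real_mult Bfun_real_add Bfun_real_diff Bfun_real_sum m1 m2 m3 b4 Bfun_const)+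
      ultimately show ?thesis by (simp only:)
    qed
    then show ?thesis by (auto simp: Bfun_real_iff)
  qed
  then obtain C where C: "\<And>i j. \<forall>\<^sub>F p in F. \<bar>L s i j p\<bar> \<le> C i j" by metis
  define N where "N = real CARD('n) * real CARD('n)"
  have N: "N > 0" unfolding N_def by simp
  define c where "c = (\<Sum>i\<in>UNIV. \<Sum>j\<in>UNIV. C i j)"
  \<comment> \<open>With N the number of matrix entries, the errors of size t / (2 N) add up to t /
    2 = (s + e) / 2. The part e / 2 is absorbed on the left-hand side, which leaves e =
    O(s).\<close>
  have "\<forall>\<^sub>F p in F. \<bar>E i j p / t p - L t i j p\<bar> < 1 / (2 * N)" for i j
    using tendstoD[OF main[OF t0 st Et, of i j], of "1 / (2 * N)"] N by simp
  then have ev1: "\<forall>\<^sub>F p in F. \<forall>i j. \<bar>E i j p / t p - L t i j p\<bar> < 1 / (2 * N)"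
    by (intro eventually_all_finite)
  have ev2: "\<forall>\<^sub>F p in F. \<forall>i j. \<bar>L s i j p\<bar> \<le> C i j"
    by (intro eventually_all_finite C)
  have ev: "\<forall>\<^sub>F p in F. e p \<le> (2 * c + 1) * s p"
    using ev1 ev2 s_pos
  proof eventually_elim
    case (elim p)
    have t: "t p > 0" using elim(3) e0[of p] by (simp add: t_def)
    have Lt: "L t i j p = s p / t p * L s i j p" for i j
      unfolding L_def lin_part_scale[symmetric] using elim(3) by simp
    have "\<bar>E i j p\<bar> \<le> t p / (2 * N) + s p * C i j" for i j
    proof -
      have "\<bar>E i j p / t p\<bar> \<le> 1 / (2 * N) + \<bar>L t i j p\<bar>" using elim(1)[rule_format, of i j] by linarith
      also have "\<bar>L t i j p\<bar> \<le> s p / t p * C i j"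
        unfolding Lt abs_mult using elim(2,3) t by (intro mult_mono) auto
      finally have "\<bar>E i j p\<bar> \<le> (1 / (2 * N) + s p / t p * C i j) * t p"
        using t by (simp add: abs_divide pos_divide_le_eq)
      then show ?thesis using t by (simp add: distrib_right)
    qed
    then have "e p \<le> (\<Sum>i\<in>(UNIV::'n set). \<Sum>j\<in>(UNIV::'n set). t p / (2 * N) + s p * C i j)"
      unfolding e_def by (intro sum_mono)
    also have "\<dots> = t p / 2 + s p * c"
      using N by (simp add: sum.distrib sum_distrib_left[symmetric] c_def N_def)
    finally show ?case by (simp add: t_def distrib_right) argo
  qed
  have "Bfun (\<lambda>p. E i j p / s p) F" for i j
  proof -
    have "\<forall>\<^sub>F p in F. \<bar>E i j p / s p\<bar> \<le> 2 * c + 1"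
      using ev s_pos
    proof eventually_elim
      case (elim p)
      then show ?case using E_le[of i j p] by (simp add: abs_divide pos_divide_le_eq)
    qed
    then show ?thesis by (auto simp: Bfun_real_iff)
  qed
  moreover have "Bfun (\<lambda>p. s p / s p) F"
  proof -
    have "\<forall>\<^sub>F p in F. \<bar>s p / s p\<bar> \<le> 1" using s_pos by eventually_elim simp
    then show ?thesis unfolding Bfun_real_iff by blast
  qed
  ultimately have "((\<lambda>p. E k l p / s p - L s k l p) \<longlongrightarrow> 0) F" by (intro main s)
  then show ?thesis by (simp only: E_def L_def)
qed

section \<open>Gaussian laws\<close>

lemma borel_measurable_vec_nth [measurable (raw)]:
  fixes f :: "'a \<Rightarrow> 'b::euclidean_space ^ 'n"
  assumes "f \<in> borel_measurable M"
  shows "(\<lambda>x. f x $ i) \<in> borel_measurable M"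
  using measurable_compose[OF assms borel_measurable_continuous_onI[OF continuous_on_component[OF continuous_on_id]]] .

lemma borel_measurable_vec_lambda [measurable (raw)]:
  fixes f :: "'n::finite \<Rightarrow> 'a \<Rightarrow> 'b::euclidean_space"
  assumes "\<And>i. f i \<in> borel_measurable M"
  shows "(\<lambda>x. \<chi> i. f i x) \<in> borel_measurable M"
proof (subst borel_measurable_euclidean_space, rule ballI)
  fix u :: "'b^'n" assume "u \<in> Basis"
  then obtain i b where u: "u = axis i b" by (auto simp: Basis_vec_def)
  have "(\<lambda>x. f i x \<bullet> b) \<in> borel_measurable M" using assms by measurable
  then show "(\<lambda>x. (\<chi> i. f i x) \<bullet> u) \<in> borel_measurable M" by (simp add: u inner_axis)
qed

lemma integrable_mult_square:
  fixes f g :: "'a \<Rightarrow> real"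
  assumes [measurable]: "f \<in> borel_measurable M" "g \<in> borel_measurable M"
    and "integrable M (\<lambda>x. (f x)\<^sup>2)" "integrable M (\<lambda>x. (g x)\<^sup>2)"
  shows "integrable M (\<lambda>x. f x * g x)"
proof (rule Bochner_Integration.integrable_bound)
  show "integrable M (\<lambda>x. (f x)\<^sup>2 + (g x)\<^sup>2)" using assms by auto
  have "\<bar>a * b\<bar> \<le> a\<^sup>2 + b\<^sup>2" for a b :: real
  proof -
    have "0 \<le> \<bar>a\<bar> * \<bar>b\<bar>" by simp
    then show ?thesis
      using sum_squares_bound[of "\<bar>a\<bar>" "\<bar>b\<bar>"] unfolding abs_mult power2_abs mult.assoc by linarith
  qed
  then show "AE x in M. norm (f x * g x) \<le> norm ((f x)\<^sup>2 + (g x)\<^sup>2)"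
    by (auto simp: abs_of_nonneg)
qed measurable

text \<open>Cholesky factorization of a Gram matrix by a Gram-Schmidt step: split off from every
  function its projection on the new one, \<open>Y j\<close>, and factor the residuals by induction.
  Positive semidefiniteness is built into the Gram form.\<close>

lemma gram_factorization:
  fixes Y :: "'i \<Rightarrow> 'a \<Rightarrow> real"
  assumes "finite I" "\<And>i. i \<in> I \<Longrightarrow> Y i \<in> borel_measurable M" "\<And>i. i \<in> I \<Longrightarrow> integrable M (\<lambda>x. (Y i x)\<^sup>2)"
  shows "\<exists>a. \<forall>i\<in>I. \<forall>j\<in>I. (\<Sum>k\<in>I. a i k * a j k) = (\<integral>x. Y i x * Y j x \<partial>M)"
  using assms
proof (induction I arbitrary: Y rule: finite_induct)
  case (insert j I)
  have [measurable]: "Y i \<in> borel_measurable M" if "i \<in> insert j I" for i using insert.prems(1) that by auto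
  have int: "integrable M (\<lambda>x. Y i x * Y k x)" if "i \<in> insert j I" "k \<in> insert j I" for i k
    using insert.prems that by (intro integrable_mult_square) auto
  define v where "v = (\<integral>x. Y j x * Y j x \<partial>M)"
  have v0: "v \<ge> 0" unfolding v_def by (rule Bochner_Integration.integral_nonneg) simp
  \<comment> \<open>If \<open>Y j\<close> is null, its inner product with every function is 0, so
    the coefficient 0 is consistent with \<open>cv\<close>.\<close>
  define c where "c i = (if v = 0 then 0 else (\<integral>x. Y i x * Y j x \<partial>M) / v)" for i
  have cv: "(\<integral>x. Y i x * Y j x \<partial>M) = c i * v" if i: "i \<in> insert j I" for i
  proof (cases "v = 0")
    case True
    then have "AE x in M. Y j x * Y j x = 0"
      using integral_nonneg_eq_0_iff_AE[OF int[of j j]] by (simp add: v_def)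
    then have "AE x in M. Y i x * Y j x = 0" by auto
    then have "(\<integral>x. Y i x * Y j x \<partial>M) = (\<integral>x. 0 \<partial>M)"
      using i by (intro integral_cong_AE) auto
    then show ?thesis using True by simp
  qed (simp add: c_def)
  have "\<exists>a. \<forall>i\<in>I. \<forall>k\<in>I. (\<Sum>h\<in>I. a i h * a k h) = (\<integral>x. (Y i x - c i * Y j x) * (Y k x - c k * Y j x) \<partial>M)"
  proof (rule insert.IH)
    fix i assume i: "i \<in> I"
    show "(\<lambda>x. Y i x - c i * Y j x) \<in> borel_measurable M" 
      using i by (intro borel_measurable_diff borel_measurable_times borel_measurable_const) auto
    have "integrable M (\<lambda>x. Y i x * Y i x + c i * c i * (Y j x * Y j x) - 2 * c i * (Y i x * Y j x))"
      using i by (intro Bochner_Integration.integrable_diff Bochner_Integration.integrable_add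
          integrable_mult_right int) auto
    then show "integrable M (\<lambda>x. (Y i x - c i * Y j x)\<^sup>2)"
      by (simp add: power2_eq_square algebra_simps)
  qed
  then obtain a where a: "\<And>i k. i \<in> I \<Longrightarrow> k \<in> I \<Longrightarrow>
      (\<Sum>h\<in>I. a i h * a k h) = (\<integral>x. (Y i x - c i * Y j x) * (Y k x - c k * Y j x) \<partial>M)" by blast
  have a': "(\<Sum>h\<in>I. a i h * a k h) = (\<integral>x. Y i x * Y k x \<partial>M) - c i * c k * v" if ik: "i \<in> I" "k \<in> I" for i k
  proof -
    have "(\<integral>x. (Y i x - c i * Y j x) * (Y k x - c k * Y j x) \<partial>M) =
        (\<integral>x. Y i x * Y k x - c k * (Y i x * Y j x) - c i * (Y k x * Y j x) + c i * c k * (Y j x * Y j x) \<partial>M)"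
      by (rule Bochner_Integration.integral_cong) (auto simp: algebra_simps)
    also have "\<dots> = (\<integral>x. Y i x * Y k x \<partial>M) - c k * (c i * v) - c i * (c k * v) + c i * c k * v"
      using ik cv[of i] cv[of k] int by (simp add: v_def[symmetric])
    finally show ?thesis using a[OF ik] by simp
  qed
  \<comment> \<open>Column j holds the coefficients with respect to the normalized
    \<open>Y j\<close>; the other columns factor the residuals and are 0 in row j.\<close>
  define b where "b i h = (if h = j then (if i = j then sqrt v else c i * sqrt v) else if i = j then 0 else a i h)" for i h
  have S: "(\<Sum>h\<in>insert j I. b i h * b k h) = b i j * b k j + (\<Sum>h\<in>I. b i h * b k h)" for i k
    using insert.hyps by simp
  have b0: "b i h = (if i = j then 0 else a i h)" if "h \<in> I" for i h
    using that insert.hyps by (auto simp: b_def)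
  have b1: "(\<Sum>h\<in>I. b i h * b k h) = (if i = j \<or> k = j then 0 else (\<Sum>h\<in>I. a i h * a k h))" for i k
    by (auto simp: b0 intro!: sum.neutral sum.cong)
  have "(\<Sum>h\<in>insert j I. b i h * b k h) = (\<integral>x. Y i x * Y k x \<partial>M)"
    if i: "i \<in> insert j I" and k: "k \<in> insert j I" for i k
  proof -
    have sq: "sqrt v * sqrt v = v" using v0 by simp
    have comm: "(\<integral>x. Y j x * Y k x \<partial>M) = (\<integral>x. Y k x * Y j x \<partial>M)" by (simp add: mult.commute)
    consider "i = j" "k = j" | "i = j" "k \<in> I" "k \<noteq> j" | "i \<in> I" "i \<noteq> j" "k = j" | "i \<in> I" "i \<noteq> j" "k \<in> I" "k \<noteq> j"
      using i k by auto
    then show ?thesis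
    proof cases
      case 1
      then show ?thesis unfolding S b1 using v0 by (simp add: b_def v_def[symmetric])
    next
      case 2
      then show ?thesis unfolding S b1 using cv[of k] sq comm by (simp add: b_def)
    next
      case 3
      then show ?thesis unfolding S b1 using cv[of i] sq by (simp add: b_def)
    next
      case 4
      then show ?thesis unfolding S b1 using a'[of i k] sq by (simp add: b_def)
    qed
  qed
  then show ?case by blast
qed auto

text \<open>As an image of the standard normal law this includes the point mass at \<sigma> = 0, so
  degenerate directions of a Gaussian vector need no separate treatment.\<close>

definition centered_normal :: "real \<Rightarrow> real measure" where
  "centered_normal \<sigma> = distr std_normal_distribution borel (\<lambda>x. \<sigma> * x)"

lemma prob_space_centered_normal: "prob_space (centered_normal \<sigma>)"
  unfolding centered_normal_def
  by (rule prob_space.prob_space_distr[OF prob_space_normal_density]) auto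

lemma real_distribution_centered_normal: "real_distribution (centered_normal \<sigma>)"
  using prob_space_centered_normal
  by (simp add: real_distribution_def real_distribution_axioms_def) (simp add: centered_normal_def)

lemma char_centered_normal: "char (centered_normal \<sigma>) t = complex_of_real (exp (- (t * \<sigma>)\<^sup>2 / 2))"
proof -
  have "char (centered_normal \<sigma>) t = (CLINT x|std_normal_distribution. iexp ((t * \<sigma>) * x))"
    unfolding char_def centered_normal_def by (subst integral_distr) (auto simp: mult.assoc)
  then show ?thesis
    using fun_cong[OF char_std_normal_distribution, of "t * \<sigma>"] by (simp only: char_def)
qed

lemma normal_law_centered_normal:
  assumes "\<sigma> \<ge> 0"
  shows "normal_law (centered_normal \<sigma>)"
proof (cases "\<sigma> = 0")
  case True
  have "centered_normal 0 = distr std_normal_distribution borel (\<lambda>_. 0)"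
    unfolding centered_normal_def by (rule distr_cong) auto
  also have "\<dots> = return borel 0"
    by (rule prob_space.distr_const[OF prob_space_normal_density]) auto
  finally have "centered_normal 0 = return borel 0" .
  then show ?thesis using True by (auto simp: normal_law_def)
next
  case False
  interpret prob_space std_normal_distribution by (rule prob_space_normal_density) simp
  have "distributed std_normal_distribution lborel (\<lambda>x. x) std_normal_density"
    by (auto simp: distributed_def distr_id2)
  from normal_density_affine[OF this, of \<sigma> 0] False assms
  have "distributed std_normal_distribution lborel (\<lambda>x. \<sigma> * x) (normal_density 0 \<sigma>)" by simp
  then have "distr std_normal_distribution lborel (\<lambda>x. \<sigma> * x) = density lborel (normal_density 0 \<sigma>)"
    by (simp add: distributed_def)
  moreover have "distr std_normal_distribution lborel (\<lambda>x. \<sigma> * x) = centered_normal \<sigma>"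
    unfolding centered_normal_def by (rule distr_cong) auto
  ultimately show ?thesis using False assms unfolding normal_law_def by (metis order_le_less)
qed

lemma centered_normal_moments:
  "(\<integral>x. x \<partial>centered_normal \<sigma>) = 0" "(\<integral>x. x\<^sup>2 \<partial>centered_normal \<sigma>) = \<sigma>\<^sup>2"
proof -
  show "(\<integral>x. x \<partial>centered_normal \<sigma>) = 0"
    using integral_std_normal_distribution_moment_odd[of 1]
    unfolding centered_normal_def by (subst integral_distr) auto
  have "(\<integral>x. x\<^sup>2 \<partial>centered_normal \<sigma>) = \<sigma>\<^sup>2 * (\<integral>x. x\<^sup>2 \<partial>std_normal_distribution)"
    unfolding centered_normal_def by (subst integral_distr) (auto simp: power_mult_distrib)
  then show "(\<integral>x. x\<^sup>2 \<partial>centered_normal \<sigma>) = \<sigma>\<^sup>2"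
    using std_normal_distribution_even_moments(1)[of 1] by (simp add: fact_numeral)
qed

text \<open>A linear image of independent standard normal variables, the matrix being a square root
  of the second moment matrix of Y; characteristic functions identify its projections. The
  one-dimensional projections are all that normality, the limit theorem and the asymptotic variances
  refer to.\<close>

lemma gaussian_exists:
  fixes Y :: "'a \<Rightarrow> real^'m"
  assumes [measurable]: "Y \<in> borel_measurable M"
    and int: "\<And>i. integrable M (\<lambda>x. (Y x $ i)\<^sup>2)"
  obtains L :: "(real^'m) measure" where "prob_space L" "sets L = sets borel"
    "\<And>t. distr L borel (\<lambda>x. t \<bullet> x) = centered_normal (sqrt (\<integral>x. (t \<bullet> Y x)\<^sup>2 \<partial>M))"
proof -
  have Ym[measurable]: "(\<lambda>x. Y x $ i) \<in> borel_measurable M" for i by measurable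
  obtain a :: "'m \<Rightarrow> 'm \<Rightarrow> real" where a: "\<And>i j. (\<Sum>k\<in>UNIV. a i k * a j k) = (\<integral>x. Y x $ i * Y x $ j \<partial>M)"
    using gram_factorization[of UNIV "\<lambda>i x. Y x $ i" M] int by auto
  interpret P: product_prob_space "\<lambda>_::'m. std_normal_distribution" UNIV
    by (intro product_prob_spaceI prob_space_normal_density) simp
  define Q where "Q = PiM (UNIV :: 'm set) (\<lambda>_. std_normal_distribution)"
  interpret Q: prob_space Q unfolding Q_def
    by (intro prob_space_PiM prob_space_normal_density) simp
  have [measurable]: "(\<lambda>g. g k) \<in> borel_measurable Q" for k :: 'm
    unfolding Q_def using measurable_component_singleton[of k UNIV "\<lambda>_. std_normal_distribution"] by simp
  define G where "G g = (\<chi> i. \<Sum>k\<in>UNIV. a i k * g k)" for g :: "'m \<Rightarrow> real"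
  have [measurable]: "G \<in> borel_measurable Q"
    unfolding G_def by (intro borel_measurable_vec_lambda) measurable
  define L where "L = distr Q borel G"
  have "prob_space L" unfolding L_def by (rule Q.prob_space_distr) simp
  moreover have "sets L = sets borel" by (simp add: L_def)
  moreover have "distr L borel (\<lambda>x. t \<bullet> x) = centered_normal (sqrt (\<integral>x. (t \<bullet> Y x)\<^sup>2 \<partial>M))" for t
  proof (rule Levy_uniqueness)
    define c where "c k = (\<Sum>i\<in>UNIV. t $ i * a i k)" for k
    have tG: "t \<bullet> G g = (\<Sum>k\<in>UNIV. c k * g k)" for g
    proof -
      have "t \<bullet> G g = (\<Sum>i\<in>UNIV. \<Sum>k\<in>UNIV. t $ i * a i k * g k)"
        by (simp add: G_def inner_vec_def sum_distrib_left mult.assoc)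
      then show ?thesis by (subst (asm) sum.swap) (simp add: c_def sum_distrib_right)
    qed
    have var: "(\<Sum>k\<in>UNIV. (c k)\<^sup>2) = (\<integral>x. (t \<bullet> Y x)\<^sup>2 \<partial>M)"
    proof -
      have "(\<Sum>k\<in>UNIV. (c k)\<^sup>2) = (\<Sum>k\<in>UNIV. \<Sum>i\<in>UNIV. \<Sum>j\<in>UNIV. t $ i * t $ j * (a i k * a j k))"
        by (simp add: c_def power2_eq_square sum_product mult_ac)
      also have "\<dots> = (\<Sum>i\<in>UNIV. \<Sum>j\<in>UNIV. t $ i * t $ j * (\<Sum>k\<in>UNIV. a i k * a j k))"
        unfolding sum_distrib_left by (subst sum.swap, rule sum.cong[OF refl], rule sum.swap)
      also have "\<dots> = (\<integral>x. (\<Sum>i\<in>UNIV. \<Sum>j\<in>UNIV. t $ i * t $ j * (Y x $ i * Y x $ j)) \<partial>M)"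
        unfolding a using int by (simp add: integrable_mult_square)
      also have "\<dots> = (\<integral>x. (t \<bullet> Y x)\<^sup>2 \<partial>M)"
        by (simp add: inner_vec_def power2_eq_square sum_product mult_ac)
      finally show ?thesis .
    qed
    have "char (distr L borel (\<lambda>x. t \<bullet> x)) s = complex_of_real (exp (- (s * sqrt (\<integral>x. (t \<bullet> Y x)\<^sup>2 \<partial>M))\<^sup>2 / 2))" for s
    proof -
      have "char (distr L borel (\<lambda>x. t \<bullet> x)) s = (CLINT g|Q. iexp (s * (t \<bullet> G g)))"
        unfolding char_def L_def by (simp add: integral_distr distr_distr comp_def)
      also have "\<dots> = (CLINT g|Q. (\<Prod>k\<in>UNIV. iexp ((s * c k) * g k)))"
        by (simp add: tG sum_distrib_left exp_sum mult_ac)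
      also have "\<dots> = (\<Prod>k\<in>UNIV. CLINT x|std_normal_distribution. iexp ((s * c k) * x))"
        unfolding Q_def
      proof (rule P.product_integral_prod)
        show "complex_integrable std_normal_distribution (\<lambda>x. iexp (s * c k * x))" for k
          by (rule prob_space.integrable_iexp[OF prob_space_normal_density]) auto
      qed simp
      also have "\<dots> = (\<Prod>k\<in>UNIV. complex_of_real (exp (- (s * c k)\<^sup>2 / 2)))"
        using fun_cong[OF char_std_normal_distribution] by (simp only: char_def)
      also have "\<dots> = complex_of_real (exp (\<Sum>k\<in>UNIV. - (s * c k)\<^sup>2 / 2))"
        by (simp add: exp_sum)
      also have "(\<Sum>k\<in>UNIV. - (s * c k)\<^sup>2 / 2) = - (s * sqrt (\<integral>x. (t \<bullet> Y x)\<^sup>2 \<partial>M))\<^sup>2 / 2"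
        by (simp add: power_mult_distrib sum_distrib_left[symmetric] sum_divide_distrib[symmetric]
            sum_negf var)
      finally show ?thesis .
    qed
    then show "char (distr L borel (\<lambda>x. t \<bullet> x)) = char (centered_normal (sqrt (\<integral>x. (t \<bullet> Y x)\<^sup>2 \<partial>M)))"
      by (simp add: char_centered_normal fun_eq_iff)
    show "real_distribution (distr L borel (\<lambda>x. t \<bullet> x))"
      using prob_space.prob_space_distr[OF \<open>prob_space L\<close>, of "\<lambda>x. t \<bullet> x" borel]
      by (simp add: real_distribution_def real_distribution_axioms_def L_def)
  qed (rule real_distribution_centered_normal)
  ultimately show ?thesis by (rule that)
qed

section \<open>The multivariate central limit theorem\<close>

text \<open>Trigonometric polynomials as test functions. Closure under products is derived from the
  product-to-sum formula instead of being a rule, so convergence of expectations has to be checked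
  for single cosines only. The phase c makes sines available.\<close>

inductive trig_sum :: "('b::euclidean_space \<Rightarrow> real) \<Rightarrow> bool" where
  trig_sum_cos: "trig_sum (\<lambda>x. cos (t \<bullet> x + c))"
| trig_sum_scale: "trig_sum f \<Longrightarrow> trig_sum (\<lambda>x. a * f x)"
| trig_sum_add: "trig_sum f \<Longrightarrow> trig_sum g \<Longrightarrow> trig_sum (\<lambda>x. f x + g x)"

lemma trig_sum_const: "trig_sum (\<lambda>_ :: 'b::euclidean_space. c)"
  using trig_sum_scale[OF trig_sum_cos[of "0 :: 'b" 0], of c] by simp

lemma trig_sum_sin: "trig_sum (\<lambda>x. sin (t \<bullet> x))"
proof -
  have "cos (t \<bullet> x - pi / 2) = sin (t \<bullet> x)" for x
    by (simp add: cos_diff)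
  then show ?thesis using trig_sum_cos[of t "- (pi/2)"] by simp
qed

lemma trig_sum_mult:
  assumes "trig_sum f" "trig_sum g"
  shows "trig_sum (\<lambda>x. f x * g x)"
  using assms(1)
proof induction
  case (trig_sum_cos t c)
  show ?case using assms(2)
  proof induction
    case (trig_sum_cos s d)
    have "cos (t \<bullet> x + c) * cos (s \<bullet> x + d) =
        1/2 * cos ((t - s) \<bullet> x + (c - d)) + 1/2 * cos ((t + s) \<bullet> x + (c + d))" for x
      by (simp add: cos_times_cos inner_add_left inner_diff_left algebra_simps)
    then show ?case
      using trig_sum_add[OF trig_sum_scale[OF trig_sum.trig_sum_cos[of "t - s" "c - d"], of "1/2"]
          trig_sum_scale[OF trig_sum.trig_sum_cos[of "t + s" "c + d"], of "1/2"]] by simp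
  next
    case (trig_sum_scale g a)
    then show ?case using trig_sum.trig_sum_scale[of _ a] by (simp add: mult.left_commute)
  next
    case (trig_sum_add g h)
    then show ?case using trig_sum.trig_sum_add by (simp add: distrib_left)
  qed
next
  case (trig_sum_scale f a)
  then show ?case using trig_sum.trig_sum_scale[of _ a] by (simp add: mult.assoc)
next
  case (trig_sum_add f h)
  then show ?case using trig_sum.trig_sum_add by (simp add: distrib_right)
qed

lemma trig_sum_sum:
  "(\<And>i. i \<in> I \<Longrightarrow> trig_sum (f i)) \<Longrightarrow> trig_sum (\<lambda>x. \<Sum>i\<in>I. f i x)"
  by (induction I rule: infinite_finite_induct) (auto intro: trig_sum_add trig_sum_const)

lemma trig_sum_polynomial:
  assumes "real_polynomial_function p"
  shows "trig_sum (\<lambda>x :: 'b::euclidean_space. p (\<Sum>b\<in>Basis. sin (c * (x \<bullet> b)) *\<^sub>R b))"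
  using assms
proof induction
  case (linear f)
  then interpret bounded_linear f .
  have "trig_sum (\<lambda>x :: 'b. \<Sum>b\<in>Basis. f b * sin ((c *\<^sub>R b) \<bullet> x))"
    by (intro trig_sum_sum trig_sum_scale trig_sum_sin)
  then show ?case by (simp add: sum scaleR mult.commute inner_commute)
qed (auto intro: trig_sum_const trig_sum_add trig_sum_mult)

text \<open>Polynomials in \<open>sin (c x\<^sub>i)\<close> approximate uniformly on a cube and stay bounded outside of it.\<close>

lemma trig_sum_approx:
  fixes f :: "'b::euclidean_space \<Rightarrow> real"
  assumes f: "continuous_on UNIV f" "\<And>x. \<bar>f x\<bar> \<le> B" and K: "K > 0" and \<epsilon>: "\<epsilon> > 0"
  obtains h where "trig_sum h" "\<And>x. (\<And>b. b \<in> Basis \<Longrightarrow> \<bar>x \<bullet> b\<bar> \<le> K) \<Longrightarrow> \<bar>f x - h x\<bar> \<le> \<epsilon>"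
    "\<And>x. \<bar>h x\<bar> \<le> B + \<epsilon>"
proof -
  \<comment> \<open>Chosen such that the cube of half-width K is mapped to [-\<pi>/2, \<pi>/2] in
    each coordinate, where arcsin inverts sin.\<close>
  define c where "c = pi / (2 * K)"
  have c: "c > 0" using K by (simp add: c_def)
  define S where "S = cbox (- One) (One :: 'b)"
  have S: "u \<in> S \<longleftrightarrow> (\<forall>b\<in>Basis. - 1 \<le> u \<bullet> b \<and> u \<bullet> b \<le> 1)" for u :: 'b
    by (simp add: S_def mem_box)
  \<comment> \<open>The function f in the coordinates u = sin(c x). Since g is bounded by B on all
    of S and the sines always land in S, the polynomial is bounded also outside of the cube.\<close>
  define g where "g u = f (\<Sum>b\<in>Basis. (arcsin (u \<bullet> b) / c) *\<^sub>R b)" for u :: 'b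
  have "continuous_on S (\<lambda>u. \<Sum>b\<in>Basis. (arcsin (u \<bullet> b) / c) *\<^sub>R b)"
  proof (intro continuous_on_sum continuous_on_scaleR continuous_on_const continuous_on_divide)
    fix b :: 'b assume "b \<in> Basis"
    then show "continuous_on S (\<lambda>u. arcsin (u \<bullet> b))"
      by (intro continuous_on_arcsin continuous_on_inner continuous_on_id continuous_on_const)
        (auto simp: S)
  qed (use c in auto)
  then have "continuous_on S g"
    unfolding g_def by (rule continuous_on_compose2[OF f(1)]) auto
  moreover have "compact S" by (simp add: S_def)
  ultimately obtain p where p: "real_polynomial_function p" "\<And>u. u \<in> S \<Longrightarrow> \<bar>g u - p u\<bar> < \<epsilon>"
    using Stone_Weierstrass_real_polynomial_function[of S g \<epsilon>] \<epsilon> by auto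
  define s where "s x = (\<Sum>b\<in>Basis. sin (c * (x \<bullet> b)) *\<^sub>R b)" for x :: 'b
  have s_inner: "s x \<bullet> b = sin (c * (x \<bullet> b))" if "b \<in> Basis" for x b
    unfolding s_def using that by simp
  have s: "s x \<in> S" for x by (simp add: S s_inner)
  have "trig_sum (\<lambda>x. p (s x))" unfolding s_def by (rule trig_sum_polynomial[OF p(1)])
  moreover have "\<bar>f x - p (s x)\<bar> \<le> \<epsilon>" if x: "\<And>b. b \<in> Basis \<Longrightarrow> \<bar>x \<bullet> b\<bar> \<le> K" for x
  proof -
    have "arcsin (s x \<bullet> b) / c = x \<bullet> b" if b: "b \<in> Basis" for b
    proof -
      have "\<bar>c * (x \<bullet> b)\<bar> \<le> c * K" using c x[OF b] by (simp add: abs_mult)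
      also have "\<dots> = pi / 2" using K by (simp add: c_def)
      finally have "arcsin (sin (c * (x \<bullet> b))) = c * (x \<bullet> b)"
        by (intro arcsin_sin) (auto simp: abs_le_iff)
      then show ?thesis using c b by (simp add: s_inner)
    qed
    then have "g (s x) = f x" by (simp add: g_def euclidean_representation)
    then show ?thesis using p(2)[OF s[of x]] by simp
  qed
  moreover have "\<bar>p (s x)\<bar> \<le> B + \<epsilon>" for x
    using p(2)[OF s[of x]] f(2)[of "\<Sum>b\<in>Basis. (arcsin (s x \<bullet> b) / c) *\<^sub>R b"]
    unfolding g_def by linarith
  ultimately show ?thesis by (rule that)
qed

lemma trig_sum_bounded_measurable:
  assumes "trig_sum h"
  shows "h \<in> borel_measurable borel" "\<exists>C. \<forall>x. \<bar>h x\<bar> \<le> C"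
proof -
  have "h \<in> borel_measurable borel \<and> (\<exists>C. \<forall>x. \<bar>h x\<bar> \<le> C)"
    using assms
  proof induction
    case (trig_sum_cos t c)
    then show ?case by (auto intro!: exI[of _ 1])
  next
    case (trig_sum_scale f a)
    then obtain C where "\<And>x. \<bar>f x\<bar> \<le> C" by auto
    then have "\<bar>a * f x\<bar> \<le> \<bar>a\<bar> * C" for x by (simp add: abs_mult mult_left_mono)
    then show ?case using trig_sum_scale by auto
  next
    case (trig_sum_add f g)
    then obtain C D where CD: "\<And>x. \<bar>f x\<bar> \<le> C" "\<And>x. \<bar>g x\<bar> \<le> D" by auto
    have "\<bar>f x + g x\<bar> \<le> C + D" for x using CD[of x] by linarith
    then show ?case using trig_sum_add by auto
  qed
  then show "h \<in> borel_measurable borel" "\<exists>C. \<forall>x. \<bar>h x\<bar> \<le> C" by auto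
qed

lemma (in prob_space) integrable_bounded_real:
  fixes f :: "'a \<Rightarrow> real"
  assumes "f \<in> borel_measurable M" "\<And>x. \<bar>f x\<bar> \<le> C"
  shows "integrable M f"
  by (rule integrable_const_bound[of _ C]) (use assms in auto)

lemma (in prob_space) expectation_diff_le:
  fixes f g :: "'a \<Rightarrow> real"
  assumes [measurable]: "f \<in> borel_measurable M" "g \<in> borel_measurable M" "A \<in> sets M"
    and b: "\<And>x. \<bar>f x\<bar> \<le> C" "\<And>x. \<bar>g x\<bar> \<le> D"
    and close: "\<And>x. x \<in> space M \<Longrightarrow> x \<notin> A \<Longrightarrow> \<bar>f x - g x\<bar> \<le> \<epsilon>" and \<epsilon>: "\<epsilon> \<ge> 0"
  shows "\<bar>expectation f - expectation g\<bar> \<le> \<epsilon> + (C + D) * prob A"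
proof -
  have int: "integrable M f" "integrable M g"
    using integrable_bounded_real[of f C] integrable_bounded_real[of g D] b by auto
  have intA: "integrable M (indicat_real A)"
    by (rule integrable_bounded_real[of _ 1]) (auto simp: indicator_def)
  have "\<bar>expectation f - expectation g\<bar> = \<bar>expectation (\<lambda>x. f x - g x)\<bar>"
    using int by simp
  also have "\<dots> \<le> expectation (\<lambda>x. \<bar>f x - g x\<bar>)" by (rule integral_abs_bound)
  also have "\<dots> \<le> expectation (\<lambda>x. \<epsilon> + (C + D) * indicator A x)"
  proof (rule integral_mono)
    fix x assume x: "x \<in> space M"
    show "\<bar>f x - g x\<bar> \<le> \<epsilon> + (C + D) * indicator A x"
      using b[of x] close[OF x] \<epsilon> by (auto simp: indicator_def)
  next
    show "integrable M (\<lambda>x. \<epsilon> + (C + D) * indicator A x)" using intA by simp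
  qed (use int in auto)
  also have "\<dots> = \<epsilon> + (C + D) * prob A" using intA by (simp add: prob_space)
  finally show ?thesis .
qed

text \<open>A continuity theorem in several dimensions: cosines determine all trigonometric sums,
  tightness confines the mass to a cube, and there a bounded continuous function is uniformly close
  to such a sum.\<close>

lemma converges_in_distributionI_cos:
  fixes X :: "nat \<Rightarrow> 'w \<Rightarrow> 'b::euclidean_space"
  assumes M: "prob_space M" and X[measurable]: "\<And>n. X n \<in> borel_measurable M"
    and L: "prob_space L" "sets L = sets borel"
    and conv: "\<And>t c. (\<lambda>n. \<integral>\<omega>. cos (t \<bullet> X n \<omega> + c) \<partial>M) \<longlonglongrightarrow> (\<integral>x. cos (t \<bullet> x + c) \<partial>L)"
    and tight: "\<And>\<epsilon>. \<epsilon> > 0 \<Longrightarrow> \<exists>K>0. (\<forall>\<^sub>F n in sequentially. measure M {\<omega> \<in> space M. \<exists>b\<in>Basis. \<bar>X n \<omega> \<bullet> b\<bar> > K} \<le> \<epsilon>)"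
  shows "converges_in_distribution M X L"
  unfolding converges_in_distribution_def
proof (intro allI impI)
  interpret M: prob_space M by fact
  interpret L: prob_space L by fact
  note [measurable_cong] = L(2)
  have space_L: "space L = UNIV" using sets_eq_imp_space_eq[OF L(2)] by simp
  have trig_conv: "(\<lambda>n. \<integral>\<omega>. h (X n \<omega>) \<partial>M) \<longlonglongrightarrow> (\<integral>x. h x \<partial>L)" if "trig_sum h" for h
    using that
  proof induction
    case (trig_sum_cos t c)
    then show ?case by (rule conv)
  next
    case (trig_sum_scale f a)
    then show ?case by (simp add: tendsto_mult)
  next
    case (trig_sum_add f g)
    obtain C D where CD: "\<And>x. \<bar>f x\<bar> \<le> C" "\<And>x. \<bar>g x\<bar> \<le> D"
      using trig_sum_bounded_measurable(2)[OF trig_sum_add.hyps(1)] trig_sum_bounded_measurable(2)[OF trig_sum_add.hyps(2)] by auto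
    note [measurable] = trig_sum_bounded_measurable(1)[OF trig_sum_add.hyps(1)] trig_sum_bounded_measurable(1)[OF trig_sum_add.hyps(2)]
    have "integrable M (\<lambda>\<omega>. f (X n \<omega>))" "integrable M (\<lambda>\<omega>. g (X n \<omega>))" for n
      using CD by (auto intro!: M.integrable_bounded_real)
    moreover have "integrable L f" "integrable L g"
      using CD by (auto intro!: L.integrable_bounded_real)
    ultimately show ?case using tendsto_add[OF trig_sum_add.IH] by simp
  qed
  fix f :: "'b \<Rightarrow> real" assume f: "continuous_on UNIV f \<and> bounded (range f)"
  then obtain B where B: "\<And>x. \<bar>f x\<bar> \<le> B" by (auto simp: bounded_iff)
  have B0: "B \<ge> 0" using B[of 0] by linarith
  have f_meas[measurable]: "f \<in> borel_measurable borel" using f by (intro borel_measurable_continuous_onI) auto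
  show "(\<lambda>n. \<integral>\<omega>. f (X n \<omega>) \<partial>M) \<longlonglongrightarrow> (\<integral>x. f x \<partial>L)"
  proof (rule tendstoI)
    fix e :: real assume e: "e > 0"
    \<comment> \<open>Three errors \<epsilon> and two tail contributions of at most (2 B + 1)
      \<epsilon> give (4 B + 5) \<epsilon> in total, which 4 B + 8 covers; \<epsilon> \<le> 1 bounds
      the supremum B + \<epsilon> of the approximation.\<close>
    define \<epsilon> where "\<epsilon> = min 1 (e / (4 * B + 8))"
    have \<epsilon>: "\<epsilon> > 0" "\<epsilon> \<le> 1" using e B0 by (auto simp: \<epsilon>_def)
    have \<epsilon>e: "\<epsilon> * (4 * B + 8) \<le> e"
      using e B0 by (simp add: \<epsilon>_def min_def divide_simps split: if_splits)
    obtain K1 where K1: "K1 > 0" "\<forall>\<^sub>F n in sequentially. measure M {\<omega> \<in> space M. \<exists>b\<in>Basis. \<bar>X n \<omega> \<bullet> b\<bar> > K1} \<le> \<epsilon>"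
      using tight[OF \<epsilon>(1)] by auto
    have "(\<lambda>k. measure L {x. \<exists>b\<in>Basis. \<bar>x \<bullet> b\<bar> > real k}) \<longlonglongrightarrow> measure L (\<Inter>k. {x. \<exists>b\<in>Basis. \<bar>x \<bullet> b\<bar> > real k})"
    proof (rule L.finite_Lim_measure_decseq)
      show "decseq (\<lambda>k. {x :: 'b. \<exists>b\<in>Basis. \<bar>x \<bullet> b\<bar> > real k})"
        unfolding decseq_def by safe (meson of_nat_mono order.strict_trans1)
    qed auto
    also have "(\<Inter>k. {x. \<exists>b\<in>Basis. \<bar>x \<bullet> b\<bar> > real k}) = ({} :: 'b set)"
    proof -
      have "\<exists>k. \<forall>b\<in>Basis. \<bar>x \<bullet> b\<bar> \<le> real k" for x :: 'b
      proof -
        obtain k where "norm x \<le> real k" using real_arch_simple by blast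
        then show ?thesis using Basis_le_norm[of _ x] by (meson order_trans)
      qed
      then show ?thesis by (simp add: set_eq_iff not_less)
    qed
    finally have "(\<lambda>k. measure L {x. \<exists>b\<in>Basis. \<bar>x \<bullet> b\<bar> > real k}) \<longlonglongrightarrow> 0" by simp
    from order_tendstoD(2)[OF this \<epsilon>(1)] obtain k where
      k: "measure L {x. \<exists>b\<in>Basis. \<bar>x \<bullet> b\<bar> > real k} < \<epsilon>"
      by (auto simp: eventually_sequentially)
    define K where "K = max K1 (real k)"
    have K: "K > 0" using K1 by (simp add: K_def)
    have LK: "measure L {x. \<exists>b\<in>Basis. \<bar>x \<bullet> b\<bar> > K} \<le> \<epsilon>"
    proof -
      have "measure L {x. \<exists>b\<in>Basis. \<bar>x \<bullet> b\<bar> > K} \<le> measure L {x. \<exists>b\<in>Basis. \<bar>x \<bullet> b\<bar> > real k}"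
        by (rule L.finite_measure_mono) (auto simp: K_def)
      then show ?thesis using k by linarith
    qed
    have MK: "measure M {\<omega> \<in> space M. \<exists>b\<in>Basis. \<bar>X n \<omega> \<bullet> b\<bar> > K} \<le> measure M {\<omega> \<in> space M. \<exists>b\<in>Basis. \<bar>X n \<omega> \<bullet> b\<bar> > K1}" for n
      by (rule M.finite_measure_mono) (auto simp: K_def)
    obtain h where h: "trig_sum h" "\<And>x. (\<And>b. b \<in> Basis \<Longrightarrow> \<bar>x \<bullet> b\<bar> \<le> K) \<Longrightarrow> \<bar>f x - h x\<bar> \<le> \<epsilon>"
      "\<And>x. \<bar>h x\<bar> \<le> B + \<epsilon>"
      using trig_sum_approx[of f B K \<epsilon>] f B K \<epsilon>(1) by blast
    note [measurable] = trig_sum_bounded_measurable(1)[OF h(1)]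
    have 1: "\<bar>(\<integral>\<omega>. f (X n \<omega>) \<partial>M) - (\<integral>\<omega>. h (X n \<omega>) \<partial>M)\<bar> \<le> \<epsilon> + (B + (B + \<epsilon>)) * measure M {\<omega> \<in> space M. \<exists>b\<in>Basis. \<bar>X n \<omega> \<bullet> b\<bar> > K}" for n
      by (rule M.expectation_diff_le) (use B h \<epsilon> in \<open>auto simp: not_less\<close>)
    have 2: "\<bar>(\<integral>x. f x \<partial>L) - (\<integral>x. h x \<partial>L)\<bar> \<le> \<epsilon> + (B + (B + \<epsilon>)) * measure L {x. \<exists>b\<in>Basis. \<bar>x \<bullet> b\<bar> > K}"
      by (rule L.expectation_diff_le) (use B h \<epsilon> in \<open>auto simp: not_less\<close>)
    have 3: "\<forall>\<^sub>F n in sequentially. dist (\<integral>\<omega>. h (X n \<omega>) \<partial>M) (\<integral>x. h x \<partial>L) < \<epsilon>"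
      by (rule tendstoD[OF trig_conv[OF h(1)] \<epsilon>(1)])
    show "\<forall>\<^sub>F n in sequentially. dist (\<integral>\<omega>. f (X n \<omega>) \<partial>M) (\<integral>x. f x \<partial>L) < e"
      using 3 K1(2)
    proof eventually_elim
      case (elim n)
      have "(B + (B + \<epsilon>)) * measure M {\<omega> \<in> space M. \<exists>b\<in>Basis. \<bar>X n \<omega> \<bullet> b\<bar> > K} \<le> (2 * B + 1) * \<epsilon>"
        using elim(2) MK[of n] B0 \<epsilon> by (intro mult_mono) auto
      moreover have "(B + (B + \<epsilon>)) * measure L {x. \<exists>b\<in>Basis. \<bar>x \<bullet> b\<bar> > K} \<le> (2 * B + 1) * \<epsilon>"
        using LK B0 \<epsilon> by (intro mult_mono) auto
      ultimately have "dist (\<integral>\<omega>. f (X n \<omega>) \<partial>M) (\<integral>x. f x \<partial>L) < 3 * \<epsilon> + 2 * ((2 * B + 1) * \<epsilon>)"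
        using 1[of n] 2 elim(1) unfolding dist_real_def by linarith
      also have "\<dots> \<le> \<epsilon> * (4 * B + 8)" using \<epsilon>(1) by (simp add: algebra_simps)
      finally show ?case using \<epsilon>e by linarith
    qed
  qed
qed

section \<open>Normalized sums of independent identically distributed variables\<close>

lemma (in prob_space) second_moment_iid_sum:
  fixes X :: "nat \<Rightarrow> 'a \<Rightarrow> real"
  assumes indep: "indep_vars (\<lambda>_. borel) X UNIV"
    and sq: "\<And>i. integrable M (\<lambda>\<omega>. (X i \<omega>)\<^sup>2)" and mean: "\<And>i. expectation (X i) = 0"
    and var: "\<And>i. expectation (\<lambda>\<omega>. (X i \<omega>)\<^sup>2) = v"
  shows "integrable M (\<lambda>\<omega>. (\<Sum>i<n. X i \<omega>)\<^sup>2)" "expectation (\<lambda>\<omega>. (\<Sum>i<n. X i \<omega>)\<^sup>2) = real n * v"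
proof -
  have [measurable]: "X i \<in> borel_measurable M" for i using indep by (auto simp: indep_vars_def)
  have int: "integrable M (\<lambda>\<omega>. X i \<omega> * X j \<omega>)" for i j by (intro integrable_mult_square sq) auto
  have int1: "integrable M (X i)" for i
    using square_integrable_imp_integrable[OF _ sq] by auto
  have E: "expectation (\<lambda>\<omega>. X i \<omega> * X j \<omega>) = (if i = j then v else 0)" for i j
  proof (cases "i = j")
    case True
    then show ?thesis using var by (simp add: power2_eq_square)
  next
    case False
    have "indep_vars (\<lambda>_. borel) X {i, j}" using indep by (rule indep_vars_subset) auto
    from indep_vars_lebesgue_integral[OF _ this] False int1 mean show ?thesis by simp
  qed
  have eq: "(\<lambda>\<omega>. (\<Sum>i<n. X i \<omega>)\<^sup>2) = (\<lambda>\<omega>. \<Sum>i<n. \<Sum>j<n. X i \<omega> * X j \<omega>)"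
    by (simp add: power2_eq_square sum_product)
  show "integrable M (\<lambda>\<omega>. (\<Sum>i<n. X i \<omega>)\<^sup>2)" unfolding eq using int by simp
  show "expectation (\<lambda>\<omega>. (\<Sum>i<n. X i \<omega>)\<^sup>2) = real n * v"
    unfolding eq using int by (simp add: E)
qed

lemma (in prob_space) iid_sum_tail:
  fixes X :: "nat \<Rightarrow> 'a \<Rightarrow> real"
  assumes indep: "indep_vars (\<lambda>_. borel) X UNIV"
    and sq: "\<And>i. integrable M (\<lambda>\<omega>. (X i \<omega>)\<^sup>2)" and mean: "\<And>i. expectation (X i) = 0"
    and var: "\<And>i. expectation (\<lambda>\<omega>. (X i \<omega>)\<^sup>2) = v" and K: "K > 0" and n: "n > 0"
  shows "prob {\<omega> \<in> space M. \<bar>(\<Sum>i<n. X i \<omega>) / sqrt (real n)\<bar> \<ge> K} \<le> v / K\<^sup>2"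
proof -
  have [measurable]: "X i \<in> borel_measurable M" for i using indep by (auto simp: indep_vars_def)
  note S = second_moment_iid_sum[OF indep sq mean var, of n]
  have eq: "((\<Sum>i<n. X i \<omega>) / sqrt (real n))\<^sup>2 = (\<Sum>i<n. X i \<omega>)\<^sup>2 / real n" for \<omega>
    by (simp add: power_divide)
  have "integrable M (\<lambda>\<omega>. ((\<Sum>i<n. X i \<omega>) / sqrt (real n))\<^sup>2)" unfolding eq using S(1) by simp
  from second_moment_method[OF _ this K]
  have "prob {\<omega> \<in> space M. \<bar>(\<Sum>i<n. X i \<omega>) / sqrt (real n)\<bar> \<ge> K} \<le> expectation (\<lambda>\<omega>. ((\<Sum>i<n. X i \<omega>) / sqrt (real n))\<^sup>2) / K\<^sup>2"
    by measurable
  also have "expectation (\<lambda>\<omega>. ((\<Sum>i<n. X i \<omega>) / sqrt (real n))\<^sup>2) = v"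
    unfolding eq using S(2) n by simp
  finally show ?thesis .
qed

text \<open>Extends the one-dimensional central limit theorem to variance 0, where the sums vanish
  almost surely. This case does occur, as the projection of the statistic on a given direction may
  be degenerate.\<close>

lemma (in prob_space) iid_char_limit:
  fixes X :: "nat \<Rightarrow> 'a \<Rightarrow> real"
  assumes indep: "indep_vars (\<lambda>_. borel) X UNIV"
    and sq: "\<And>i. integrable M (\<lambda>\<omega>. (X i \<omega>)\<^sup>2)" and mean: "\<And>i. expectation (X i) = 0"
    and var: "\<And>i. expectation (\<lambda>\<omega>. (X i \<omega>)\<^sup>2) = v" and law: "\<And>i. distr M borel (X i) = \<mu>"
  shows "(\<lambda>n. char (distr M borel (\<lambda>\<omega>. (\<Sum>i<n. X i \<omega>) / sqrt (real n))) t) \<longlonglongrightarrow> char (centered_normal (sqrt v)) t"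
proof -
  have [measurable]: "X i \<in> borel_measurable M" for i using indep by (auto simp: indep_vars_def)
  have v0: "v \<ge> 0" using var[of 0] by (metis integral_nonneg_AE always_eventually zero_le_power2)
  show ?thesis
  proof (cases "v = 0")
    case True
    have "AE \<omega> in M. X i \<omega> = 0" for i
      using integral_nonneg_eq_0_iff_AE[OF sq[of i]] var[of i] True by simp
    then have "AE \<omega> in M. \<forall>i. X i \<omega> = 0" by (simp add: AE_all_countable)
    then have "AE \<omega> in M. iexp (t * ((\<Sum>i<n. X i \<omega>) / sqrt (real n))) = 1" for n
      by eventually_elim simp
    then have "(CLINT \<omega>|M. iexp (t * ((\<Sum>i<n. X i \<omega>) / sqrt (real n)))) = (CLINT \<omega>|M. 1)" for n
      by (intro integral_cong_AE) auto
    then have "char (distr M borel (\<lambda>\<omega>. (\<Sum>i<n. X i \<omega>) / sqrt (real n))) t = 1" for n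
      unfolding char_def by (subst integral_distr) (auto simp: prob_space)
    then show ?thesis using True by (simp add: char_centered_normal)
  next
    case False
    then have \<sigma>: "sqrt v > 0" using v0 by simp
    have "weak_conv_m (\<lambda>n. distr M borel (\<lambda>x. (\<Sum>i<n. X i x) / sqrt (real n * (sqrt v)\<^sup>2))) std_normal_distribution"
      by (rule central_limit_theorem_zero_mean[OF indep mean \<sigma> sq _ law])
        (use var mean v0 in simp)
    then have *: "(\<lambda>n. char (distr M borel (\<lambda>x. (\<Sum>i<n. X i x) / sqrt (real n * (sqrt v)\<^sup>2))) s) \<longlonglongrightarrow> char std_normal_distribution s" for s
      by (intro levy_continuity1 real_dist_normal_dist)
        (auto simp: real_distribution_def real_distribution_axioms_def intro!: prob_space_distr)
    have "char (distr M borel (\<lambda>x. (\<Sum>i<n. X i x) / sqrt (real n * (sqrt v)\<^sup>2))) (sqrt v * t)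
        = char (distr M borel (\<lambda>\<omega>. (\<Sum>i<n. X i \<omega>) / sqrt (real n))) t" for n
    proof -
      have "(sqrt v * t) * ((\<Sum>i<n. X i x) / sqrt (real n * (sqrt v)\<^sup>2)) = t * ((\<Sum>i<n. X i x) / sqrt (real n))" for x
        using \<sigma> v0 by (simp add: real_sqrt_mult)
      then show ?thesis unfolding char_def by (subst (1 2) integral_distr) (auto simp del: of_real_mult simp: of_real_mult[symmetric])
    qed
    moreover have "char std_normal_distribution (sqrt v * t) = char (centered_normal (sqrt v)) t"
      by (simp add: char_std_normal_distribution char_centered_normal mult.commute)
    ultimately show ?thesis using *[of "sqrt v * t"] by simp
  qed
qed

lemma abs_cos_diff_le: "\<bar>cos x - cos y\<bar> \<le> \<bar>x - y\<bar>" for x y :: real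
proof -
  have "\<bar>cos x - cos y\<bar> = 2 * \<bar>sin ((x + y) / 2)\<bar> * \<bar>sin ((y - x) / 2)\<bar>"
    by (simp add: cos_diff_cos abs_mult)
  also have "\<dots> \<le> 2 * 1 * \<bar>(y - x) / 2\<bar>"
    by (intro mult_mono abs_sin_x_le_abs_x) auto
  finally show ?thesis by (simp add: abs_minus_commute)
qed

lemma (in prob_space) expectation_cos_char:
  assumes [measurable]: "T \<in> borel_measurable M"
  shows "expectation (\<lambda>\<omega>. cos (T \<omega> + c)) = Re (char (distr M borel T) 1 * cis c)"
proof -
  have int: "complex_integrable M (\<lambda>\<omega>. iexp (T \<omega>))" by (rule integrable_iexp) auto
  have "expectation (\<lambda>\<omega>. cos (T \<omega> + c)) = expectation (\<lambda>\<omega>. Re (iexp (T \<omega>) * cis c))"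
    by (simp add: cis_conv_exp[symmetric] cis_mult)
  also have "\<dots> = Re (CLINT \<omega>|M. iexp (T \<omega>) * cis c)"
    using int by (intro integral_Re) simp
  also have "(CLINT \<omega>|M. iexp (T \<omega>) * cis c) = char (distr M borel T) 1 * cis c"
    unfolding char_def by (subst integral_distr) (use int in auto)
  finally show ?thesis .
qed

text \<open>Combines projection to one dimension with the removal of a remainder that is null in
  probability: cosines are Lipschitz, so the remainder does not change the limit of their
  expectations, and tightness follows from Chebyshev's inequality in each coordinate.\<close>

lemma multivariate_clt:
  fixes Z :: "nat \<Rightarrow> 'w \<Rightarrow> 'c::topological_space" and Y :: "'c \<Rightarrow> 'b::euclidean_space"
  assumes M: "prob_space M"
    and indep: "prob_space.indep_vars M (\<lambda>_. borel) Z UNIV" and law: "\<And>i. distr M borel (Z i) = F"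
    and Y[measurable]: "Y \<in> borel_measurable borel"
    and sq: "\<And>b. b \<in> Basis \<Longrightarrow> integrable F (\<lambda>z. (Y z \<bullet> b)\<^sup>2)"
    and mean: "\<And>b. b \<in> Basis \<Longrightarrow> (\<integral>z. Y z \<bullet> b \<partial>F) = 0"
    and X[measurable]: "\<And>n. X n \<in> borel_measurable M"
    and R: "converges_in_probability M (\<lambda>n \<omega>. X n \<omega> - (1 / sqrt (real n)) *\<^sub>R (\<Sum>i<n. Y (Z i \<omega>))) 0"
    and L: "prob_space L" "sets L = sets borel"
    and L_law: "\<And>t. distr L borel (\<lambda>x. t \<bullet> x) = centered_normal (sqrt (\<integral>z. (t \<bullet> Y z)\<^sup>2 \<partial>F))"
  shows "converges_in_distribution M X L"
proof -
  interpret M: prob_space M by fact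
  interpret L: prob_space L by fact
  note [measurable_cong] = L(2)
  have Z[measurable]: "Z i \<in> borel_measurable M" for i using indep by (auto simp: M.indep_vars_def)
  have setsF[measurable_cong]: "sets F = sets borel" using law[of 0] by auto
  define S where "S n \<omega> = (1 / sqrt (real n)) *\<^sub>R (\<Sum>i<n. Y (Z i \<omega>))" for n \<omega>
  have S[measurable]: "S n \<in> borel_measurable M" for n unfolding S_def by measurable
  define T where "T t i \<omega> = t \<bullet> Y (Z i \<omega>)" for t i \<omega>
  have tS: "t \<bullet> S n \<omega> = (\<Sum>i<n. T t i \<omega>) / sqrt (real n)" for t n \<omega>
    by (simp add: S_def T_def inner_sum_right)
  have T_indep: "M.indep_vars (\<lambda>_. borel) (T t) UNIV" for t
    unfolding T_def by (rule M.indep_vars_compose2[OF indep]) measurable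
  have YY: "integrable F (\<lambda>z. (Y z \<bullet> b) * (Y z \<bullet> b'))" if "b \<in> Basis" "b' \<in> Basis" for b b'
    using sq that by (intro integrable_mult_square) auto
  have tY: "t \<bullet> Y z = (\<Sum>b\<in>Basis. (t \<bullet> b) * (Y z \<bullet> b))" for t z
    by (rule euclidean_inner)
  have F_sq: "integrable F (\<lambda>z. (t \<bullet> Y z)\<^sup>2)" for t
  proof -
    have "(t \<bullet> Y z)\<^sup>2 = (\<Sum>b\<in>Basis. \<Sum>b'\<in>Basis. (t \<bullet> b) * (t \<bullet> b') * ((Y z \<bullet> b) * (Y z \<bullet> b')))" for z
      by (simp add: tY power2_eq_square sum_product mult_ac)
    then show ?thesis using YY by simp
  qed
  have Fp: "prob_space F" using M.prob_space_distr[of "Z 0" borel] law[of 0] by simp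
  interpret F: prob_space F by (rule Fp)
  have int_b: "integrable F (\<lambda>z. Y z \<bullet> b)" if "b \<in> Basis" for b
    using F.square_integrable_imp_integrable[OF _ sq[OF that]] by auto
  have F_mean: "(\<integral>z. t \<bullet> Y z \<partial>F) = 0" for t
    unfolding tY using int_b mean by simp
  have transfer: "(\<integral>\<omega>. g (Z i \<omega>) \<partial>M) = (\<integral>z. g z \<partial>F)" if [measurable]: "g \<in> borel_measurable borel" for g :: "'c \<Rightarrow> real" and i
    unfolding law[of i, symmetric] by (subst integral_distr) auto
  have T_sq: "integrable M (\<lambda>\<omega>. (T t i \<omega>)\<^sup>2)" for t i
    using F_sq[of t] unfolding law[of i, symmetric] T_def by (subst (asm) integrable_distr_eq) auto
  have T_mean: "M.expectation (T t i) = 0" for t i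
    unfolding T_def using transfer[of "\<lambda>z. t \<bullet> Y z" i] F_mean by simp
  have T_var: "M.expectation (\<lambda>\<omega>. (T t i \<omega>)\<^sup>2) = (\<integral>z. (t \<bullet> Y z)\<^sup>2 \<partial>F)" for t i
    unfolding T_def using transfer[of "\<lambda>z. (t \<bullet> Y z)\<^sup>2" i] by simp
  have T_law: "distr M borel (T t i) = distr F borel (\<lambda>z. t \<bullet> Y z)" for t i
    unfolding T_def law[of i, symmetric] by (subst distr_distr) (auto simp: comp_def)
  have R': "(\<lambda>n. M.prob {\<omega> \<in> space M. norm (X n \<omega> - S n \<omega>) > \<epsilon>}) \<longlonglongrightarrow> 0" if "\<epsilon> > 0" for \<epsilon>
    using R that by (simp add: converges_in_probability_def S_def)
  show ?thesis
  proof (rule converges_in_distributionI_cos[OF M X L])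
    fix t c
    have "(\<lambda>n. char (distr M borel (\<lambda>\<omega>. t \<bullet> S n \<omega>)) 1) \<longlonglongrightarrow> char (distr L borel (\<lambda>x. t \<bullet> x)) 1"
      unfolding tS L_law by (rule M.iid_char_limit[OF T_indep T_sq T_mean T_var T_law])
    then have "(\<lambda>n. Re (char (distr M borel (\<lambda>\<omega>. t \<bullet> S n \<omega>)) 1 * cis c)) \<longlonglongrightarrow> Re (char (distr L borel (\<lambda>x. t \<bullet> x)) 1 * cis c)"
      by (intro tendsto_Re tendsto_mult tendsto_const)
    then have lim: "(\<lambda>n. \<integral>\<omega>. cos (t \<bullet> S n \<omega> + c) \<partial>M) \<longlonglongrightarrow> (\<integral>x. cos (t \<bullet> x + c) \<partial>L)"
      by (simp add: M.expectation_cos_char L.expectation_cos_char)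
    have "(\<lambda>n. (\<integral>\<omega>. cos (t \<bullet> X n \<omega> + c) \<partial>M) - (\<integral>\<omega>. cos (t \<bullet> S n \<omega> + c) \<partial>M)) \<longlonglongrightarrow> 0"
    proof (rule tendstoI)
      fix e :: real assume e: "e > 0"
      \<comment> \<open>A remainder of at most \<delta> costs at most e / 2, and the exceptional
        event less than e / 2; the summand 1 avoids a division by 0 for t = 0.\<close>
      define \<delta> where "\<delta> = e / (2 * (norm t + 1))"
      have \<delta>: "\<delta> > 0" using e by (simp add: \<delta>_def add_nonneg_pos)
      have t\<delta>: "norm t * \<delta> \<le> e / 2"
      proof -
        have "norm t * \<delta> \<le> (norm t + 1) * \<delta>" using \<delta> by (intro mult_right_mono) auto
        also have "\<dots> = e / 2"
        proof -
          have "norm t + 1 > 0" by (simp add: add_nonneg_pos)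
          then show ?thesis unfolding \<delta>_def by (simp only: times_divide_eq_right) (simp add: divide_simps)
        qed
        finally show ?thesis .
      qed
      have "\<forall>\<^sub>F n in sequentially. M.prob {\<omega> \<in> space M. norm (X n \<omega> - S n \<omega>) > \<delta>} < e / 4"
        using order_tendstoD(2)[OF R'[OF \<delta>], of "e / 4"] e by simp
      then show "\<forall>\<^sub>F n in sequentially. dist ((\<integral>\<omega>. cos (t \<bullet> X n \<omega> + c) \<partial>M) - (\<integral>\<omega>. cos (t \<bullet> S n \<omega> + c) \<partial>M)) 0 < e"
      proof eventually_elim
        case (elim n)
        have "\<bar>(\<integral>\<omega>. cos (t \<bullet> X n \<omega> + c) \<partial>M) - (\<integral>\<omega>. cos (t \<bullet> S n \<omega> + c) \<partial>M)\<bar>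
            \<le> norm t * \<delta> + (1 + 1) * M.prob {\<omega> \<in> space M. norm (X n \<omega> - S n \<omega>) > \<delta>}"
        proof (rule M.expectation_diff_le)
          fix \<omega> assume "\<omega> \<in> space M" "\<omega> \<notin> {\<omega> \<in> space M. norm (X n \<omega> - S n \<omega>) > \<delta>}"
          then have "norm (X n \<omega> - S n \<omega>) \<le> \<delta>" by simp
          then have "\<bar>t \<bullet> (X n \<omega> - S n \<omega>)\<bar> \<le> norm t * \<delta>"
            by (meson Cauchy_Schwarz_ineq2 mult_left_mono norm_ge_zero order_trans)
          then show "\<bar>cos (t \<bullet> X n \<omega> + c) - cos (t \<bullet> S n \<omega> + c)\<bar> \<le> norm t * \<delta>"
            using abs_cos_diff_le[of "t \<bullet> X n \<omega> + c" "t \<bullet> S n \<omega> + c"] by (simp add: inner_diff_right)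
        qed (use \<delta> in auto)
        then show ?case using t\<delta> elim by (simp add: dist_real_def)
      qed
    qed
    from tendsto_add[OF this lim] show "(\<lambda>n. \<integral>\<omega>. cos (t \<bullet> X n \<omega> + c) \<partial>M) \<longlonglongrightarrow> (\<integral>x. cos (t \<bullet> x + c) \<partial>L)"
      by simp
  next
    fix \<epsilon> :: real assume \<epsilon>: "\<epsilon> > 0"
    define v where "v b = (\<integral>z. (b \<bullet> Y z)\<^sup>2 \<partial>F)" for b
    have v0: "v b \<ge> 0" for b unfolding v_def by (rule Bochner_Integration.integral_nonneg) simp
    define w where "w = (\<Sum>b\<in>Basis. v b)"
    have w0: "w \<ge> 0" unfolding w_def by (intro sum_nonneg v0)
    \<comment> \<open>Chebyshev's bounds, summed over the basis, are then at most \<epsilon> / 2;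
      adding 1 keeps \<open>k\<close> positive if all variances are 0. The cube has half-width k +
      1, the extra 1 being for the remainder.\<close>
    define k where "k = sqrt (2 * w / \<epsilon>) + 1"
    have k: "k > 0" using w0 \<epsilon> by (simp add: k_def add_nonneg_pos)
    have wk: "w / k\<^sup>2 \<le> \<epsilon> / 2"
    proof -
      have "2 * w / \<epsilon> = (sqrt (2 * w / \<epsilon>))\<^sup>2" using w0 \<epsilon> by simp
      also have "\<dots> \<le> k\<^sup>2" unfolding k_def using w0 \<epsilon> by (intro power_mono) auto
      finally show ?thesis using \<epsilon> k by (simp add: field_simps)
    qed
    have "\<forall>\<^sub>F n in sequentially. M.prob {\<omega> \<in> space M. norm (X n \<omega> - S n \<omega>) > 1} < \<epsilon> / 2"
      using order_tendstoD(2)[OF R'[of 1], of "\<epsilon> / 2"] \<epsilon> by simp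
    then have "\<forall>\<^sub>F n in sequentially. M.prob {\<omega> \<in> space M. \<exists>b\<in>Basis. \<bar>X n \<omega> \<bullet> b\<bar> > k + 1} \<le> \<epsilon>"
      using eventually_gt_at_top[of 0]
    proof eventually_elim
      case (elim n)
      let ?T = "\<lambda>b. {\<omega> \<in> space M. \<bar>(\<Sum>i<n. T b i \<omega>) / sqrt (real n)\<bar> \<ge> k}"
      let ?R = "{\<omega> \<in> space M. norm (X n \<omega> - S n \<omega>) > 1}"
      have "M.prob {\<omega> \<in> space M. \<exists>b\<in>Basis. \<bar>X n \<omega> \<bullet> b\<bar> > k + 1} \<le>
        M.prob ((\<Union>b\<in>Basis. ?T b) \<union> ?R)"
      proof (rule M.finite_measure_mono)
        show "{\<omega> \<in> space M. \<exists>b\<in>Basis. \<bar>X n \<omega> \<bullet> b\<bar> > k + 1} \<subseteq>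
          (\<Union>b\<in>Basis. ?T b) \<union> ?R"
        proof (safe, rule ccontr)
          fix \<omega> and b :: 'b assume *: "\<omega> \<in> space M" "b \<in> Basis" "k + 1 < \<bar>X n \<omega> \<bullet> b\<bar>" "\<not> norm (X n \<omega> - S n \<omega>) > 1"
            and "\<omega> \<notin> (\<Union>b\<in>Basis. ?T b)"
          then have "\<bar>b \<bullet> S n \<omega>\<bar> < k" by (auto simp: tS not_le)
          moreover have "\<bar>(X n \<omega> - S n \<omega>) \<bullet> b\<bar> \<le> 1"
            using Basis_le_norm[OF *(2), of "X n \<omega> - S n \<omega>"] *(4) by linarith
          ultimately show False using *(3) by (simp add: inner_diff_left inner_diff_right inner_commute)
        qed
        have [measurable]: "T b i \<in> borel_measurable M" for b i unfolding T_def by measurable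
        show "(\<Union>b\<in>Basis. ?T b) \<union> ?R \<in> sets M"
          by (intro sets.Un sets.finite_UN) (auto simp del: abs_divide)
      qed
      also have "\<dots> \<le> M.prob (\<Union>b\<in>Basis. ?T b) + M.prob ?R"
      proof (rule measure_Un_le)
        have [measurable]: "T b i \<in> borel_measurable M" for b i unfolding T_def by measurable
        show "(\<Union>b\<in>Basis. ?T b) \<in> sets M"
          by (intro sets.finite_UN) (auto simp del: abs_divide)
      qed measurable
      also have "M.prob (\<Union>b\<in>Basis. ?T b) \<le>
          (\<Sum>b\<in>Basis. M.prob (?T b))"
      proof (rule M.finite_measure_subadditive_finite)
        have [measurable]: "T b i \<in> borel_measurable M" for b i unfolding T_def by measurable
        show "?T ` Basis \<subseteq> sets M"
          by (auto simp del: abs_divide)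
      qed simp
      also have "\<dots> \<le> (\<Sum>b\<in>Basis. v b / k\<^sup>2)"
        unfolding v_def by (intro sum_mono M.iid_sum_tail[OF T_indep T_sq T_mean T_var k elim(2)])
      also have "\<dots> = w / k\<^sup>2" by (simp add: w_def sum_divide_distrib)
      finally show ?case using wk elim(1) by linarith
    qed
    then show "\<exists>K>0. \<forall>\<^sub>F n in sequentially. M.prob {\<omega> \<in> space M. \<exists>b\<in>Basis. \<bar>X n \<omega> \<bullet> b\<bar> > K} \<le> \<epsilon>"
      using k by (intro exI[of _ "k + 1"]) auto
  qed
qed

section \<open>Moments of the independent component law\<close>

lemma independent_standardizedD:
  assumes "independent_standardized F"
  shows "prob_space F" "sets F = sets borel" "prob_space.indep_vars F (\<lambda>_. borel) (\<lambda>k x. x $ k) UNIV"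
    "(\<integral>x. x $ k \<partial>F) = 0" "(\<integral>x. (x $ k)\<^sup>2 \<partial>F) = 1"
  using assms by (auto simp: independent_standardized_def)

lemma finite_moments_power:
  fixes F :: "(real^'n) measure"
  assumes F: "prob_space F" "sets F = sets borel" and fm: "finite_moments N F" and m: "m \<le> N"
  shows "integrable F (\<lambda>x. (x $ k) ^ m)"
proof -
  interpret prob_space F by fact
  note [measurable_cong] = F(2)
  show ?thesis
  proof (rule Bochner_Integration.integrable_bound)
    show "integrable F (\<lambda>x. 1 + \<bar>x $ k\<bar> ^ N)"
      using fm by (simp add: finite_moments_def)
    show "AE x in F. norm ((x $ k) ^ m) \<le> norm (1 + \<bar>x $ k\<bar> ^ N)"
    proof (rule AE_I2)
      fix x :: "real^'n"
      have "\<bar>x $ k\<bar> ^ m \<le> 1 + \<bar>x $ k\<bar> ^ N"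
      proof (cases "\<bar>x $ k\<bar> \<le> 1")
        case True
        then have "\<bar>x $ k\<bar> ^ m \<le> 1" by (simp add: power_le_one)
        then show ?thesis using zero_le_power[of "\<bar>x $ k\<bar>" N] by linarith
      next
        case False
        then have "\<bar>x $ k\<bar> ^ m \<le> \<bar>x $ k\<bar> ^ N" using m by (intro power_increasing) auto
        then show ?thesis by linarith
      qed
      then show "norm ((x $ k) ^ m) \<le> norm (1 + \<bar>x $ k\<bar> ^ N)"
        by (simp add: power_abs)
    qed
  qed (use F(2) in measurable)
qed

lemma finite_moments_mono:
  fixes F :: "(real^'n) measure"
  assumes F: "prob_space F" "sets F = sets borel" and fm: "finite_moments N F" and m: "m \<le> N"
  shows "finite_moments m F"
  unfolding finite_moments_def
  using integrable_abs[OF finite_moments_power[OF F fm m]] by (simp add: power_abs)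

lemma has_bochner_integral_indep_prod:
  fixes F :: "(real^'n) measure" and f :: "'n \<Rightarrow> real \<Rightarrow> real"
  assumes F: "independent_standardized F"
    and f: "\<And>i. i \<in> I \<Longrightarrow> f i \<in> borel_measurable borel" "\<And>i. i \<in> I \<Longrightarrow> integrable F (\<lambda>x. f i (x $ i))"
  shows "has_bochner_integral F (\<lambda>x. \<Prod>i\<in>I. f i (x $ i)) (\<Prod>i\<in>I. \<integral>x. f i (x $ i) \<partial>F)"
proof -
  interpret prob_space F using F by (rule independent_standardizedD)
  have "indep_vars (\<lambda>_. borel) (\<lambda>i x. f i (x $ i)) I"
    by (rule indep_vars_compose2[OF indep_vars_subset[OF independent_standardizedD(3)[OF F]]]) (use f in auto)
  from indep_vars_lebesgue_integral[OF _ this f(2)] indep_vars_integrable[OF _ this f(2)]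
  show ?thesis by (simp add: has_bochner_integral_iff)
qed

text \<open>Index lists with repetition encode mixed moments. There are finitely many lists of
  bounded length, so all sample moments can be controlled as one finite family.\<close>

definition monomial :: "'n list \<Rightarrow> real^'n \<Rightarrow> real" where
  "monomial is x = prod_list (map (\<lambda>i. x $ i) is)"

lemma monomial_eq_prod: "monomial is x = (\<Prod>m\<in>UNIV. (x $ m) ^ count_list is m)"
proof (induction "is")
  case Nil
  then show ?case by (simp add: monomial_def)
next
  case (Cons i "is")
  have "(\<Prod>m\<in>UNIV. (x $ m) ^ count_list (i # is) m) = (\<Prod>m\<in>UNIV. (if i = m then x $ m else 1) * (x $ m) ^ count_list is m)"
    by (intro prod.cong) auto
  also have "\<dots> = x $ i * (\<Prod>m\<in>UNIV. (x $ m) ^ count_list is m)"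
    by (simp add: prod.distrib)
  finally show ?case using Cons by (simp add: monomial_def)
qed

text \<open>Independence factors a mixed moment into marginal ones, with the multiplicities in the
  list as orders; none exceeds the length of the list.\<close>

lemma has_bochner_integral_monomial:
  fixes F :: "(real^'n) measure"
  assumes F: "independent_standardized F" and fm: "finite_moments N F" and len: "length is \<le> N"
  shows "has_bochner_integral F (monomial is) (\<Prod>m\<in>set is. moment (count_list is m) F m)"
proof -
  note Fp = independent_standardizedD(1,2)[OF F]
  have cnt: "count_list is m \<le> N" for m using count_le_length[of "is" m] len by linarith
  have "has_bochner_integral F (\<lambda>x. \<Prod>m\<in>UNIV. (x $ m) ^ count_list is m) (\<Prod>m\<in>UNIV. \<integral>x. (x $ m) ^ count_list is m \<partial>F)"
    by (rule has_bochner_integral_indep_prod[OF F, of UNIV "\<lambda>m t. t ^ count_list is m"])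
      (auto intro: finite_moments_power[OF Fp fm cnt])
  moreover have "(\<Prod>m\<in>UNIV. \<integral>x. (x $ m) ^ count_list is m \<partial>F) = (\<Prod>m\<in>set is. moment (count_list is m) F m)"
  proof (rule prod.mono_neutral_cong_right)
    interpret prob_space F by (rule Fp)
    show "\<forall>i\<in>UNIV - set is. (\<integral>x. (x $ i) ^ count_list is i \<partial>F) = 1"
      by (auto simp: count_list_0_iff prob_space)
  qed (auto simp: moment_def)
  ultimately show ?thesis by (simp add: monomial_eq_prod[abs_def])
qed

lemma integrable_monomial:
  assumes "independent_standardized F" "finite_moments N F" "length is \<le> N"
  shows "integrable F (monomial is)"
  using has_bochner_integral_monomial[OF assms] by (simp add: has_bochner_integral_iff)

lemma moment_1_2:
  assumes "independent_standardized F"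
  shows "moment (Suc 0) F k = 0" "moment (Suc (Suc 0)) F k = 1"
  using independent_standardizedD(4,5)[OF assms, of k] by (simp_all add: moment_def numeral_2_eq_2)

lemma population_moments:
  fixes F :: "(real^'n) measure"
  assumes F: "independent_standardized F"
  shows "finite_moments 2 F \<Longrightarrow> (\<integral>x. x $ i * x $ j \<partial>F) = mom2 i j"
    and "finite_moments 3 F \<Longrightarrow> (\<integral>x. x $ i * (x $ j * x $ k) \<partial>F) = mom3 (gam F) i j k"
    and "finite_moments 4 F \<Longrightarrow> (\<integral>x. x $ i * (x $ j * (x $ k * x $ l)) \<partial>F) = mom4 (kap F) i j k l"
proof -
  note m = moment_1_2[OF F]
  assume "finite_moments 2 F"
  from has_bochner_integral_monomial[OF F this, of "[i, j]"]
  show "(\<integral>x. x $ i * x $ j \<partial>F) = mom2 i j"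
    by (cases "i = j") (auto simp: has_bochner_integral_iff monomial_def[abs_def] mom2_def m)
next
  note m = moment_1_2[OF F]
  assume "finite_moments 3 F"
  from has_bochner_integral_monomial[OF F this, of "[i, j, k]"]
  show "(\<integral>x. x $ i * (x $ j * x $ k) \<partial>F) = mom3 (gam F) i j k"
    by (cases "i = j"; cases "i = k"; cases "j = k")
      (auto simp: has_bochner_integral_iff monomial_def[abs_def] mom3_def m gam_def numeral_3_eq_3)
next
  note m = moment_1_2[OF F]
  assume "finite_moments 4 F"
  from has_bochner_integral_monomial[OF F this, of "[i, j, k, l]"]
  show "(\<integral>x. x $ i * (x $ j * (x $ k * x $ l)) \<partial>F) = mom4 (kap F) i j k l"
    by (cases "i = j"; cases "i = k"; cases "i = l"; cases "j = k"; cases "j = l"; cases "k = l")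
      (auto simp: has_bochner_integral_iff monomial_def[abs_def] mom4_def mom2_def m kap_def bet_def eval_nat_numeral insert_commute)
qed

section \<open>Covariances of the off-diagonal statistics\<close>

definition poly_mean :: "(real^'n) measure \<Rightarrow> 'n \<Rightarrow> real poly \<Rightarrow> real" where
  "poly_mean F k p = (\<integral>x. poly p (x $ k) \<partial>F)"

lemma poly_mean_integrable:
  fixes F :: "(real^'n) measure"
  assumes F: "prob_space F" "sets F = sets borel" and fm: "finite_moments N F" and p: "degree p \<le> N"
  shows "integrable F (\<lambda>x. poly p (x $ k))"
proof -
  have "integrable F (\<lambda>x. coeff p i * (x $ k) ^ i)" if "i \<le> N" for i
    using finite_moments_power[OF F fm that] by simp
  then show ?thesis unfolding poly_altdef using p by (intro Bochner_Integration.integrable_sum) auto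
qed

lemma borel_measurable_poly: "poly p \<in> borel_measurable borel" for p :: "real poly"
  by (intro borel_measurable_continuous_onI continuous_on_poly continuous_on_id)

text \<open>The common shape of both off-diagonal statistics: f and g collect the terms with j = k
  and j = l of the compounding sum over j together with the lower-order corrections, r belongs to
  the other j.\<close>

definition bistat :: "'n::finite \<Rightarrow> 'n \<Rightarrow> real poly \<Rightarrow> real poly \<Rightarrow> real poly \<Rightarrow> real^'n \<Rightarrow> real" where
  "bistat k l f g r x = poly f (x $ k) * x $ l + x $ k * poly g (x $ l)
     + x $ k * x $ l * (\<Sum>m\<in>UNIV - {k, l}. poly r (x $ m))"

text \<open>Each term of the expanded product factors over the coordinates. Terms with a single r or
  with r at two different coordinates vanish because r is centred, and squares of untouched
  coordinates have mean 1. No coordinate occurs with degree above six.\<close>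

lemma bistat_covariance:
  fixes F :: "(real^'n) measure"
  assumes F: "independent_standardized F" and fm: "finite_moments 6 F" and kl: "k \<noteq> l"
    and deg: "degree f \<le> 3" "degree g \<le> 3" "degree r \<le> 3" "degree f' \<le> 3" "degree g' \<le> 3" "degree r' \<le> 3"
    and r0: "\<And>m. poly_mean F m r = 0" "\<And>m. poly_mean F m r' = 0"
  shows "has_bochner_integral F (\<lambda>x. bistat k l f g r x * bistat k l f' g' r' x)
    (poly_mean F k (f * f') + poly_mean F l (g * g')
     + poly_mean F k ([:0, 1:] * f) * poly_mean F l ([:0, 1:] * g')
     + poly_mean F k ([:0, 1:] * f') * poly_mean F l ([:0, 1:] * g)
     + (\<Sum>m\<in>UNIV - {k, l}. poly_mean F m (r * r')))"
proof -
  note Fp = independent_standardizedD(1,2)[OF F]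
  define w :: "real poly" where "w = [:0, 1:]"
  have w: "poly w t = t" for t by (simp add: w_def)
  have dm: "degree (p * q) \<le> 6" if "degree p \<le> 3" "degree q \<le> 3" for p q :: "real poly"
    using degree_mult_le[of p q] that by linarith
  have dw: "degree w \<le> 3" by (simp add: w_def)
  have ww: "poly_mean F m (w * w) = 1" for m
    using independent_standardizedD(5)[OF F, of m] by (simp add: poly_mean_def w power2_eq_square)
  have d3: "degree p \<le> 6" if "degree p \<le> 3" for p :: "real poly" using that by linarith
  note dd = dm[OF deg(1,4)] dm[OF deg(2,5)] dm[OF deg(3,6)] dm[OF dw deg(1)] dm[OF dw deg(2)] dm[OF dw deg(4)]
    dm[OF dw deg(5)] dm[OF dw dw] d3[OF deg(3)] d3[OF deg(6)]
  have P2: "has_bochner_integral F (\<lambda>x. poly p (x $ k) * poly q (x $ l)) (poly_mean F k p * poly_mean F l q)"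
    if "degree p \<le> 6" "degree q \<le> 6" for p q
  proof -
    have d: "degree (if i = k then p else q) \<le> 6" for i using that by simp
    show ?thesis
      using has_bochner_integral_indep_prod[OF F, of "{k, l}" "\<lambda>i. poly (if i = k then p else q)",
          OF borel_measurable_poly poly_mean_integrable[OF Fp fm d]] kl that
      by (auto simp: poly_mean_def)
  qed
  have P3: "has_bochner_integral F (\<lambda>x. poly p (x $ k) * poly q (x $ l) * poly u (x $ m))
      (poly_mean F k p * poly_mean F l q * poly_mean F m u)"
    if "degree p \<le> 6" "degree q \<le> 6" "degree u \<le> 6" "m \<notin> {k, l}" for p q u m
  proof -
    have d: "degree (if i = k then p else if i = l then q else u) \<le> 6" for i using that by simp
    show ?thesis
      using has_bochner_integral_indep_prod[OF F, of "{k, l, m}" "\<lambda>i. poly (if i = k then p else if i = l then q else u)",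
          OF borel_measurable_poly poly_mean_integrable[OF Fp fm d]] kl that
      by (auto simp: poly_mean_def mult.assoc)
  qed
  have P4: "has_bochner_integral F (\<lambda>x. poly p (x $ k) * poly q (x $ l) * (poly u (x $ m) * poly v (x $ n)))
      (poly_mean F k p * poly_mean F l q * (poly_mean F m u * poly_mean F n v))"
    if "degree p \<le> 6" "degree q \<le> 6" "degree u \<le> 6" "degree v \<le> 6" "m \<notin> {k, l}" "n \<notin> {k, l}" "m \<noteq> n" for p q u v m n
  proof -
    have d: "degree (if i = k then p else if i = l then q else if i = m then u else v) \<le> 6" for i using that by simp
    show ?thesis
      using has_bochner_integral_indep_prod[OF F, of "{k, l, m, n}"
          "\<lambda>i. poly (if i = k then p else if i = l then q else if i = m then u else v)",
          OF borel_measurable_poly poly_mean_integrable[OF Fp fm d]] kl that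
      by (auto simp: poly_mean_def mult.assoc)
  qed
  define H where "H = UNIV - {k, l}"
  have H: "m \<notin> {k, l}" if "m \<in> H" for m using that by (simp add: H_def)
  have eq: "bistat k l f g r x * bistat k l f' g' r' x =
      poly (f * f') (x $ k) * poly (w * w) (x $ l) + poly (w * w) (x $ k) * poly (g * g') (x $ l)
    + poly (w * f) (x $ k) * poly (w * g') (x $ l) + poly (w * f') (x $ k) * poly (w * g) (x $ l)
    + ((\<Sum>m\<in>H. poly (w * f) (x $ k) * poly (w * w) (x $ l) * poly r' (x $ m))
     + (\<Sum>m\<in>H. poly (w * w) (x $ k) * poly (w * g) (x $ l) * poly r' (x $ m))
     + (\<Sum>m\<in>H. poly (w * f') (x $ k) * poly (w * w) (x $ l) * poly r (x $ m))
     + (\<Sum>m\<in>H. poly (w * w) (x $ k) * poly (w * g') (x $ l) * poly r (x $ m)))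
    + (\<Sum>m\<in>H. \<Sum>n\<in>H. poly (w * w) (x $ k) * poly (w * w) (x $ l) * (poly r (x $ m) * poly r' (x $ n)))" for x
    unfolding sum_distrib_left[symmetric] sum_distrib_right[symmetric] bistat_def H_def[symmetric] poly_mult w
    by (simp add: algebra_simps)
  have "has_bochner_integral F (\<lambda>x. poly (w * w) (x $ k) * poly (w * w) (x $ l) * (poly r (x $ m) * poly r' (x $ n)))
      (if m = n then poly_mean F m (r * r') else 0)" if "m \<in> H" "n \<in> H" for m n
  proof (cases "m = n")
    case True
    then show ?thesis using P3[OF dd(8) dd(8) dd(3) H[OF that(1)]] by (simp add: ww)
  next
    case False
    then show ?thesis using P4[OF dd(8) dd(8) dd(9) dd(10) H[OF that(1)] H[OF that(2)]] by (simp add: ww r0)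
  qed
  then have D: "has_bochner_integral F (\<lambda>x. \<Sum>m\<in>H. \<Sum>n\<in>H. poly (w * w) (x $ k) * poly (w * w) (x $ l) * (poly r (x $ m) * poly r' (x $ n)))
      (\<Sum>m\<in>H. \<Sum>n\<in>H. if m = n then poly_mean F m (r * r') else 0)"
    by (intro has_bochner_integral_sum)
  have Z: "has_bochner_integral F (\<lambda>x. \<Sum>m\<in>H. poly p (x $ k) * poly q (x $ l) * poly u (x $ m)) 0"
    if "degree p \<le> 6" "degree q \<le> 6" "degree u \<le> 6" "\<And>m. poly_mean F m u = 0" for p q u
    using has_bochner_integral_sum[of H F "\<lambda>m x. poly p (x $ k) * poly q (x $ l) * poly u (x $ m)"
        "\<lambda>m. poly_mean F k p * poly_mean F l q * poly_mean F m u"] P3[OF that(1-3) H] that(4) by simp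
  have "has_bochner_integral F (\<lambda>x. bistat k l f g r x * bistat k l f' g' r' x)
     (poly_mean F k (f * f') * poly_mean F l (w * w) + poly_mean F k (w * w) * poly_mean F l (g * g')
     + poly_mean F k (w * f) * poly_mean F l (w * g') + poly_mean F k (w * f') * poly_mean F l (w * g)
     + (0 + 0 + 0 + 0) + (\<Sum>m\<in>H. \<Sum>n\<in>H. if m = n then poly_mean F m (r * r') else 0))"
    unfolding eq by (intro has_bochner_integral_add P2 Z D dd r0)
  then show ?thesis unfolding w_def[symmetric] H_def ww by simp
qed

text \<open>For \<open>k \<noteq> l\<close> the linear part of \<open>w\<^sub>k\<^sub>l\<close> is a combination of these two.\<close>

definition skew_stat :: "(real^'n) measure \<Rightarrow> 'n \<Rightarrow> 'n \<Rightarrow> real^'n \<Rightarrow> real" where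
  "skew_stat F k l = bistat k l [:-1, - gam F k, 1, 0:] [:-1, 0, 1, 0:] [:0, 1, 0, 0:]"

definition kurt_stat :: "(real^'n) measure \<Rightarrow> 'n \<Rightarrow> 'n \<Rightarrow> real^'n \<Rightarrow> real" where
  "kurt_stat F k l = bistat k l [:- gam F k, - (kap F k + 6), 0, 1:] [:- gam F l, 0, 0, 1:] [:-1, 0, 1, 0:]"

text \<open>One formula in the four coefficients evaluates every mean that occurs; for this purpose
  the polynomials in \<open>skew_stat\<close> and \<open>kurt_stat\<close> are padded with zeros to
  cubics.\<close>

lemma poly_mean_cubic:
  fixes F :: "(real^'n) measure"
  assumes F: "independent_standardized F" and fm: "finite_moments 6 F"
  shows "poly_mean F m ([:a0, a1, a2, a3:] * [:b0, b1, b2, b3:]) = a0 * b0 + (a0 * b2 + a1 * b1 + a2 * b0)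
    + (a0 * b3 + a1 * b2 + a2 * b1 + a3 * b0) * moment 3 F m + (a1 * b3 + a2 * b2 + a3 * b1) * moment 4 F m
    + (a2 * b3 + a3 * b2) * moment 5 F m + a3 * b3 * moment 6 F m"
    and "poly_mean F m [:b0, b1, b2, b3:] = b0 + b2 + b3 * moment 3 F m"
proof -
  note Fp = independent_standardizedD(1,2)[OF F]
  interpret prob_space F by (rule Fp)
  have m1: "(\<integral>x. x $ m \<partial>F) = 0" and m2: "(\<integral>x. (x $ m)\<^sup>2 \<partial>F) = 1"
    using independent_standardizedD(4,5)[OF F] by auto
  have int: "integrable F (\<lambda>x. (x $ m) ^ i)" if "i \<le> 6" for i
    using finite_moments_power[OF Fp fm that] .
  have int1: "integrable F (\<lambda>x. x $ m)" using int[of 1] by simp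
  have "poly ([:a0, a1, a2, a3:] * [:b0, b1, b2, b3:]) t = a0 * b0 + (a0 * b1 + a1 * b0) * t
    + (a0 * b2 + a1 * b1 + a2 * b0) * t ^ 2 + (a0 * b3 + a1 * b2 + a2 * b1 + a3 * b0) * t ^ 3
    + (a1 * b3 + a2 * b2 + a3 * b1) * t ^ 4 + (a2 * b3 + a3 * b2) * t ^ 5 + a3 * b3 * t ^ 6" for t
    by (simp add: algebra_simps eval_nat_numeral)
  then show "poly_mean F m ([:a0, a1, a2, a3:] * [:b0, b1, b2, b3:]) = a0 * b0 + (a0 * b2 + a1 * b1 + a2 * b0)
    + (a0 * b3 + a1 * b2 + a2 * b1 + a3 * b0) * moment 3 F m + (a1 * b3 + a2 * b2 + a3 * b1) * moment 4 F m
    + (a2 * b3 + a3 * b2) * moment 5 F m + a3 * b3 * moment 6 F m"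
    unfolding poly_mean_def using int int1 m1 m2 by (simp add: moment_def prob_space del: poly_mult mult_pCons_left mult_pCons_right)
  have "poly [:b0, b1, b2, b3:] t = b0 + b1 * t + b2 * t ^ 2 + b3 * t ^ 3" for t
    by (simp add: algebra_simps eval_nat_numeral)
  then show "poly_mean F m [:b0, b1, b2, b3:] = b0 + b2 + b3 * moment 3 F m"
    unfolding poly_mean_def using int int1 m1 m2 by (simp add: moment_def prob_space del: poly_pCons)
qed

text \<open>The asymmetry of the zetas in k and l stems from the polynomial at k. In
  \<open>skew_stat\<close> it is uncorrelated with z_k, in \<open>kurt_stat\<close> its covariance
  with z_k is -3; the resulting 9 - 6 \<beta>_l equals \<kappa>_l^2 - \<beta>_l^2, which is the form
  used in \<open>zeta22\<close>.\<close>

lemma stat_covariances: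
  fixes F :: "(real^'n) measure"
  assumes F: "independent_standardized F" and fm: "finite_moments 6 F" and kl: "k \<noteq> l"
  shows "has_bochner_integral F (\<lambda>x. skew_stat F k l x * skew_stat F k l x) (zeta11 F k l)"
    and "has_bochner_integral F (\<lambda>x. kurt_stat F k l x * kurt_stat F k l x) (zeta22 F k l)"
    and "has_bochner_integral F (\<lambda>x. skew_stat F k l x * kurt_stat F k l x) (zeta12 F k l)"
proof -
  have card: "real (card (UNIV - {k, l})) = real CARD('n) - 2"
  proof -
    have "card {k, l} \<le> CARD('n)" by (rule card_mono) auto
    then show ?thesis using kl by (simp add: card_Diff_subset of_nat_diff)
  qed
  note pm = poly_mean_cubic[OF F fm]
  have d: "degree [:a, b, c, d:] \<le> 3" for a b c d :: real
    by (simp add: degree_pCons_eq_if)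
  have w: "[:0, 1:] = [:0, 1, 0, 0 :: real:]" by simp
  have r0: "poly_mean F m [:0, 1, 0, 0:] = 0" "poly_mean F m [:-1, 0, 1, 0:] = 0" for m
    unfolding pm by simp_all
  note cov = bistat_covariance[OF F fm kl d d d d d d, unfolded w]
  show "has_bochner_integral F (\<lambda>x. skew_stat F k l x * skew_stat F k l x) (zeta11 F k l)"
  proof -
    have "has_bochner_integral F (\<lambda>x. skew_stat F k l x * skew_stat F k l x)
      (poly_mean F k ([:-1, - gam F k, 1, 0:] * [:-1, - gam F k, 1, 0:]) + poly_mean F l ([:-1, 0, 1, 0:] * [:-1, 0, 1, 0:])
     + poly_mean F k ([:0, 1, 0, 0:] * [:-1, - gam F k, 1, 0:]) * poly_mean F l ([:0, 1, 0, 0:] * [:-1, 0, 1, 0:])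
     + poly_mean F k ([:0, 1, 0, 0:] * [:-1, - gam F k, 1, 0:]) * poly_mean F l ([:0, 1, 0, 0:] * [:-1, 0, 1, 0:])
     + (\<Sum>m\<in>UNIV - {k, l}. poly_mean F m ([:0, 1, 0, 0:] * [:0, 1, 0, 0:])))"
      unfolding skew_stat_def by (rule cov) (rule r0)+
    then show ?thesis unfolding pm
      by (simp add: card zeta11_def nu_def gam_def power2_eq_square algebra_simps)
  qed
  show "has_bochner_integral F (\<lambda>x. kurt_stat F k l x * kurt_stat F k l x) (zeta22 F k l)"
  proof -
    have "has_bochner_integral F (\<lambda>x. kurt_stat F k l x * kurt_stat F k l x)
      (poly_mean F k ([:- gam F k, - (kap F k + 6), 0, 1:] * [:- gam F k, - (kap F k + 6), 0, 1:])
     + poly_mean F l ([:- gam F l, 0, 0, 1:] * [:- gam F l, 0, 0, 1:])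
     + poly_mean F k ([:0, 1, 0, 0:] * [:- gam F k, - (kap F k + 6), 0, 1:]) * poly_mean F l ([:0, 1, 0, 0:] * [:- gam F l, 0, 0, 1:])
     + poly_mean F k ([:0, 1, 0, 0:] * [:- gam F k, - (kap F k + 6), 0, 1:]) * poly_mean F l ([:0, 1, 0, 0:] * [:- gam F l, 0, 0, 1:])
     + (\<Sum>m\<in>UNIV - {k, l}. poly_mean F m ([:-1, 0, 1, 0:] * [:-1, 0, 1, 0:])))"
      unfolding kurt_stat_def by (rule cov) (rule r0)+
    then show ?thesis unfolding pm
      by (simp add: card zeta22_def omg_def bet_def kap_def gam_def power2_eq_square sum_subtractf algebra_simps)
  qed
  show "has_bochner_integral F (\<lambda>x. skew_stat F k l x * kurt_stat F k l x) (zeta12 F k l)"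
  proof -
    have "has_bochner_integral F (\<lambda>x. skew_stat F k l x * kurt_stat F k l x)
      (poly_mean F k ([:-1, - gam F k, 1, 0:] * [:- gam F k, - (kap F k + 6), 0, 1:])
     + poly_mean F l ([:-1, 0, 1, 0:] * [:- gam F l, 0, 0, 1:])
     + poly_mean F k ([:0, 1, 0, 0:] * [:-1, - gam F k, 1, 0:]) * poly_mean F l ([:0, 1, 0, 0:] * [:- gam F l, 0, 0, 1:])
     + poly_mean F k ([:0, 1, 0, 0:] * [:- gam F k, - (kap F k + 6), 0, 1:]) * poly_mean F l ([:0, 1, 0, 0:] * [:-1, 0, 1, 0:])
     + (\<Sum>m\<in>UNIV - {k, l}. poly_mean F m ([:0, 1, 0, 0:] * [:-1, 0, 1, 0:])))"
      unfolding skew_stat_def kurt_stat_def by (rule cov) (rule r0)+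
    then show ?thesis unfolding pm
      by (simp add: card zeta12_def eta_def bet_def kap_def gam_def power2_eq_square sum_subtractf algebra_simps)
  qed
qed

section \<open>Cumulant matrices of the empirical distribution\<close>

definition avg :: "nat \<Rightarrow> (nat \<Rightarrow> real) \<Rightarrow> real" where
  "avg n f = (\<Sum>h<n. f h) / real n"

lemma avg_add: "avg n (\<lambda>h. f h + g h) = avg n f + avg n g"
  and avg_diff: "avg n (\<lambda>h. f h - g h) = avg n f - avg n g"
  and avg_cmult: "avg n (\<lambda>h. c * f h) = c * avg n f"
  and avg_sum: "avg n (\<lambda>h. \<Sum>i\<in>I. F i h) = (\<Sum>i\<in>I. avg n (F i))"
  and avg_const: "n > 0 \<Longrightarrow> avg n (\<lambda>_. c) = c"
  by (simp_all add: avg_def sum.distrib sum_subtractf sum_distrib_left add_divide_distrib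
      diff_divide_distrib sum_divide_distrib) (rule sum.swap)

lemma integral_empirical:
  fixes g :: "real^'n \<Rightarrow> real"
  assumes "g \<in> borel_measurable borel"
  shows "(\<integral>x. g x \<partial>empirical n X) = avg n (\<lambda>h. g (X h))"
proof -
  have "(\<integral>x. g x \<partial>empirical n X) = (\<integral>h. g (X h) \<partial>uniform_count_measure {..<n})"
    unfolding empirical_def using assms
    by (subst integral_distr) (auto simp: measurable_def space_uniform_count_measure sets_uniform_count_measure)
  also have "\<dots> = avg n (\<lambda>h. g (X h))"
    by (subst integral_uniform_count_measure) (auto simp: avg_def)
  finally show ?thesis .
qed

definition raw1 :: "nat \<Rightarrow> (nat \<Rightarrow> real^'n) \<Rightarrow> 'n \<Rightarrow> real" where
  "raw1 n x i = avg n (\<lambda>h. x h $ i)"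
definition raw2 :: "nat \<Rightarrow> (nat \<Rightarrow> real^'n) \<Rightarrow> 'n \<Rightarrow> 'n \<Rightarrow> real" where
  "raw2 n x i j = avg n (\<lambda>h. x h $ i * x h $ j)"
definition raw3 :: "nat \<Rightarrow> (nat \<Rightarrow> real^'n) \<Rightarrow> 'n \<Rightarrow> 'n \<Rightarrow> 'n \<Rightarrow> real" where
  "raw3 n x i j k = avg n (\<lambda>h. x h $ i * (x h $ j * x h $ k))"
definition raw4 :: "nat \<Rightarrow> (nat \<Rightarrow> real^'n) \<Rightarrow> 'n \<Rightarrow> 'n \<Rightarrow> 'n \<Rightarrow> 'n \<Rightarrow> real" where
  "raw4 n x i j k l = avg n (\<lambda>h. x h $ i * (x h $ j * (x h $ k * x h $ l)))"

lemma mean_vector_empirical: "mean_vector (empirical n x) $ i = raw1 n x i"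
  by (simp add: mean_vector_def raw1_def integral_empirical)

lemma central_moments:
  fixes x :: "nat \<Rightarrow> real^'n"
  assumes n: "n > 0"
  defines "c \<equiv> \<lambda>h i. x h $ i - raw1 n x i"
  shows "avg n (\<lambda>h. c h i * c h j) = cen2 (raw1 n x) (raw2 n x) i j"
    and "avg n (\<lambda>h. c h i * (c h j * c h k)) = cen3 (raw1 n x) (raw2 n x) (raw3 n x) i j k"
    and "avg n (\<lambda>h. c h i * (c h j * (c h k * c h l))) = cen4 (raw1 n x) (raw2 n x) (raw3 n x) (raw4 n x) i j k l"
proof -
  let ?m = "raw1 n x"
  have e2: "c h i * c h j = x h $ i * x h $ j - ?m i * x h $ j - ?m j * x h $ i + ?m i * ?m j" for h i j
    by (simp add: c_def algebra_simps)
  show "avg n (\<lambda>h. c h i * c h j) = cen2 (raw1 n x) (raw2 n x) i j"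
    unfolding e2 avg_add avg_diff avg_cmult avg_const[OF n] cen2_def raw2_def raw1_def[symmetric]
    by (simp add: algebra_simps)
  have e3: "c h i * (c h j * c h k) = x h $ i * (x h $ j * x h $ k) - ?m i * (x h $ j * x h $ k)
      - ?m j * (x h $ i * x h $ k) - ?m k * (x h $ i * x h $ j)
      + (?m i * ?m j) * x h $ k + (?m i * ?m k) * x h $ j + (?m j * ?m k) * x h $ i - ?m i * ?m j * ?m k" for h i j k
    by (simp add: c_def algebra_simps)
  show "avg n (\<lambda>h. c h i * (c h j * c h k)) = cen3 (raw1 n x) (raw2 n x) (raw3 n x) i j k"
    unfolding e3 avg_add avg_diff avg_cmult avg_const[OF n] cen3_def raw3_def raw2_def raw1_def[symmetric]
    by (simp add: algebra_simps)
  have e4: "c h i * (c h j * (c h k * c h l)) = x h $ i * (x h $ j * (x h $ k * x h $ l))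
      - ?m i * (x h $ j * (x h $ k * x h $ l)) - ?m j * (x h $ i * (x h $ k * x h $ l))
      - ?m k * (x h $ i * (x h $ j * x h $ l)) - ?m l * (x h $ i * (x h $ j * x h $ k))
      + (?m i * ?m j) * (x h $ k * x h $ l) + (?m i * ?m k) * (x h $ j * x h $ l) + (?m i * ?m l) * (x h $ j * x h $ k)
      + (?m j * ?m k) * (x h $ i * x h $ l) + (?m j * ?m l) * (x h $ i * x h $ k) + (?m k * ?m l) * (x h $ i * x h $ j)
      - (?m i * ?m j * ?m k) * x h $ l - (?m i * ?m j * ?m l) * x h $ k - (?m i * ?m k * ?m l) * x h $ j
      - (?m j * ?m k * ?m l) * x h $ i + ?m i * ?m j * ?m k * ?m l" for h i j k l
    by (simp add: c_def algebra_simps)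
  show "avg n (\<lambda>h. c h i * (c h j * (c h k * c h l))) = cen4 (raw1 n x) (raw2 n x) (raw3 n x) (raw4 n x) i j k l"
    unfolding e4 avg_add avg_diff avg_cmult avg_const[OF n] cen4_def raw4_def raw3_def raw2_def raw1_def[symmetric]
    by (simp add: algebra_simps)
qed

lemma covariance_matrix_empirical:
  assumes "n > 0"
  shows "covariance_matrix (empirical n x) $ i $ j = cen2 (raw1 n x) (raw2 n x) i j"
  unfolding central_moments(1)[OF assms, symmetric]
  by (simp add: covariance_matrix_def integral_empirical mean_vector_empirical)

section \<open>Conjugated cumulant matrices of standardized samples\<close>

definition standardized :: "nat \<Rightarrow> (nat \<Rightarrow> real^'n) \<Rightarrow> real^'n^'n \<Rightarrow> nat \<Rightarrow> 'n \<Rightarrow> real" where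
  "standardized n x V h i = (\<Sum>j\<in>UNIV. V $ i $ j * (x h $ j - raw1 n x j))"

lemma C3_empirical:
  "C3 (standardized_empirical n x V) $ k $ l =
    (\<Sum>i\<in>UNIV. avg n (\<lambda>h. standardized n x V h i * (standardized n x V h k * standardized n x V h l)))"
proof -
  have "(V *v (x h - mean_vector (empirical n x))) $ i = standardized n x V h i" for h i
    by (simp add: matrix_vector_mult_def standardized_def mean_vector_empirical)
  then show ?thesis
    by (simp add: C3_def C3i_def standardized_empirical_def integral_empirical)
qed

lemma C4_empirical:
  "C4 (standardized_empirical n x V) $ k $ l =
    (\<Sum>i\<in>UNIV. avg n (\<lambda>h. standardized n x V h i * standardized n x V h i * (standardized n x V h k * standardized n x V h l))
      - avg n (\<lambda>h. standardized n x V h i * standardized n x V h i) * avg n (\<lambda>h. standardized n x V h k * standardized n x V h l)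
      - 2 * (avg n (\<lambda>h. standardized n x V h i * standardized n x V h k) * avg n (\<lambda>h. standardized n x V h i * standardized n x V h l)))"
proof -
  have "(V *v (x h - mean_vector (empirical n x))) $ i = standardized n x V h i" for h i
    by (simp add: matrix_vector_mult_def standardized_def mean_vector_empirical)
  then show ?thesis
    by (simp add: C4_def C4ij_def standardized_empirical_def integral_empirical)
qed

lemma standardized_mult:
  "(\<Sum>a\<in>UNIV. U $ k $ a * standardized n x V h a) = standardized n x (U ** V) h k"
proof -
  have "(\<Sum>a\<in>UNIV. U $ k $ a * standardized n x V h a) =
      (\<Sum>a\<in>UNIV. \<Sum>j\<in>UNIV. U $ k $ a * V $ a $ j * (x h $ j - raw1 n x j))"
    by (simp add: standardized_def sum_distrib_left mult.assoc)
  also have "\<dots> = standardized n x (U ** V) h k"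
    by (subst sum.swap) (simp add: standardized_def matrix_matrix_mult_def sum_distrib_right)
  finally show ?thesis .
qed

lemma avg_standardized2:
  assumes n: "n > 0"
  shows "avg n (\<lambda>h. standardized n x W h k * standardized n x W' h l) =
    (\<Sum>a\<in>UNIV. \<Sum>b\<in>UNIV. W $ k $ a * W' $ l $ b * cen2 (raw1 n x) (raw2 n x) a b)"
  unfolding central_moments(1)[OF n, symmetric] avg_cmult[symmetric] avg_sum[symmetric]
  by (simp add: standardized_def sum_product mult_ac)

lemma mult_bilinear_sum:
  fixes f g y :: "'n::finite \<Rightarrow> real"
  shows "T * ((\<Sum>a\<in>UNIV. f a * y a) * (\<Sum>b\<in>UNIV. g b * y b)) =
      (\<Sum>a\<in>UNIV. \<Sum>b\<in>UNIV. f a * g b * (T * (y a * y b)))"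
  unfolding sum_product by (simp add: sum_distrib_left mult_ac)

text \<open>Rotating standardized data by U is the same as transforming centred data by U V, and the
  sum over the standardized components turns into the column sums of V. This is the shape assumed in
  the abstract linearization.\<close>

lemma conj_C3_empirical:
  fixes U V :: "real^'n^'n"
  assumes n: "n > 0"
  shows "(U ** C3 (standardized_empirical n x V) ** transpose U) $ k $ l =
    (\<Sum>a\<in>UNIV. \<Sum>b\<in>UNIV. (U ** V) $ k $ a * (U ** V) $ l $ b *
      (\<Sum>j\<in>UNIV. (\<Sum>m\<in>UNIV. V $ m $ j) * cen3 (raw1 n x) (raw2 n x) (raw3 n x) j a b))"
proof -
  let ?c = "\<lambda>h i. x h $ i - raw1 n x i"
  have t: "(\<Sum>i\<in>UNIV. standardized n x V h i) = (\<Sum>j\<in>UNIV. (\<Sum>m\<in>UNIV. V $ m $ j) * ?c h j)" for h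
    unfolding standardized_def by (subst sum.swap) (simp add: sum_distrib_right)
  have "(U ** C3 (standardized_empirical n x V) ** transpose U) $ k $ l =
      avg n (\<lambda>h. \<Sum>a\<in>UNIV. \<Sum>b\<in>UNIV. U $ k $ a * U $ l $ b *
        (\<Sum>i\<in>UNIV. standardized n x V h i * (standardized n x V h a * standardized n x V h b)))"
    unfolding conj_matrix_component C3_empirical by (simp add: avg_sum avg_cmult)
  also have "\<dots> = avg n (\<lambda>h. (\<Sum>i\<in>UNIV. standardized n x V h i) *
      ((\<Sum>a\<in>UNIV. U $ k $ a * standardized n x V h a) * (\<Sum>b\<in>UNIV. U $ l $ b * standardized n x V h b)))"
    by (simp only: sum_distrib_right[symmetric] mult_bilinear_sum)
  also have "\<dots> = avg n (\<lambda>h. (\<Sum>j\<in>UNIV. (\<Sum>m\<in>UNIV. V $ m $ j) * ?c h j) *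
      ((\<Sum>a\<in>UNIV. (U ** V) $ k $ a * ?c h a) * (\<Sum>b\<in>UNIV. (U ** V) $ l $ b * ?c h b)))"
    unfolding t standardized_mult by (simp only: standardized_def)
  also have "\<dots> = avg n (\<lambda>h. \<Sum>a\<in>UNIV. \<Sum>b\<in>UNIV. (U ** V) $ k $ a * (U ** V) $ l $ b *
      (\<Sum>j\<in>UNIV. (\<Sum>m\<in>UNIV. V $ m $ j) * (?c h j * (?c h a * ?c h b))))"
    unfolding mult_bilinear_sum by (simp only: sum_distrib_right mult.assoc)
  also have "\<dots> = (\<Sum>a\<in>UNIV. \<Sum>b\<in>UNIV. (U ** V) $ k $ a * (U ** V) $ l $ b *
      (\<Sum>j\<in>UNIV. (\<Sum>m\<in>UNIV. V $ m $ j) * cen3 (raw1 n x) (raw2 n x) (raw3 n x) j a b))"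
    by (simp only: avg_sum avg_cmult central_moments(2)[OF n])
  finally show ?thesis .
qed

text \<open>For whitened data the products of second moments in C4 add up to (p + 2) I, which an
  orthogonal conjugation leaves unchanged; what remains is a fourth-moment matrix in which V enters
  through V^T V.\<close>

lemma conj_C4_empirical:
  fixes U V :: "real^'n^'n"
  assumes n: "n > 0" and U: "orthogonal_matrix U"
    and cov: "\<And>k l. (\<Sum>a\<in>UNIV. \<Sum>b\<in>UNIV. V $ k $ a * V $ l $ b * cen2 (raw1 n x) (raw2 n x) a b) = (if k = l then 1 else 0)"
  shows "(U ** C4 (standardized_empirical n x V) ** transpose U) $ k $ l =
    (\<Sum>a\<in>UNIV. \<Sum>b\<in>UNIV. (U ** V) $ k $ a * (U ** V) $ l $ b *
      (\<Sum>i\<in>UNIV. \<Sum>j\<in>UNIV. (\<Sum>m\<in>UNIV. V $ m $ i * V $ m $ j) * cen4 (raw1 n x) (raw2 n x) (raw3 n x) (raw4 n x) i j a b))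
    - (if k = l then real CARD('n) + 2 else 0)"
proof -
  let ?c = "\<lambda>h i. x h $ i - raw1 n x i"
  have C4: "C4 (standardized_empirical n x V) $ a $ b =
      avg n (\<lambda>h. (\<Sum>i\<in>UNIV. standardized n x V h i * standardized n x V h i) * (standardized n x V h a * standardized n x V h b))
      - (real CARD('n) + 2) * (if a = b then 1 else 0)" for a b
  proof -
    have "(\<Sum>i\<in>UNIV. (if i = a then 1 else 0) * (if i = b then 1 else (0 :: real))) = (if a = b then 1 else 0)"
      by (rule sum_delta_mult(2))
    then show ?thesis
      unfolding C4_empirical avg_standardized2[OF n] cov sum_distrib_right avg_sum sum_subtractf
        sum_distrib_left[symmetric] by (simp add: algebra_simps)
  qed
  have t: "(\<Sum>i\<in>UNIV. standardized n x V h i * standardized n x V h i) =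
      (\<Sum>i\<in>UNIV. \<Sum>j\<in>UNIV. (\<Sum>m\<in>UNIV. V $ m $ i * V $ m $ j) * (?c h i * ?c h j))" for h
  proof -
    have "(\<Sum>i\<in>UNIV. standardized n x V h i * standardized n x V h i) =
        (\<Sum>m\<in>UNIV. \<Sum>i\<in>UNIV. \<Sum>j\<in>UNIV. V $ m $ i * V $ m $ j * (?c h i * ?c h j))"
      by (simp only: standardized_def sum_product mult_ac)
    also have "\<dots> = (\<Sum>i\<in>UNIV. \<Sum>j\<in>UNIV. \<Sum>m\<in>UNIV. V $ m $ i * V $ m $ j * (?c h i * ?c h j))"
      by (subst sum.swap, rule sum.cong[OF refl], rule sum.swap)
    finally show ?thesis by (simp only: sum_distrib_right)
  qed
  have I: "(\<Sum>a\<in>UNIV. \<Sum>b\<in>UNIV. U $ k $ a * U $ l $ b * ((real CARD('n) + 2) * (if a = b then 1 else 0)))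
      = (if k = l then real CARD('n) + 2 else 0)"
  proof -
    have "(\<Sum>b\<in>UNIV. U $ k $ a * U $ l $ b * ((real CARD('n) + 2) * (if a = b then 1 else 0)))
        = (real CARD('n) + 2) * (U $ k $ a * U $ l $ a)" for a
    proof -
      have "(\<Sum>b\<in>UNIV. U $ k $ a * U $ l $ b * ((real CARD('n) + 2) * (if a = b then 1 else 0))) =
        (\<Sum>b\<in>UNIV. (U $ k $ a * U $ l $ b * (real CARD('n) + 2)) * (if a = b then 1 else 0))"
        by (simp only: mult.assoc)
      then show ?thesis unfolding sum_delta_mult by (simp only: mult_ac)
    qed
    then show ?thesis
      by (simp add: sum_distrib_left[symmetric] orthogonal_matrix_inner_rows[OF U])
  qed
  have "(U ** C4 (standardized_empirical n x V) ** transpose U) $ k $ l =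
      avg n (\<lambda>h. \<Sum>a\<in>UNIV. \<Sum>b\<in>UNIV. U $ k $ a * U $ l $ b *
        ((\<Sum>i\<in>UNIV. standardized n x V h i * standardized n x V h i) * (standardized n x V h a * standardized n x V h b)))
       - (if k = l then real CARD('n) + 2 else 0)"
    unfolding conj_matrix_component C4 right_diff_distrib sum_subtractf I by (simp only: avg_sum avg_cmult)
  also have "avg n (\<lambda>h. \<Sum>a\<in>UNIV. \<Sum>b\<in>UNIV. U $ k $ a * U $ l $ b *
        ((\<Sum>i\<in>UNIV. standardized n x V h i * standardized n x V h i) * (standardized n x V h a * standardized n x V h b)))
      = avg n (\<lambda>h. (\<Sum>i\<in>UNIV. standardized n x V h i * standardized n x V h i) *
      ((\<Sum>a\<in>UNIV. U $ k $ a * standardized n x V h a) * (\<Sum>b\<in>UNIV. U $ l $ b * standardized n x V h b)))"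
    by (simp only: mult_bilinear_sum)
  also have "\<dots> = avg n (\<lambda>h. (\<Sum>i\<in>UNIV. \<Sum>j\<in>UNIV. (\<Sum>m\<in>UNIV. V $ m $ i * V $ m $ j) * (?c h i * ?c h j)) *
      ((\<Sum>a\<in>UNIV. (U ** V) $ k $ a * ?c h a) * (\<Sum>b\<in>UNIV. (U ** V) $ l $ b * ?c h b)))"
    unfolding t standardized_mult by (simp only: standardized_def)
  also have "\<dots> = avg n (\<lambda>h. \<Sum>a\<in>UNIV. \<Sum>b\<in>UNIV. (U ** V) $ k $ a * (U ** V) $ l $ b *
      (\<Sum>i\<in>UNIV. \<Sum>j\<in>UNIV. (\<Sum>m\<in>UNIV. V $ m $ i * V $ m $ j) * (?c h i * (?c h j * (?c h a * ?c h b)))))"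
    unfolding mult_bilinear_sum by (simp only: sum_distrib_right mult.assoc)
  also have "\<dots> = (\<Sum>a\<in>UNIV. \<Sum>b\<in>UNIV. (U ** V) $ k $ a * (U ** V) $ l $ b *
      (\<Sum>i\<in>UNIV. \<Sum>j\<in>UNIV. (\<Sum>m\<in>UNIV. V $ m $ i * V $ m $ j) * cen4 (raw1 n x) (raw2 n x) (raw3 n x) (raw4 n x) i j a b))"
    by (simp only: avg_sum avg_cmult central_moments(3)[OF n])
  finally show ?thesis .
qed

lemma C_empirical_symmetric:
  "C3 (standardized_empirical n x V) $ i $ j = C3 (standardized_empirical n x V) $ j $ i"
  "C4 (standardized_empirical n x V) $ i $ j = C4 (standardized_empirical n x V) $ j $ i"
  unfolding C3_empirical C4_empirical by (simp_all add: mult_ac)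

text \<open>The orthogonal factor and the signed row permutation both cancel in V \<Sigma> V^T. This
  is the exact equation by which a sample version of the functional enters the expansion.\<close>

lemma row_equivalent_whitening:
  fixes V \<Sigma> :: "real^'n^'n"
  assumes row: "row_equivalent (U ** S) V" and U: "orthogonal_matrix U" and S: "is_inverse_sqrt S \<Sigma>"
  shows "V ** \<Sigma> ** transpose V = mat 1"
proof -
  define G where "G = U ** S"
  have St: "transpose S = S" and inv: "invertible \<Sigma>" and SS: "S ** S = matrix_inv \<Sigma>"
    using S by (auto simp: is_inverse_sqrt_def)
  have "\<Sigma> ** matrix_inv \<Sigma> = mat 1 \<and> matrix_inv \<Sigma> ** \<Sigma> = mat 1"
    using inv unfolding matrix_inv_def invertible_def by (rule someI_ex)
  then have "matrix_inv \<Sigma> ** \<Sigma> = mat 1" ..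
  \<comment> \<open>One-sided inverses of square matrices are two-sided, so S may be moved to the
    other side.\<close>
  then have "S ** (S ** \<Sigma>) = mat 1" by (simp add: SS[symmetric] matrix_mul_assoc)
  then have "(S ** \<Sigma>) ** S = mat 1" using matrix_left_right_inverse by blast
  then have G: "G ** \<Sigma> ** transpose G = mat 1"
    using U by (simp add: G_def matrix_transpose_mul St matrix_mul_assoc orthogonal_matrix_def)
      (metis matrix_mul_assoc matrix_mul_rid orthogonal_matrix_def)
  obtain \<pi> s where \<pi>: "bij \<pi>" and s: "\<And>i. s i = 1 \<or> s i = - 1" and V: "\<And>i. V $ i = s i *\<^sub>R G $ \<pi> i"
    using row by (auto simp: row_equivalent_def G_def)
  have "(V ** \<Sigma> ** transpose V) $ i $ j = (mat 1 :: real^'n^'n) $ i $ j" for i j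
  proof -
    have "(V ** \<Sigma> ** transpose V) $ i $ j = s i * s j * (G ** \<Sigma> ** transpose G) $ \<pi> i $ \<pi> j"
      unfolding conj_matrix_component V by (simp add: sum_distrib_left mult_ac)
    also have "\<dots> = s i * s j * (if i = j then 1 else 0)"
      unfolding G using bij_is_inj[OF \<pi>] by (auto simp: mat_def inj_eq)
    finally show ?thesis using s[of i] by (auto simp: mat_def)
  qed
  then show ?thesis by (simp add: vec_eq_iff)
qed

lemma whitening_components:
  fixes V :: "real^'n^'n"
  assumes "n > 0" "V ** covariance_matrix (empirical n x) ** transpose V = mat 1"
  shows "(\<Sum>a\<in>UNIV. \<Sum>b\<in>UNIV. V $ k $ a * V $ l $ b * cen2 (raw1 n x) (raw2 n x) a b) = (if k = l then 1 else 0)"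
proof -
  have "(V ** covariance_matrix (empirical n x) ** transpose V) $ k $ l = (if k = l then 1 else 0)"
    by (simp add: assms(2) mat_def)
  then show ?thesis unfolding conj_matrix_component covariance_matrix_empirical[OF assms(1)] .
qed

lemma whitening_orthogonal_mult:
  fixes U V :: "real^'n^'n"
  assumes U: "orthogonal_matrix U" and V: "V ** \<Sigma> ** transpose V = mat 1"
  shows "(U ** V) ** \<Sigma> ** transpose (U ** V) = mat 1"
proof -
  have "(U ** V) ** \<Sigma> ** transpose (U ** V) = U ** (V ** \<Sigma> ** transpose V) ** transpose U"
    by (simp add: matrix_transpose_mul matrix_mul_assoc)
  then show ?thesis using U V by (simp add: orthogonal_matrix_def)
qed

section \<open>Linearization of the solutions\<close>

text \<open>The deterministic core, in which p later runs through pairs of a sample size and a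
  sample point. The premise \<open>nearest\<close> is what the selection provides: U lies within 1/2
  of I as soon as some maximizer does.\<close>

lemma solution_linearization:
  fixes F :: "'a filter" and N :: "'a \<Rightarrow> nat" and x :: "'a \<Rightarrow> nat \<Rightarrow> real^'n"
    and V U :: "'a \<Rightarrow> real^'n^'n" and \<gamma> \<kappa> :: "'n \<Rightarrow> real" and \<alpha> :: real
  defines "s \<equiv> \<lambda>p. 1 / sqrt (real (N p))"
  defines "obj \<equiv> \<lambda>p. compound_objective \<alpha> (C3 (standardized_empirical (N p) (x p) (V p)))
      (C4 (standardized_empirical (N p) (x p) (V p)))"
  assumes N: "filterlim N at_top F"
    and m1: "\<And>i. Bfun (\<lambda>p. raw1 (N p) (x p) i / s p) F"
    and m2: "\<And>i j. Bfun (\<lambda>p. (raw2 (N p) (x p) i j - mom2 i j) / s p) F"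
    and m3: "\<And>i j k. Bfun (\<lambda>p. (raw3 (N p) (x p) i j k - mom3 \<gamma> i j k) / s p) F"
    and m4: "\<And>i j k l. \<alpha> \<noteq> 1 \<Longrightarrow> Bfun (\<lambda>p. (raw4 (N p) (x p) i j k l - mom4 \<kappa> i j k l) / s p) F"
    and V: "\<And>i j. Bfun (\<lambda>p. (V p $ i $ j - (if i = j then 1 else 0)) / s p) F"
    and whiten: "\<forall>\<^sub>F p in F. V p ** covariance_matrix (empirical (N p) (x p)) ** transpose (V p) = mat 1"
    and max: "\<forall>\<^sub>F p in F. is_arg_max (obj p) orthogonal_matrix (U p)"
    and nearest: "\<forall>\<^sub>F p in F. \<forall>Q. is_arg_max (obj p) orthogonal_matrix Q \<and> norm (Q - mat 1) \<le> 1/2 \<longrightarrow> norm (U p - mat 1) \<le> 1/2"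
    and \<alpha>: "0 \<le> \<alpha>" "\<alpha> \<le> 1"
    and sep: "\<And>k l. k \<noteq> l \<Longrightarrow> \<alpha> * (\<gamma> k - \<gamma> l)\<^sup>2 + (1 - \<alpha>) * (\<kappa> k - \<kappa> l)\<^sup>2 \<noteq> 0"
  shows "((\<lambda>p. U p ** V p) \<longlongrightarrow> mat 1) F"
    and "((\<lambda>p. ((U p ** V p) $ k $ l - (if k = l then 1 else 0)) / s p - lin_part \<alpha> \<gamma> \<kappa> k l
      (\<lambda>i. raw1 (N p) (x p) i / s p) (\<lambda>i j. (raw2 (N p) (x p) i j - mom2 i j) / s p)
      (\<lambda>i j h. (raw3 (N p) (x p) i j h - mom3 \<gamma> i j h) / s p)
      (\<lambda>i j h r. (raw4 (N p) (x p) i j h r - mom4 \<kappa> i j h r) / s p)) \<longlongrightarrow> 0) F"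
proof -
  have N_pos: "\<forall>\<^sub>F p in F. N p > 0"
    using N eventually_gt_at_top[of 0] by (rule eventually_compose_filterlim[rotated])
  have s_pos: "\<forall>\<^sub>F p in F. s p > 0"
    using N_pos by eventually_elim (simp add: s_def)
  have "((\<lambda>n. 1 / sqrt (real n)) \<longlongrightarrow> 0) at_top"
    by (intro tendsto_divide_0[OF tendsto_const] filterlim_compose[OF sqrt_at_top filterlim_real_sequentially]
        filterlim_at_top_imp_at_infinity)
  from filterlim_compose[OF this N] have s0: "(s \<longlongrightarrow> 0) F" by (simp add: s_def)
  note eq = expands_quotient
  have m1': "expands F s (\<lambda>p. raw1 (N p) (x p) i) 0 (\<lambda>p. raw1 (N p) (x p) i / s p)" for i
    using eq[of "\<lambda>p. raw1 (N p) (x p) i" 0 s F] m1[of i] by simp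
  have sym: "raw2 n y i j = raw2 n y j i" for n i j and y :: "nat \<Rightarrow> real^'n"
    by (simp add: raw2_def mult.commute)
  have sym': "(raw2 (N p) (x p) i j - mom2 i j) / s p = (raw2 (N p) (x p) j i - mom2 j i) / s p" for i j p
    by (simp add: sym mom2_def)
  have covV: "\<forall>\<^sub>F p in F. (\<Sum>a\<in>UNIV. \<Sum>b\<in>UNIV. V p $ k $ a * V p $ l $ b *
      cen2 (\<lambda>i. raw1 (N p) (x p) i) (\<lambda>i j. raw2 (N p) (x p) i j) a b) = (if k = l then 1 else 0)" for k l
    using N_pos whiten by eventually_elim (rule whitening_components)
  define A where "A p = C3 (standardized_empirical (N p) (x p) (V p))" for p
  define B where "B p = (if \<alpha> = 1 then diag_matrix \<kappa> else C4 (standardized_empirical (N p) (x p) (V p)))" for p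
  have obj: "obj p = compound_objective \<alpha> (A p) (B p)" for p
    by (simp add: obj_def A_def B_def compound_objective_def fun_eq_iff)
  have V': "expands F s (\<lambda>p. V p $ i $ j) (if i = j then 1 else 0) (\<lambda>p. (V p $ i $ j - (if i = j then 1 else 0)) / s p)" for i j
    by (rule eq[OF V])
  let ?c3 = "\<lambda>p. cen3 (\<lambda>i. raw1 (N p) (x p) i) (\<lambda>i j. raw2 (N p) (x p) i j) (\<lambda>i j k. raw3 (N p) (x p) i j k)"
  let ?c4 = "\<lambda>p. cen4 (\<lambda>i. raw1 (N p) (x p) i) (\<lambda>i j. raw2 (N p) (x p) i j) (\<lambda>i j k. raw3 (N p) (x p) i j k)
    (\<lambda>i j k l. raw4 (N p) (x p) i j k l)"
  let ?A = "\<lambda>Q k l p. \<Sum>a\<in>UNIV. \<Sum>b\<in>UNIV. Q p $ k $ a * Q p $ l $ b *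
    (\<Sum>j\<in>UNIV. (\<Sum>m\<in>UNIV. V p $ m $ j) * ?c3 p j a b)"
  let ?B = "\<lambda>Q k l p. \<Sum>a\<in>UNIV. \<Sum>b\<in>UNIV. Q p $ k $ a * Q p $ l $ b *
    (\<Sum>i\<in>UNIV. \<Sum>j\<in>UNIV. (\<Sum>m\<in>UNIV. V p $ m $ i * V p $ m $ j) * ?c4 p i j a b)"
  have A_lim: "(A \<longlongrightarrow> diag_matrix \<gamma>) F"
  proof (intro vec_tendstoI)
    fix k l
    have "(?A V k l \<longlongrightarrow> (if k = l then \<gamma> k else 0)) F"
      by (rule skewness_limit[OF s0 m1' eq[OF m2] eq[OF m3] eq[OF m4] V' V' sym' s_pos])
    moreover have "\<forall>\<^sub>F p in F. ?A V k l p = A p $ k $ l"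
      using N_pos
    proof eventually_elim
      case (elim p)
      then show ?case using conj_C3_empirical[OF elim, of "mat 1" "x p" "V p" k l]
        by (simp only: matrix_mul_lid matrix_mul_rid transpose_mat A_def)
    qed
    ultimately show "((\<lambda>p. A p $ k $ l) \<longlongrightarrow> diag_matrix \<gamma> $ k $ l) F"
      using tendsto_cong by fastforce
  qed
  have B_lim: "(B \<longlongrightarrow> diag_matrix \<kappa>) F"
  proof (cases "\<alpha> = 1")
    case True
    then have "B = (\<lambda>_. diag_matrix \<kappa>)" by (simp add: B_def fun_eq_iff)
    then show ?thesis by (simp only: tendsto_const)
  next
    case False
    show ?thesis
    proof (intro vec_tendstoI)
      fix k l
      let ?f = "?B V k l"
      have "(?f \<longlongrightarrow> (if k = l then \<kappa> k + real CARD('n) + 2 else 0)) F"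
        by (rule kurtosis_limit[OF s0 m1' eq[OF m2] eq[OF m3] eq[OF m4] V' V' sym' False s_pos covV])
      then have "((\<lambda>p. ?f p - (if k = l then real CARD('n) + 2 else 0)) \<longlongrightarrow>
          (if k = l then \<kappa> k + real CARD('n) + 2 else 0) - (if k = l then real CARD('n) + 2 else 0)) F"
        by (intro tendsto_diff tendsto_const)
      moreover have "\<forall>\<^sub>F p in F. ?f p - (if k = l then real CARD('n) + 2 else 0) = B p $ k $ l"
        using N_pos whiten
      proof eventually_elim
        case (elim p)
        from conj_C4_empirical[OF elim(1) orthogonal_matrix_id whitening_components[OF elim], of k l] False
        show ?case by (simp only: matrix_mul_lid matrix_mul_rid transpose_mat B_def if_False)
      qed
      moreover have "(if k = l then \<kappa> k + real CARD('n) + 2 else 0) - (if k = l then real CARD('n) + 2 else 0)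
        = diag_matrix \<kappa> $ k $ l" by simp
      ultimately show "((\<lambda>p. B p $ k $ l) \<longlongrightarrow> diag_matrix \<kappa> $ k $ l) F"
        using tendsto_cong by fastforce
    qed
  qed
  have U_lim: "(U \<longlongrightarrow> mat 1) F"
  proof (rule tendstoI)
    fix e :: real assume e: "e > 0"
    have *: "\<forall>\<^sub>F p in F. (\<exists>Q. is_arg_max (obj p) orthogonal_matrix Q \<and> norm (Q - mat 1) \<le> \<epsilon>) \<and>
        (\<forall>Q. is_arg_max (obj p) orthogonal_matrix Q \<and> norm (Q - mat 1) \<le> 1/2 \<longrightarrow> norm (Q - mat 1) \<le> \<epsilon>)"
      if "\<epsilon> > 0" for \<epsilon>
    proof -
      have "\<exists>\<delta>>0. \<forall>A B. norm (A - diag_matrix \<gamma>) < \<delta> \<and> norm (B - diag_matrix \<kappa>) < \<delta> \<longrightarrow>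
        (\<exists>U. is_arg_max (compound_objective \<alpha> A B) orthogonal_matrix U \<and> norm (U - mat 1) \<le> \<epsilon>) \<and>
        (\<forall>U. is_arg_max (compound_objective \<alpha> A B) orthogonal_matrix U \<and> norm (U - mat 1) \<le> 1/2
          \<longrightarrow> norm (U - mat 1) \<le> \<epsilon>)"
        by (intro maximizers_near_identity \<alpha> sep that)
      then obtain \<delta> where \<delta>: "\<delta> > 0 \<and> (\<forall>A B. norm (A - diag_matrix \<gamma>) < \<delta> \<and> norm (B - diag_matrix \<kappa>) < \<delta> \<longrightarrow>
        (\<exists>U. is_arg_max (compound_objective \<alpha> A B) orthogonal_matrix U \<and> norm (U - mat 1) \<le> \<epsilon>) \<and>
        (\<forall>U. is_arg_max (compound_objective \<alpha> A B) orthogonal_matrix U \<and> norm (U - mat 1) \<le> 1/2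
          \<longrightarrow> norm (U - mat 1) \<le> \<epsilon>))" ..
      have "\<forall>\<^sub>F p in F. dist (A p) (diag_matrix \<gamma>) < \<delta>" "\<forall>\<^sub>F p in F. dist (B p) (diag_matrix \<kappa>) < \<delta>"
        by (rule tendstoD[OF A_lim conjunct1[OF \<delta>]], rule tendstoD[OF B_lim conjunct1[OF \<delta>]])
      then show ?thesis
      proof eventually_elim
        case (elim p)
        show ?case unfolding obj using elim
          by (intro conjunct2[OF \<delta>, THEN spec, THEN spec, THEN mp]) (simp add: dist_norm)
      qed
    qed
    \<comment> \<open>Existence at radius 1/2 and \<open>nearest\<close> put U within 1/2 of I, and
      every maximizer this close is already within e / 2.\<close>
    have e2: "e / 2 > 0" and half: "1/2 > (0::real)" using e by auto
    show "\<forall>\<^sub>F p in F. dist (U p) (mat 1) < e"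
      using *[OF e2] *[OF half] max nearest
    proof eventually_elim
      case (elim p)
      then have "norm (U p - mat 1) \<le> e / 2" by blast
      then show ?case using e by (simp add: dist_norm)
    qed
  qed
  have V_lim: "((\<lambda>p. V p $ i $ j) \<longlongrightarrow> mat 1 $ i $ j) F" for i j
    using expands_tendsto[OF V' s0 s_pos, of i j] by (simp add: mat_def)
  show W_lim: "((\<lambda>p. U p ** V p) \<longlongrightarrow> mat 1) F"
  proof (intro vec_tendstoI)
    fix i j
    have "((\<lambda>p. (U p ** V p) $ i $ j) \<longlongrightarrow> (mat 1 ** mat 1 :: real^'n^'n) $ i $ j) F"
      unfolding matrix_matrix_mult_def vec_lambda_beta
      by (intro tendsto_sum tendsto_mult tendsto_vec_nth U_lim V_lim)
    then show "((\<lambda>p. (U p ** V p) $ i $ j) \<longlongrightarrow> mat 1 $ i $ j) F"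
      by (simp only: matrix_mul_lid)
  qed
  have W_lim': "((\<lambda>p. (U p ** V p) $ i $ j) \<longlongrightarrow> (if i = j then 1 else 0)) F" for i j
    using tendsto_vec_nth[OF tendsto_vec_nth[OF W_lim, of i], of j] by (simp add: mat_def)
  have covW: "\<forall>\<^sub>F p in F. (\<Sum>a\<in>UNIV. \<Sum>b\<in>UNIV. (U p ** V p) $ k $ a * (U p ** V p) $ l $ b *
      cen2 (\<lambda>i. raw1 (N p) (x p) i) (\<lambda>i j. raw2 (N p) (x p) i j) a b) = (if k = l then 1 else 0)" for k l
    using N_pos whiten max
  proof eventually_elim
    case (elim p)
    show ?case
      by (rule whitening_components[OF elim(1) whitening_orthogonal_mult[OF is_arg_maxD(1)[OF elim(3)] elim(2)]])
  qed
  let ?W = "\<lambda>p. U p ** V p"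
  have stat: "\<forall>\<^sub>F p in F. \<alpha> * (?A ?W k l p * (?A ?W k k p - ?A ?W l l p)) +
      (1 - \<alpha>) * (?B ?W k l p * (?B ?W k k p - ?B ?W l l p)) = 0"
    if kl: "k \<noteq> l" for k l
    using N_pos whiten max
  proof eventually_elim
    case (elim p)
    note U = is_arg_maxD(1)[OF elim(3)]
    note eqA = conj_C3_empirical[OF elim(1), of "U p" "x p" "V p"]
    note eqB = conj_C4_empirical[OF elim(1) U whitening_components[OF elim(1,2)]]
    \<comment> \<open>The constant p + 2 separating \<open>?B\<close> from the conjugated C4 cancels
      in differences of diagonal entries.\<close>
    have c: "a * (b - d - (e - d)) = a * (b - e)" for a b d e :: real by simp
    show ?case
      using compound_objective_stationary[OF elim(3)[unfolded obj_def] C_empirical_symmetric kl]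
      unfolding eqA eqB using kl by (simp only: simp_thms if_True if_False diff_0_right c)
  qed
  show "((\<lambda>p. ((U p ** V p) $ k $ l - (if k = l then 1 else 0)) / s p - lin_part \<alpha> \<gamma> \<kappa> k l
      (\<lambda>i. raw1 (N p) (x p) i / s p) (\<lambda>i j. (raw2 (N p) (x p) i j - mom2 i j) / s p)
      (\<lambda>i j h. (raw3 (N p) (x p) i j h - mom3 \<gamma> i j h) / s p)
      (\<lambda>i j h r. (raw4 (N p) (x p) i j h r - mom4 \<kappa> i j h r) / s p)) \<longlongrightarrow> 0) F"
    by (rule consistent_solution_linearization[where W = "\<lambda>k l p. (U p ** V p) $ k $ l" and V = "\<lambda>k l p. V p $ k $ l",
          OF s0 s_pos m1 m2 m3 m4 sym V W_lim' covV covW stat sep])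
qed

section \<open>Event filters and influence functions\<close>

text \<open>Convergence along this filter is convergence uniform over the events \<open>G n\<close>
  as n grows, so ordinary limit theorems for functions apply to stochastic expansions.\<close>

definition event_filter :: "(nat \<Rightarrow> 'w set) \<Rightarrow> (nat \<times> 'w) filter" where
  "event_filter G = inf (filtercomap fst sequentially) (principal {p. snd p \<in> G (fst p)})"

lemma eventually_event_filter:
  "eventually P (event_filter G) \<longleftrightarrow> (\<forall>\<^sub>F n in sequentially. \<forall>\<omega>\<in>G n. P (n, \<omega>))"
proof
  assume "eventually P (event_filter G)"
  then obtain Q where Q: "eventually Q sequentially" "\<And>p. Q (fst p) \<Longrightarrow> snd p \<in> G (fst p) \<Longrightarrow> P p"
    unfolding event_filter_def eventually_inf_principal eventually_filtercomap by blast
  show "\<forall>\<^sub>F n in sequentially. \<forall>\<omega>\<in>G n. P (n, \<omega>)"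
    using Q(1) by eventually_elim (use Q(2) in auto)
next
  assume "\<forall>\<^sub>F n in sequentially. \<forall>\<omega>\<in>G n. P (n, \<omega>)"
  then show "eventually P (event_filter G)"
    unfolding event_filter_def eventually_inf_principal eventually_filtercomap by fastforce
qed

lemma filterlim_fst_event_filter: "filterlim fst at_top (event_filter G)"
  unfolding event_filter_def by (rule filterlim_mono[OF filterlim_filtercomap]) auto

text \<open>Uniform convergence on events of probability at least 1 - \<eta> bounds the probability
  of a deviation by \<eta> from some n on, and \<eta> is arbitrary. The events may depend on
  \<eta>.\<close>

lemma converges_in_probabilityI_event_filter:
  fixes R :: "nat \<Rightarrow> 'w \<Rightarrow> 'b::{real_normed_vector, second_countable_topology}"
  assumes M: "prob_space M" and R[measurable]: "\<And>n. R n \<in> borel_measurable M"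
    and G: "\<And>\<eta>. \<eta> > 0 \<Longrightarrow> \<exists>G. (\<forall>n. G n \<in> sets M) \<and> (\<forall>\<^sub>F n in sequentially. measure M (G n) \<ge> 1 - \<eta>) \<and>
      ((\<lambda>p. R (fst p) (snd p)) \<longlongrightarrow> c) (event_filter G)"
  shows "converges_in_probability M R c"
  unfolding converges_in_probability_def
proof (intro allI impI tendstoI)
  interpret prob_space M by fact
  fix \<epsilon> e :: real assume \<epsilon>: "\<epsilon> > 0" and e: "e > 0"
  obtain G where G: "\<And>n. G n \<in> sets M" "\<forall>\<^sub>F n in sequentially. measure M (G n) \<ge> 1 - e / 2"
      "((\<lambda>p. R (fst p) (snd p)) \<longlongrightarrow> c) (event_filter G)"
    using G[of "e / 2"] e by auto
  have "\<forall>\<^sub>F n in sequentially. \<forall>\<omega>\<in>G n. dist (R n \<omega>) c < \<epsilon>"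
    using tendstoD[OF G(3) \<epsilon>] by (simp add: eventually_event_filter)
  then show "\<forall>\<^sub>F n in sequentially. dist (measure M {\<omega> \<in> space M. norm (R n \<omega> - c) > \<epsilon>}) 0 < e"
    using G(2)
  proof eventually_elim
    case (elim n)
    have "prob {\<omega> \<in> space M. norm (R n \<omega> - c) > \<epsilon>} \<le> prob (space M - G n)"
      using elim(1) G(1) by (intro finite_measure_mono) (auto simp: dist_norm)
    also have "\<dots> = 1 - prob (G n)" by (rule prob_compl[OF G(1)])
    finally show ?case using elim(2) e by (simp add: dist_real_def)
  qed
qed

section \<open>The influence function and its first two moments\<close>

lemma lin_part_add:
  "lin_part \<alpha> \<gamma> \<kappa> k l (\<lambda>i. a1 i + b1 i) (\<lambda>i j. a2 i j + b2 i j) (\<lambda>i j h. a3 i j h + b3 i j h)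
    (\<lambda>i j h r. a4 i j h r + b4 i j h r) = lin_part \<alpha> \<gamma> \<kappa> k l a1 a2 a3 a4 + lin_part \<alpha> \<gamma> \<kappa> k l b1 b2 b3 b4"
  by (simp add: lin_part_def sum.distrib add_divide_distrib[symmetric]) (simp add: algebra_simps)

lemma lin_part_zero: "lin_part \<alpha> \<gamma> \<kappa> k l (\<lambda>_. 0) (\<lambda>_ _. 0) (\<lambda>_ _ _. 0) (\<lambda>_ _ _ _. 0) = 0"
  by (simp add: lin_part_def)

lemma lin_part_sum:
  assumes "finite H"
  shows "lin_part \<alpha> \<gamma> \<kappa> k l (\<lambda>i. \<Sum>h\<in>H. a1 h i) (\<lambda>i j. \<Sum>h\<in>H. a2 h i j) (\<lambda>i j m. \<Sum>h\<in>H. a3 h i j m)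
    (\<lambda>i j m r. \<Sum>h\<in>H. a4 h i j m r) = (\<Sum>h\<in>H. lin_part \<alpha> \<gamma> \<kappa> k l (a1 h) (a2 h) (a3 h) (a4 h))"
  using assms by induction (simp_all add: lin_part_zero lin_part_add)

lemma has_bochner_integral_lin_part:
  assumes "\<And>i. has_bochner_integral F (a1 i) 0" "\<And>i j. has_bochner_integral F (a2 i j) 0"
    "\<And>i j h. has_bochner_integral F (a3 i j h) 0" "\<And>i j h r. has_bochner_integral F (a4 i j h r) 0"
  shows "has_bochner_integral F (\<lambda>z. lin_part \<alpha> \<gamma> \<kappa> k l (\<lambda>i. a1 i z) (\<lambda>i j. a2 i j z) (\<lambda>i j h. a3 i j h z)
    (\<lambda>i j h r. a4 i j h r z)) 0"
  using assms by (cases "k = l") (simp_all add: lin_part_def has_bochner_integral_iff)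

definition influence :: "real \<Rightarrow> ('n::finite \<Rightarrow> real) \<Rightarrow> ('n \<Rightarrow> real) \<Rightarrow> real^'n \<Rightarrow> real^('n \<times> 'n)" where
  "influence \<alpha> \<gamma> \<kappa> z = (\<chi> kl. lin_part \<alpha> \<gamma> \<kappa> (fst kl) (snd kl) (\<lambda>i. z $ i) (\<lambda>i j. z $ i * z $ j - mom2 i j)
    (\<lambda>i j h. z $ i * (z $ j * z $ h) - mom3 \<gamma> i j h)
    (\<lambda>i j h r. z $ i * (z $ j * (z $ h * z $ r)) - mom4 \<kappa> i j h r))"

lemma influence_measurable: "influence \<alpha> \<gamma> \<kappa> \<in> borel_measurable borel"
  unfolding influence_def lin_part_def by (intro borel_measurable_vec_lambda) measurable

lemma influence_diagonal: "influence \<alpha> \<gamma> \<kappa> z $ (k, k) = (1 - (z $ k)\<^sup>2) / 2"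
  by (simp add: influence_def lin_part_def mom2_def power2_eq_square field_simps)

text \<open>Origin of the constants in \<open>kurt_stat\<close>: the coefficient \<kappa>_k + p + 4
  is split as (\<kappa>_k + 6) + (p - 2). The first part joins the polynomial at k, the second
  centres the squares of the remaining p - 2 coordinates.\<close>

lemma influence_off_diagonal:
  fixes F :: "(real^'n) measure"
  assumes kl: "k \<noteq> l"
  shows "influence \<alpha> (gam F) (kap F) z $ (k, l) =
    (\<alpha> * (gam F k - gam F l) * skew_stat F k l z + (1 - \<alpha>) * (kap F k - kap F l) * kurt_stat F k l z)
    / (\<alpha> * (gam F k - gam F l)\<^sup>2 + (1 - \<alpha>) * (kap F k - kap F l)\<^sup>2)"
proof -
  have split: "(\<Sum>j\<in>UNIV. f j) = f k + f l + (\<Sum>j\<in>UNIV - {k, l}. f j)" for f :: "'n \<Rightarrow> real"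
    using sum.subset_diff[of "{k, l}" UNIV f] kl by simp
  have card: "real (card (UNIV - {k, l})) = real CARD('n) - 2"
  proof -
    have "card {k, l} \<le> CARD('n)" by (rule card_mono) auto
    then show ?thesis using kl by (simp add: card_Diff_subset of_nat_diff)
  qed
  have m: "mom2 k l = 0" "mom3 (gam F) j k l = 0" "mom4 (kap F) j j k l = 0" for j
    using kl by (auto simp: mom2_def mom3_def mom4_def)
  have S: "(\<Sum>j\<in>UNIV. z $ j * (z $ k * z $ l)) - z $ k - z $ l - gam F k * (z $ k * z $ l) = skew_stat F k l z"
    unfolding split skew_stat_def bistat_def by (simp add: sum_distrib_left[symmetric] sum_distrib_right[symmetric] algebra_simps)
  have T: "(\<Sum>j\<in>UNIV. z $ j * (z $ j * (z $ k * z $ l))) - gam F l * z $ k - gam F k * z $ l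
      - (kap F k + real CARD('n) + 4) * (z $ k * z $ l) = kurt_stat F k l z"
  proof -
    have s1: "(\<Sum>j\<in>UNIV - {k, l}. z $ j * (z $ j * (z $ k * z $ l))) = (\<Sum>j\<in>UNIV - {k, l}. z $ j * z $ j) * (z $ k * z $ l)"
      by (simp add: sum_distrib_right mult.assoc)
    have s2: "(\<Sum>m\<in>UNIV - {k, l}. poly [:-1, 0, 1, 0:] (z $ m)) = (\<Sum>j\<in>UNIV - {k, l}. z $ j * z $ j) - (real CARD('n) - 2)"
      by (simp add: sum.distrib sum_subtractf card)
    show ?thesis
      unfolding split kurt_stat_def bistat_def s1 s2 by (simp add: algebra_simps)
  qed
  show ?thesis
    using kl unfolding influence_def vec_lambda_beta fst_conv snd_conv lin_part_def m diff_0_right S T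
    by (simp add: mult.assoc)
qed

lemma influence_mean:
  fixes F :: "(real^'n) measure"
  assumes F: "independent_standardized F" and fm: "finite_moments 6 F"
  shows "has_bochner_integral F (\<lambda>z. influence \<alpha> (gam F) (kap F) z $ kl) 0"
proof -
  note Fp = independent_standardizedD(1,2)[OF F]
  interpret prob_space F by (rule Fp)
  have hb: "has_bochner_integral F (\<lambda>z. monomial is z - c) 0"
    if "length is \<le> 6" "integral\<^sup>L F (monomial is) = c" for "is" c
    using integrable_monomial[OF F fm that(1)] that(2) by (simp add: has_bochner_integral_iff prob_space)
  have fm': "finite_moments m F" if "m \<le> 6" for m by (rule finite_moments_mono[OF Fp fm that])
  have 1: "has_bochner_integral F (\<lambda>z. z $ i) 0" for i
    using hb[of "[i]" 0] independent_standardizedD(4)[OF F] by (simp add: monomial_def[abs_def])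
  have 2: "has_bochner_integral F (\<lambda>z. z $ i * z $ j - mom2 i j) 0" for i j
    using hb[of "[i, j]" "mom2 i j"] population_moments(1)[OF F fm', of i j] by (simp add: monomial_def[abs_def])
  have 3: "has_bochner_integral F (\<lambda>z. z $ i * (z $ j * z $ h) - mom3 (gam F) i j h) 0" for i j h
    using hb[of "[i, j, h]" "mom3 (gam F) i j h"] population_moments(2)[OF F fm', of i j h] by (simp add: monomial_def[abs_def])
  have 4: "has_bochner_integral F (\<lambda>z. z $ i * (z $ j * (z $ h * z $ r)) - mom4 (kap F) i j h r) 0" for i j h r
    using hb[of "[i, j, h, r]" "mom4 (kap F) i j h r"] population_moments(3)[OF F fm', of i j h r] by (simp add: monomial_def[abs_def])
  show ?thesis unfolding influence_def vec_lambda_beta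
    by (rule has_bochner_integral_lin_part[OF 1 2 3 4])
qed

text \<open>Six moments suffice even though products of four coordinates enter: for k \<noteq> l
  these products contain each variable at most to the third power.\<close>

lemma influence_variance:
  fixes F :: "(real^'n) measure"
  assumes F: "independent_standardized F" and fm: "finite_moments 6 F"
  shows "has_bochner_integral F (\<lambda>z. (influence \<alpha> (gam F) (kap F) z $ (k, k))\<^sup>2) ((kap F k + 2) / 4)"
    and "k \<noteq> l \<Longrightarrow> has_bochner_integral F (\<lambda>z. (influence \<alpha> (gam F) (kap F) z $ (k, l))\<^sup>2)
      ((\<alpha>\<^sup>2 * (gam F k - gam F l)\<^sup>2 * zeta11 F k l
                + (1 - \<alpha>)\<^sup>2 * (kap F k - kap F l)\<^sup>2 * zeta22 F k l
                + 2 * \<alpha> * (1 - \<alpha>) * (gam F k - gam F l) * (kap F k - kap F l) * zeta12 F k l)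
               / (\<alpha> * (gam F k - gam F l)\<^sup>2 + (1 - \<alpha>) * (kap F k - kap F l)\<^sup>2)\<^sup>2)"
proof -
  note Fp = independent_standardizedD(1,2)[OF F]
  interpret prob_space F by (rule Fp)
  have i4: "integrable F (\<lambda>z. (z $ k) ^ 4)" and i2: "integrable F (\<lambda>z. (z $ k)\<^sup>2)"
    by (rule finite_moments_power[OF Fp fm]; simp)+
  have "((1 - t\<^sup>2) / 2)\<^sup>2 = 1 / 4 - t\<^sup>2 / 2 + t ^ 4 / 4" for t :: real
    by (simp add: power2_eq_square eval_nat_numeral field_simps)
  then show "has_bochner_integral F (\<lambda>z. (influence \<alpha> (gam F) (kap F) z $ (k, k))\<^sup>2) ((kap F k + 2) / 4)"
    unfolding influence_diagonal using i2 i4 independent_standardizedD(5)[OF F, of k]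
    by (simp add: has_bochner_integral_iff kap_def bet_def moment_def prob_space)
next
  assume kl: "k \<noteq> l"
  define a where "a = \<alpha> * (gam F k - gam F l)"
  define b where "b = (1 - \<alpha>) * (kap F k - kap F l)"
  define D where "D = \<alpha> * (gam F k - gam F l)\<^sup>2 + (1 - \<alpha>) * (kap F k - kap F l)\<^sup>2"
  note C = stat_covariances[OF F fm kl]
  have "has_bochner_integral F (\<lambda>z. (a\<^sup>2 / D\<^sup>2) * (skew_stat F k l z * skew_stat F k l z)
      + (b\<^sup>2 / D\<^sup>2) * (kurt_stat F k l z * kurt_stat F k l z)
      + (2 * a * b / D\<^sup>2) * (skew_stat F k l z * kurt_stat F k l z))
     ((a\<^sup>2 / D\<^sup>2) * zeta11 F k l + (b\<^sup>2 / D\<^sup>2) * zeta22 F k l + (2 * a * b / D\<^sup>2) * zeta12 F k l)"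
    by (intro has_bochner_integral_add has_bochner_integral_mult_right C)
  moreover have "(a\<^sup>2 / D\<^sup>2) * (s * s) + (b\<^sup>2 / D\<^sup>2) * (t * t) + (2 * a * b / D\<^sup>2) * (s * t) = ((a * s + b * t) / D)\<^sup>2" for s t
    by (simp add: power_divide power2_eq_square add_divide_distrib[symmetric]) (simp add: algebra_simps)
  moreover have "(a\<^sup>2 / D\<^sup>2) * x + (b\<^sup>2 / D\<^sup>2) * y + (2 * a * b / D\<^sup>2) * w =
      (\<alpha>\<^sup>2 * (gam F k - gam F l)\<^sup>2 * x + (1 - \<alpha>)\<^sup>2 * (kap F k - kap F l)\<^sup>2 * y
        + 2 * \<alpha> * (1 - \<alpha>) * (gam F k - gam F l) * (kap F k - kap F l) * w) / D\<^sup>2" for x y w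
  proof -
    have 1: "a\<^sup>2 = \<alpha>\<^sup>2 * (gam F k - gam F l)\<^sup>2" "b\<^sup>2 = (1 - \<alpha>)\<^sup>2 * (kap F k - kap F l)\<^sup>2"
      "2 * a * b = 2 * \<alpha> * (1 - \<alpha>) * (gam F k - gam F l) * (kap F k - kap F l)"
      by (simp_all only: a_def b_def power_mult_distrib mult_ac)
    show ?thesis unfolding 1 by (simp only: times_divide_eq_left add_divide_distrib)
  qed
  ultimately show "has_bochner_integral F (\<lambda>z. (influence \<alpha> (gam F) (kap F) z $ (k, l))\<^sup>2)
      ((\<alpha>\<^sup>2 * (gam F k - gam F l)\<^sup>2 * zeta11 F k l
                + (1 - \<alpha>)\<^sup>2 * (kap F k - kap F l)\<^sup>2 * zeta22 F k l
                + 2 * \<alpha> * (1 - \<alpha>) * (gam F k - gam F l) * (kap F k - kap F l) * zeta12 F k l)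
               / (\<alpha> * (gam F k - gam F l)\<^sup>2 + (1 - \<alpha>) * (kap F k - kap F l)\<^sup>2)\<^sup>2)"
    unfolding influence_off_diagonal[OF kl] a_def[symmetric] b_def[symmetric] D_def[symmetric] by (simp only:)
qed

lemma avg_deviation:
  assumes "n > 0"
  shows "(avg n f - c) / (1 / sqrt (real n)) = (\<Sum>h<n. f h - c) / sqrt (real n)"
proof -
  have "(\<Sum>h<n. f h - c) = real n * (avg n f - c)"
    using assms by (simp add: avg_def sum_subtractf right_diff_distrib)
  also have "real n = sqrt (real n) * sqrt (real n)" by simp
  finally show ?thesis using assms by (simp add: field_simps)
qed

section \<open>The limiting distribution\<close>

text \<open>Chebyshev's inequality for each member of a finite family. The bound for normalized sums
  is free of n, hence so is K.\<close>

lemma iid_deviations_bounded: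
  fixes Z :: "nat \<Rightarrow> 'w \<Rightarrow> real^'n" and f :: "'i \<Rightarrow> real^'n \<Rightarrow> real"
  assumes M: "prob_space M" and indep: "prob_space.indep_vars M (\<lambda>_. borel) Z UNIV"
    and law: "\<And>i. distr M borel (Z i) = F"
    and I: "finite I" and f: "\<And>i. i \<in> I \<Longrightarrow> f i \<in> borel_measurable borel"
    and sq: "\<And>i. i \<in> I \<Longrightarrow> integrable F (\<lambda>z. (f i z)\<^sup>2)" and \<eta>: "\<eta> > 0"
  shows "\<exists>K. \<forall>n>0. (\<Sum>i\<in>I. measure M {\<omega> \<in> space M.
    \<bar>(\<Sum>h<n. f i (Z h \<omega>) - (\<integral>z. f i z \<partial>F)) / sqrt (real n)\<bar> \<ge> K}) \<le> \<eta>"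
proof -
  interpret M: prob_space M by fact
  have Z[measurable]: "Z i \<in> borel_measurable M" for i using indep by (auto simp: M.indep_vars_def)
  have setsF[measurable_cong]: "sets F = sets borel" using law[of 0] by auto
  interpret F: prob_space F using M.prob_space_distr[of "Z 0" borel] law[of 0] by simp
  define X where "X i h \<omega> = f i (Z h \<omega>) - (\<integral>z. f i z \<partial>F)" for i h \<omega>
  define v where "v i = (\<integral>z. (f i z - (\<integral>z. f i z \<partial>F))\<^sup>2 \<partial>F)" for i
  have v0: "v i \<ge> 0" for i unfolding v_def by (rule Bochner_Integration.integral_nonneg) simp
  define w where "w = (\<Sum>i\<in>I. v i)"
  have w0: "w \<ge> 0" unfolding w_def by (intro sum_nonneg v0)
  \<comment> \<open>Large enough for w / K^2 \<le> \<eta>, with 1 added so that K is positive even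
    if all variances are 0.\<close>
  define K where "K = sqrt (w / \<eta>) + 1"
  have K: "K > 0" using w0 \<eta> by (simp add: K_def add_nonneg_pos)
  have wK: "w / K\<^sup>2 \<le> \<eta>"
  proof -
    have "w / \<eta> = (sqrt (w / \<eta>))\<^sup>2" using w0 \<eta> by simp
    also have "\<dots> \<le> K\<^sup>2" unfolding K_def using w0 \<eta> by (intro power_mono) auto
    finally show ?thesis using \<eta> K by (simp add: field_simps)
  qed
  have tail: "measure M {\<omega> \<in> space M. \<bar>(\<Sum>h<n. X i h \<omega>) / sqrt (real n)\<bar> \<ge> K} \<le> v i / K\<^sup>2"
    if i: "i \<in> I" and n: "n > 0" for i n
  proof (rule M.iid_sum_tail[OF _ _ _ _ K n])
    note [measurable] = f[OF i]
    have int: "integrable F (f i)" by (rule F.square_integrable_imp_integrable[OF _ sq[OF i]]) measurable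
    have int2: "integrable F (\<lambda>z. (f i z - (\<integral>z. f i z \<partial>F))\<^sup>2)"
      using sq[OF i] int by (simp add: power2_diff)
    show "M.indep_vars (\<lambda>_. borel) (X i) UNIV"
      unfolding X_def by (rule M.indep_vars_compose2[OF indep]) measurable
    show "integrable M (\<lambda>\<omega>. (X i h \<omega>)\<^sup>2)" for h
      using int2 unfolding law[of h, symmetric] X_def by (subst (asm) integrable_distr_eq) auto
    have "M.expectation (X i h) = (\<integral>z. f i z - (\<integral>z. f i z \<partial>F) \<partial>F)" for h
      unfolding X_def by (subst (2) law[of h, symmetric], subst integral_distr) auto
    then show "M.expectation (X i h) = 0" for h using int by (simp add: F.prob_space)
    show "M.expectation (\<lambda>\<omega>. (X i h \<omega>)\<^sup>2) = v i" for h
      unfolding X_def v_def by (subst (2) law[of h, symmetric], subst integral_distr) auto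
  qed
  have "(\<Sum>i\<in>I. measure M {\<omega> \<in> space M. \<bar>(\<Sum>h<n. X i h \<omega>) / sqrt (real n)\<bar> \<ge> K}) \<le> \<eta>" if "n > 0" for n
  proof -
    have "(\<Sum>i\<in>I. measure M {\<omega> \<in> space M. \<bar>(\<Sum>h<n. X i h \<omega>) / sqrt (real n)\<bar> \<ge> K}) \<le> (\<Sum>i\<in>I. v i / K\<^sup>2)"
      using that by (intro sum_mono tail)
    also have "\<dots> = w / K\<^sup>2" by (simp add: w_def sum_divide_distrib)
    finally show ?thesis using wK by linarith
  qed
  then show ?thesis unfolding X_def by blast
qed

text \<open>One event on which V whitens and all scaled deviations are bounded. It excludes three
  exceptional sets of probability about \<eta> / 3 each: failure of the sample version, large V - I,
  and large sample moments. Order 2 d is needed because the squares of monomials of degree d must be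
  integrable.\<close>

lemma good_events:
  fixes Z :: "nat \<Rightarrow> 'w \<Rightarrow> real^'n"
  assumes F: "independent_standardized F" and M: "prob_space M"
    and indep: "prob_space.indep_vars M (\<lambda>_. borel) Z UNIV" and law: "\<And>i. distr M borel (Z i) = F"
    and \<Gamma>: "ic_functional D \<Gamma>" and V: "sample_version M Z D \<Gamma> V"
    and V_root_n: "bounded_in_probability M (\<lambda>n \<omega>. sqrt (real n) *\<^sub>R (V n \<omega> - mat 1))"
    and fm: "finite_moments (2 * d) F" and \<eta>: "\<eta> > 0"
  obtains G K K' where "\<And>n. G n \<in> sets M" "\<forall>\<^sub>F n in sequentially. measure M (G n) \<ge> 1 - \<eta>"
    "\<And>n \<omega>. \<omega> \<in> G n \<Longrightarrow> V n \<omega> ** covariance_matrix (empirical n (\<lambda>i. Z i \<omega>)) ** transpose (V n \<omega>) = mat 1"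
    "\<And>n \<omega>. \<omega> \<in> G n \<Longrightarrow> norm (sqrt (real n) *\<^sub>R (V n \<omega> - mat 1)) \<le> K"
    "\<And>n \<omega> is. \<omega> \<in> G n \<Longrightarrow> length is \<le> d \<Longrightarrow>
      \<bar>(\<Sum>h<n. monomial is (Z h \<omega>) - (\<integral>z. monomial is z \<partial>F)) / sqrt (real n)\<bar> \<le> K'"
proof -
  interpret M: prob_space M by fact
  have Z[measurable]: "Z i \<in> borel_measurable M" for i using indep by (auto simp: M.indep_vars_def)
  have V_meas[measurable]: "V n \<in> borel_measurable M" for n using V by (auto simp: sample_version_def)
  define I where "I = {is :: 'n list. length is \<le> d}"
  have I: "finite I"
    unfolding I_def using finite_lists_length_le[of "UNIV :: 'n set" d] by simp
  have mono_meas[measurable]: "monomial is \<in> borel_measurable borel" for "is" :: "'n list"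
    unfolding monomial_eq_prod[abs_def] by measurable
  have mono_sq: "integrable F (\<lambda>z. (monomial is z)\<^sup>2)" if "is \<in> I" for "is"
  proof -
    have "monomial (is @ is) = (\<lambda>z :: real^'n. (monomial is z)\<^sup>2)"
      by (simp add: fun_eq_iff monomial_def power2_eq_square)
    moreover have "integrable F (monomial (is @ is))"
      by (rule integrable_monomial[OF F fm]) (use that in \<open>simp add: I_def\<close>)
    ultimately show ?thesis by simp
  qed
  obtain E where E: "\<And>n. E n \<in> sets M" "(\<lambda>n. measure M (E n)) \<longlonglongrightarrow> 1"
      "\<And>n \<omega>. \<omega> \<in> E n \<Longrightarrow> empirical n (\<lambda>i. Z i \<omega>) \<in> D \<and> row_equivalent (\<Gamma> (empirical n (\<lambda>i. Z i \<omega>))) (V n \<omega>)"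
    using V unfolding sample_version_def with_probability_tending_to_one_def by blast
  have whiten: "V n \<omega> ** covariance_matrix (empirical n (\<lambda>i. Z i \<omega>)) ** transpose (V n \<omega>) = mat 1" if \<omega>: "\<omega> \<in> E n" for n \<omega>
  proof -
    obtain U S where US: "orthogonal_matrix U" "is_inverse_sqrt S (covariance_matrix (empirical n (\<lambda>i. Z i \<omega>)))"
        "\<Gamma> (empirical n (\<lambda>i. Z i \<omega>)) = U ** S"
      using \<Gamma> E(3)[OF \<omega>] unfolding ic_functional_def by blast
    show ?thesis
      by (rule row_equivalent_whitening[OF _ US(1,2)]) (use E(3)[OF \<omega>] US(3) in simp)
  qed
  have \<eta>3: "\<eta> / 3 > 0" using \<eta> by simp
  obtain K where K: "\<forall>\<^sub>F n in sequentially. measure M {\<omega> \<in> space M. norm (sqrt (real n) *\<^sub>R (V n \<omega> - mat 1)) > K} \<le> \<eta> / 3"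
    using V_root_n \<eta>3 unfolding bounded_in_probability_def by blast
  obtain K' where K': "\<And>n. n > 0 \<Longrightarrow> (\<Sum>is\<in>I. measure M {\<omega> \<in> space M.
    \<bar>(\<Sum>h<n. monomial is (Z h \<omega>) - (\<integral>z. monomial is z \<partial>F)) / sqrt (real n)\<bar> \<ge> K'}) \<le> \<eta> / 3"
    using iid_deviations_bounded[where f = monomial, OF M indep law I mono_meas mono_sq \<eta>3] by blast
  define T where "T n is = {\<omega> \<in> space M. \<bar>(\<Sum>h<n. monomial is (Z h \<omega>) - (\<integral>z. monomial is z \<partial>F)) / sqrt (real n)\<bar> \<ge> K'}" for n "is"
  have T[measurable]: "T n is \<in> sets M" for n "is"
    unfolding T_def by measurable
  define B where "B n = {\<omega> \<in> space M. norm (sqrt (real n) *\<^sub>R (V n \<omega> - mat 1)) > K}" for n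
  have B[measurable]: "B n \<in> sets M" for n unfolding B_def by measurable
  define G where "G n = E n - (B n \<union> (\<Union>is\<in>I. T n is))" for n
  have U: "(\<Union>is\<in>I. T n is) \<in> sets M" for n using I T by (intro sets.finite_UN) auto
  have G: "G n \<in> sets M" for n unfolding G_def using E(1) B U by auto
  have "\<forall>\<^sub>F n in sequentially. measure M (E n) > 1 - \<eta> / 3"
    by (rule order_tendstoD(1)[OF E(2)]) (use \<eta> in simp)
  then have "\<forall>\<^sub>F n in sequentially. measure M (G n) \<ge> 1 - \<eta>"
    using K eventually_gt_at_top[of 0]
  proof eventually_elim
    case (elim n)
    have "measure M (E n) \<le> measure M (G n \<union> (B n \<union> (\<Union>is\<in>I. T n is)))"
      by (rule M.finite_measure_mono[OF _ sets.Un[OF G sets.Un[OF B U]]]) (auto simp: G_def)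
    also have "\<dots> \<le> measure M (G n) + measure M (B n \<union> (\<Union>is\<in>I. T n is))"
      using G B U by (intro measure_Un_le) auto
    also have "measure M (B n \<union> (\<Union>is\<in>I. T n is)) \<le> measure M (B n) + measure M (\<Union>is\<in>I. T n is)"
      using B U by (intro measure_Un_le) auto
    also have "measure M (\<Union>is\<in>I. T n is) \<le> (\<Sum>is\<in>I. measure M (T n is))"
      using T I by (intro M.finite_measure_subadditive_finite) auto
    finally have "measure M (E n) \<le> measure M (G n) + (measure M (B n) + (\<Sum>is\<in>I. measure M (T n is)))" by simp
    moreover have "(\<Sum>is\<in>I. measure M (T n is)) \<le> \<eta> / 3" using K'[OF elim(3)] by (simp only: T_def)
    moreover have "measure M (B n) \<le> \<eta> / 3" using elim(2) by (simp only: B_def)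
    ultimately show ?case using elim(1) by linarith
  qed
  moreover have "norm (sqrt (real n) *\<^sub>R (V n \<omega> - mat 1)) \<le> K" if "\<omega> \<in> G n" for n \<omega>
    using that sets.sets_into_space[OF E(1)[of n]] by (auto simp: G_def B_def not_less)
  moreover have "\<bar>(\<Sum>h<n. monomial is (Z h \<omega>) - (\<integral>z. monomial is z \<partial>F)) / sqrt (real n)\<bar> \<le> K'"
    if \<omega>: "\<omega> \<in> G n" and len: "length is \<le> d" for n \<omega> "is"
  proof -
    have "\<omega> \<in> space M" "\<omega> \<notin> T n is"
      using \<omega> len sets.sets_into_space[OF E(1)[of n]] by (auto simp: G_def I_def)
    then show ?thesis unfolding T_def by (auto simp: not_le simp del: abs_divide)
  qed
  moreover have "V n \<omega> ** covariance_matrix (empirical n (\<lambda>i. Z i \<omega>)) ** transpose (V n \<omega>) = mat 1"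
    if "\<omega> \<in> G n" for n \<omega> using whiten that by (simp add: G_def)
  ultimately show ?thesis using that G by blast
qed

lemma is_arg_max_iff: "is_arg_max f P x \<longleftrightarrow> P x \<and> (\<forall>y. P y \<longrightarrow> f y \<le> (f x :: real))"
  by (auto simp: is_arg_max_def not_less)

text \<open>All three parts at once: the choice of \<alpha> affects only the separation condition
  and how many moments are required.\<close>

lemma compound_cumulant_limit:
  fixes M :: "'w measure" and F :: "(real^'n) measure" and Z :: "nat \<Rightarrow> 'w \<Rightarrow> real^'n"
  assumes F: "independent_standardized F" and M: "prob_space M"
    and indep: "prob_space.indep_vars M (\<lambda>_. borel) Z UNIV" and law: "\<And>i. distr M borel (Z i) = F"
    and \<Gamma>: "ic_functional D \<Gamma>" and V: "sample_version M Z D \<Gamma> V"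
    and V_root_n: "bounded_in_probability M (\<lambda>n \<omega>. sqrt (real n) *\<^sub>R (V n \<omega> - mat 1))"
    and \<alpha>: "0 \<le> \<alpha>" "\<alpha> \<le> 1" and fm6: "finite_moments 6 F" and fm8: "\<alpha> \<noteq> 1 \<Longrightarrow> finite_moments 8 F"
    and sep: "\<And>k l. k \<noteq> l \<Longrightarrow> \<alpha> * (gam F k - gam F l)\<^sup>2 + (1 - \<alpha>) * (kap F k - kap F l)\<^sup>2 \<noteq> 0"
  shows "\<exists>W. compound_cumulant_sequence M Z V \<alpha> W \<and> converges_in_probability M W (mat 1) \<and>
        (\<exists>L. limiting_normal M W L \<and>
          (\<forall>k. ASV L k k = (kap F k + 2) / 4) \<and>
          (\<forall>k l. k \<noteq> l \<longrightarrow>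
             ASV L k l =
               (\<alpha>\<^sup>2 * (gam F k - gam F l)\<^sup>2 * zeta11 F k l
                + (1 - \<alpha>)\<^sup>2 * (kap F k - kap F l)\<^sup>2 * zeta22 F k l
                + 2 * \<alpha> * (1 - \<alpha>) * (gam F k - gam F l) * (kap F k - kap F l) * zeta12 F k l)
               / (\<alpha> * (gam F k - gam F l)\<^sup>2 + (1 - \<alpha>) * (kap F k - kap F l)\<^sup>2)\<^sup>2))"
proof -
  interpret M: prob_space M by fact
  note Fp = independent_standardizedD(1,2)[OF F]
  have Z[measurable]: "Z i \<in> borel_measurable M" for i using indep by (auto simp: M.indep_vars_def)
  have V_meas[measurable]: "V n \<in> borel_measurable M" for n using V by (auto simp: sample_version_def)
  define obj where "obj n \<omega> = compound_objective \<alpha> (C3 (standardized_empirical n (\<lambda>i. Z i \<omega>) (V n \<omega>)))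
      (C4 (standardized_empirical n (\<lambda>i. Z i \<omega>) (V n \<omega>)))" for n \<omega>
  have obj_meas: "(\<lambda>\<omega>. obj n \<omega> Q) \<in> borel_measurable M" for n Q
    unfolding obj_def compound_objective_eq conj_matrix_component C3_empirical C4_empirical avg_def
      standardized_def raw1_def by measurable
  have obj_cont: "continuous_on UNIV (obj n \<omega>)" for n \<omega>
    unfolding obj_def by (rule continuous_on_compound_objective)
  define OM where "OM = {Q :: real^'n^'n. orthogonal_matrix Q}"
  have OM: "compact OM" unfolding OM_def by (rule compact_orthogonal_matrix)
  have C: "compact (OM \<inter> cball (mat 1) (1/2))" "OM \<inter> cball (mat 1) (1/2) \<noteq> {}"
    using OM orthogonal_matrix_id by (auto simp: OM_def intro!: compact_Int exI[of _ "mat 1"])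
  \<comment> \<open>A maximizer exists for every sample, degenerate ones included, so that
    \<open>U n\<close> solves the problem on the whole space; the preference for the ball around I
    is what makes it consistent.\<close>
  define selects where "selects n g \<longleftrightarrow> g \<in> borel_measurable M \<and>
      (\<forall>\<omega>\<in>space M. g \<omega> \<in> OM \<and> (\<forall>Q\<in>OM. obj n \<omega> Q \<le> obj n \<omega> (g \<omega>))) \<and>
      (\<forall>\<omega>\<in>space M. \<forall>Q\<in>OM \<inter> cball (mat 1) (1/2). (\<forall>R\<in>OM. obj n \<omega> R \<le> obj n \<omega> Q) \<longrightarrow> g \<omega> \<in> OM \<inter> cball (mat 1) (1/2))"
    for n g
  have "\<exists>g. selects n g" for n
    by (rule measurable_argmax_preferring[where f = "obj n", OF OM C Int_lower1 obj_meas obj_cont])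
      (unfold selects_def, blast)
  then obtain U where "\<And>n. selects n (U n)" by metis
  note U = this[unfolded selects_def]
  have U_meas[measurable]: "U n \<in> borel_measurable M" for n using U by blast
  have U_max: "is_arg_max (obj n \<omega>) orthogonal_matrix (U n \<omega>)" if "\<omega> \<in> space M" for n \<omega>
    using U[of n] that unfolding is_arg_max_iff OM_def by auto
  have U_near: "norm (U n \<omega> - mat 1) \<le> 1/2" if "\<omega> \<in> space M" "is_arg_max (obj n \<omega>) orthogonal_matrix Q" "norm (Q - mat 1) \<le> 1/2" for n \<omega> Q
  proof -
    have "Q \<in> OM \<inter> cball (mat 1) (1/2)" "\<forall>R\<in>OM. obj n \<omega> R \<le> obj n \<omega> Q"
      using that(2,3) unfolding is_arg_max_iff OM_def by (auto simp: dist_norm norm_minus_commute)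
    then have "U n \<omega> \<in> OM \<inter> cball (mat 1) (1/2)" using U[of n] that(1) by blast
    then show ?thesis by (simp add: dist_norm norm_minus_commute)
  qed
  define W where "W n \<omega> = U n \<omega> ** V n \<omega>" for n \<omega>
  have W_meas[measurable]: "W n \<in> borel_measurable M" for n
    unfolding W_def matrix_matrix_mult_def by (intro borel_measurable_vec_lambda) measurable
  have seq: "compound_cumulant_sequence M Z V \<alpha> W"
    unfolding compound_cumulant_sequence_def compound_cumulant_solution_def
    using U_max W_meas by (auto simp: W_def obj_def)
  define Y where "Y = influence \<alpha> (gam F) (kap F)"
  have Y_meas[measurable]: "Y \<in> borel_measurable borel" unfolding Y_def by (rule influence_measurable)
  define X where "X n \<omega> = sqrt (real n) *\<^sub>R vectorize (W n \<omega> - mat 1)" for n \<omega>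
  have X_meas[measurable]: "X n \<in> borel_measurable M" for n
    unfolding X_def vectorize_def by (intro borel_measurable_scaleR borel_measurable_const borel_measurable_vec_lambda) measurable
  define R where "R n \<omega> = X n \<omega> - (1 / sqrt (real n)) *\<^sub>R (\<Sum>i<n. Y (Z i \<omega>))" for n \<omega>
  have R_meas[measurable]: "R n \<in> borel_measurable M" for n unfolding R_def by measurable
  \<comment> \<open>The order up to which sample moments must deviate by O(n^(-1/2)): 3 for pure
    skewness, otherwise 4. The required population moments are those of order 2 d.\<close>
  define d :: nat where "d = (if \<alpha> = 1 then 3 else 4)"
  have fm: "finite_moments (2 * d) F" using fm6 fm8 by (auto simp: d_def)
  have fm': "finite_moments m F" if "m \<le> 6" for m by (rule finite_moments_mono[OF Fp fm6 that])
  have main: "\<exists>G. (\<forall>n. G n \<in> sets M) \<and> (\<forall>\<^sub>F n in sequentially. measure M (G n) \<ge> 1 - \<eta>) \<and>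
      ((\<lambda>p. W (fst p) (snd p)) \<longlongrightarrow> mat 1) (event_filter G) \<and> ((\<lambda>p. R (fst p) (snd p)) \<longlongrightarrow> 0) (event_filter G)"
    if \<eta>: "\<eta> > 0" for \<eta>
  proof -
    obtain G K K' where G: "\<And>n. G n \<in> sets M" "\<forall>\<^sub>F n in sequentially. measure M (G n) \<ge> 1 - \<eta>"
      and whiten: "\<And>n \<omega>. \<omega> \<in> G n \<Longrightarrow> V n \<omega> ** covariance_matrix (empirical n (\<lambda>i. Z i \<omega>)) ** transpose (V n \<omega>) = mat 1"
      and VK: "\<And>n \<omega>. \<omega> \<in> G n \<Longrightarrow> norm (sqrt (real n) *\<^sub>R (V n \<omega> - mat 1)) \<le> K"
      and mK: "\<And>n \<omega> is. \<omega> \<in> G n \<Longrightarrow> length is \<le> d \<Longrightarrow>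
        \<bar>(\<Sum>h<n. monomial is (Z h \<omega>) - (\<integral>z. monomial is z \<partial>F)) / sqrt (real n)\<bar> \<le> K'"
      using good_events[OF F M indep law \<Gamma> V V_root_n fm \<eta>] by metis
    have space: "\<omega> \<in> space M" if "\<omega> \<in> G n" for n \<omega> using G(1) that sets.sets_into_space by blast
    have pos: "\<forall>\<^sub>F p in event_filter G. fst p > 0"
      unfolding eventually_event_filter using eventually_gt_at_top[of 0] by eventually_elim simp
    have dev: "Bfun (\<lambda>p. (avg (fst p) (\<lambda>h. monomial is (Z h (snd p))) - c) / (1 / sqrt (real (fst p)))) (event_filter G)"
      if "length is \<le> d" "(\<integral>z. monomial is z \<partial>F) = c" for "is" c
    proof -
      have "\<forall>\<^sub>F p in event_filter G. \<bar>(avg (fst p) (\<lambda>h. monomial is (Z h (snd p))) - c) / (1 / sqrt (real (fst p)))\<bar> \<le> K'"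
        unfolding eventually_event_filter using eventually_gt_at_top[of 0]
      proof eventually_elim
        case (elim n)
        show ?case using mK[of _ n "is"] that elim by (simp only: fst_conv snd_conv avg_deviation) auto
      qed
      then show ?thesis unfolding Bfun_real_iff by blast
    qed
    have m1: "Bfun (\<lambda>p. raw1 (fst p) (\<lambda>i. Z i (snd p)) i / (1 / sqrt (real (fst p)))) (event_filter G)" for i
      using dev[of "[i]" 0] independent_standardizedD(4)[OF F, of i]
      by (simp add: monomial_def raw1_def d_def)
    have m2: "Bfun (\<lambda>p. (raw2 (fst p) (\<lambda>i. Z i (snd p)) i j - mom2 i j) / (1 / sqrt (real (fst p)))) (event_filter G)" for i j
      using dev[of "[i, j]" "mom2 i j"] population_moments(1)[OF F fm', of i j]
      by (simp add: monomial_def raw2_def d_def)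
    have m3: "Bfun (\<lambda>p. (raw3 (fst p) (\<lambda>i. Z i (snd p)) i j h - mom3 (gam F) i j h) / (1 / sqrt (real (fst p)))) (event_filter G)" for i j h
      using dev[of "[i, j, h]" "mom3 (gam F) i j h"] population_moments(2)[OF F fm', of i j h]
      by (simp add: monomial_def raw3_def d_def)
    have m4: "Bfun (\<lambda>p. (raw4 (fst p) (\<lambda>i. Z i (snd p)) i j h r - mom4 (kap F) i j h r) / (1 / sqrt (real (fst p)))) (event_filter G)"
      if "\<alpha> \<noteq> 1" for i j h r
      using dev[of "[i, j, h, r]" "mom4 (kap F) i j h r"] population_moments(3)[OF F fm', of i j h r] that
      by (simp add: monomial_def raw4_def d_def)
    have V': "Bfun (\<lambda>p. (V (fst p) (snd p) $ i $ j - (if i = j then 1 else 0)) / (1 / sqrt (real (fst p)))) (event_filter G)" for i j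
    proof -
      have "\<bar>(V n \<omega> $ i $ j - (if i = j then 1 else 0)) / (1 / sqrt (real n))\<bar> \<le> K" if "\<omega> \<in> G n" for n \<omega>
      proof -
        have "(V n \<omega> $ i $ j - (if i = j then 1 else 0)) / (1 / sqrt (real n)) = (sqrt (real n) *\<^sub>R (V n \<omega> - mat 1)) $ i $ j"
          by (simp add: mat_def)
        moreover have "\<bar>(sqrt (real n) *\<^sub>R (V n \<omega> - mat 1)) $ i $ j\<bar> \<le> norm (sqrt (real n) *\<^sub>R (V n \<omega> - mat 1))"
          using component_le_norm_cart[of "(sqrt (real n) *\<^sub>R (V n \<omega> - mat 1)) $ i" j]
            Finite_Cartesian_Product.norm_nth_le[of "sqrt (real n) *\<^sub>R (V n \<omega> - mat 1)" i] by linarith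
        ultimately show ?thesis using VK[OF that] by linarith
      qed
      then have "\<forall>\<^sub>F p in event_filter G. \<bar>(V (fst p) (snd p) $ i $ j - (if i = j then 1 else 0)) / (1 / sqrt (real (fst p)))\<bar> \<le> K"
        unfolding eventually_event_filter by (intro always_eventually) simp
      then show ?thesis unfolding Bfun_real_iff by blast
    qed
    have w: "\<forall>\<^sub>F p in event_filter G. V (fst p) (snd p) ** covariance_matrix (empirical (fst p) (\<lambda>i. Z i (snd p))) ** transpose (V (fst p) (snd p)) = mat 1"
      unfolding eventually_event_filter by (intro always_eventually) (simp add: whiten)
    have mx: "\<forall>\<^sub>F p in event_filter G. is_arg_max (obj (fst p) (snd p)) orthogonal_matrix (U (fst p) (snd p))"
      unfolding eventually_event_filter by (intro always_eventually) (simp add: U_max space)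
    have nr: "\<forall>\<^sub>F p in event_filter G. \<forall>Q. is_arg_max (obj (fst p) (snd p)) orthogonal_matrix Q \<and> norm (Q - mat 1) \<le> 1/2
        \<longrightarrow> norm (U (fst p) (snd p) - mat 1) \<le> 1/2"
      unfolding eventually_event_filter by (intro always_eventually) (use U_near space in auto)
    note lin = solution_linearization[where N = fst and x = "\<lambda>p i. Z i (snd p)" and V = "\<lambda>p. V (fst p) (snd p)"
        and U = "\<lambda>p. U (fst p) (snd p)", OF filterlim_fst_event_filter m1 m2 m3 m4 V' w mx[unfolded obj_def] nr[unfolded obj_def] \<alpha> sep]
    have "((\<lambda>p. R (fst p) (snd p)) \<longlongrightarrow> 0) (event_filter G)"
    proof (rule vec_tendstoI)
      fix kl :: "'n \<times> 'n"
      obtain k l where kl: "kl = (k, l)" by (cases kl)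
      have "\<forall>\<^sub>F p in event_filter G. ((U (fst p) (snd p) ** V (fst p) (snd p)) $ k $ l - (if k = l then 1 else 0)) / (1 / sqrt (real (fst p)))
        - lin_part \<alpha> (gam F) (kap F) k l
        (\<lambda>i. raw1 (fst p) (\<lambda>i. Z i (snd p)) i / (1 / sqrt (real (fst p))))
        (\<lambda>i j. (raw2 (fst p) (\<lambda>i. Z i (snd p)) i j - mom2 i j) / (1 / sqrt (real (fst p))))
        (\<lambda>i j h. (raw3 (fst p) (\<lambda>i. Z i (snd p)) i j h - mom3 (gam F) i j h) / (1 / sqrt (real (fst p))))
        (\<lambda>i j h r. (raw4 (fst p) (\<lambda>i. Z i (snd p)) i j h r - mom4 (kap F) i j h r) / (1 / sqrt (real (fst p))))
        = R (fst p) (snd p) $ kl"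
        using pos
      proof eventually_elim
        case (elim p)
        \<comment> \<open>As \<open>lin_part\<close> is additive and homogeneous, the factor 1 /
          sqrt n and the sum over the sample can be pulled out of it; the linearization error is
          then exactly a coordinate of R.\<close>
        define n \<omega> where "n = fst p" and "\<omega> = snd p"
        have n: "n > 0" using elim by (simp add: n_def)
        have r1: "raw1 n (\<lambda>i. Z i \<omega>) i / (1 / sqrt (real n)) = (1 / sqrt (real n)) * (\<Sum>h<n. Z h \<omega> $ i)" for i
          using avg_deviation[OF n, of "\<lambda>h. Z h \<omega> $ i" 0] by (simp add: raw1_def)
        have r2: "(raw2 n (\<lambda>i. Z i \<omega>) i j - mom2 i j) / (1 / sqrt (real n)) = (1 / sqrt (real n)) * (\<Sum>h<n. Z h \<omega> $ i * Z h \<omega> $ j - mom2 i j)" for i j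
          unfolding raw2_def avg_deviation[OF n] by simp
        have r3: "(raw3 n (\<lambda>i. Z i \<omega>) i j r - mom3 (gam F) i j r) / (1 / sqrt (real n))
            = (1 / sqrt (real n)) * (\<Sum>h<n. Z h \<omega> $ i * (Z h \<omega> $ j * Z h \<omega> $ r) - mom3 (gam F) i j r)" for i j r
          unfolding raw3_def avg_deviation[OF n] by simp
        have r4: "(raw4 n (\<lambda>i. Z i \<omega>) i j r q - mom4 (kap F) i j r q) / (1 / sqrt (real n))
            = (1 / sqrt (real n)) * (\<Sum>h<n. Z h \<omega> $ i * (Z h \<omega> $ j * (Z h \<omega> $ r * Z h \<omega> $ q)) - mom4 (kap F) i j r q)" for i j r q
          unfolding raw4_def avg_deviation[OF n] by simp
        have "R n \<omega> $ kl = sqrt (real n) * (W n \<omega> $ k $ l - mat 1 $ k $ l) - (1 / sqrt (real n)) * (\<Sum>i<n. Y (Z i \<omega>) $ (k, l))"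
          by (simp add: R_def X_def vectorize_def kl)
        also have "sqrt (real n) * (W n \<omega> $ k $ l - mat 1 $ k $ l) = ((U n \<omega> ** V n \<omega>) $ k $ l - (if k = l then 1 else 0)) / (1 / sqrt (real n))"
          by (simp add: W_def mat_def)
        finally show ?case
          unfolding n_def[symmetric] \<omega>_def[symmetric] r1 r2 r3 r4 lin_part_scale lin_part_sum[OF finite_lessThan]
          by (simp add: Y_def influence_def)
      qed
      from tendsto_cong[OF this] lin(2)[of k l] show "((\<lambda>p. R (fst p) (snd p) $ kl) \<longlongrightarrow> 0 $ kl) (event_filter G)"
        by simp
    qed
    then show ?thesis using G lin(1) unfolding W_def by blast
  qed
  have W_conv: "converges_in_probability M W (mat 1)"
    by (rule converges_in_probabilityI_event_filter[OF M W_meas]) (use main in blast)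
  have R_conv: "converges_in_probability M R 0"
    by (rule converges_in_probabilityI_event_filter[OF M R_meas]) (use main in blast)
  note var = influence_variance[OF F fm6, where \<alpha> = \<alpha>, folded Y_def]
  note [measurable_cong] = Fp(2)
  have Y_sq: "integrable F (\<lambda>z. (Y z $ kl)\<^sup>2)" for kl
    using var(1) var(2) by (cases kl; cases "fst kl = snd kl") (auto simp: has_bochner_integral_iff)
  have Y_F: "Y \<in> borel_measurable F" by measurable
  obtain L :: "(real^('n \<times> 'n)) measure" where L: "prob_space L" "sets L = sets borel"
    and L_law: "\<And>t. distr L borel (\<lambda>x. t \<bullet> x) = centered_normal (sqrt (\<integral>z. (t \<bullet> Y z)\<^sup>2 \<partial>F))"
    using gaussian_exists[OF Y_F Y_sq] by metis
  have Basis_comp: "\<exists>kl. b = axis kl 1" if "b \<in> Basis" for b :: "real^('n \<times> 'n)"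
    using that by (auto simp: Basis_vec_def)
  have inner_axis': "x \<bullet> axis kl 1 = x $ kl" for x :: "real^('n \<times> 'n)" and kl
    by (simp add: inner_axis)
  have conv: "converges_in_distribution M X L"
  proof (rule multivariate_clt[OF M indep law Y_meas _ _ X_meas _ L L_law])
    fix b :: "real^('n \<times> 'n)" assume "b \<in> Basis"
    then obtain kl where b: "b = axis kl 1" using Basis_comp by blast
    show "integrable F (\<lambda>z. (Y z \<bullet> b)\<^sup>2)" unfolding b inner_axis' by (rule Y_sq)
    show "(\<integral>z. Y z \<bullet> b \<partial>F) = 0" unfolding b inner_axis'
      using influence_mean[OF F fm6, where \<alpha> = \<alpha> and kl = kl] by (simp add: Y_def has_bochner_integral_iff)
  next
    show "converges_in_probability M (\<lambda>n \<omega>. X n \<omega> - (1 / sqrt (real n)) *\<^sub>R (\<Sum>i<n. Y (Z i \<omega>))) 0"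
      using R_conv unfolding R_def .
  qed
  note [measurable_cong] = L(2)
  have comp_law: "distr L borel (\<lambda>x. x $ kl) = centered_normal (sqrt (\<integral>z. (Y z $ kl)\<^sup>2 \<partial>F))" for kl
    using L_law[of "axis kl 1"] by (simp add: inner_axis' inner_commute[of "axis kl 1"])
  have L_mean: "(\<integral>x. x $ kl \<partial>L) = 0" for kl
  proof -
    have "(\<integral>x. x $ kl \<partial>L) = (\<integral>y. y \<partial>distr L borel (\<lambda>x. x $ kl))"
      by (subst integral_distr) auto
    then show ?thesis by (simp add: comp_law centered_normal_moments)
  qed
  have L_var: "ASV L k l = (\<integral>z. (Y z $ (k, l))\<^sup>2 \<partial>F)" for k l
  proof -
    have "ASV L k l = (\<integral>y. y\<^sup>2 \<partial>distr L borel (\<lambda>x. x $ (k, l)))"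
      unfolding ASV_def L_mean by (subst integral_distr) auto
    also have "\<dots> = (sqrt (\<integral>z. (Y z $ (k, l))\<^sup>2 \<partial>F))\<^sup>2"
      unfolding comp_law by (rule centered_normal_moments)
    finally show ?thesis by simp
  qed
  have "multivariate_normal L"
    unfolding multivariate_normal_def using L L_law by (auto intro!: normal_law_centered_normal)
  then have "limiting_normal M W L"
    unfolding limiting_normal_def using L_mean conv by (simp add: X_def[abs_def])
  moreover have "ASV L k k = (kap F k + 2) / 4" for k
    unfolding L_var using var(1)[of k] by (simp add: has_bochner_integral_iff)
  moreover have "ASV L k l =
               (\<alpha>\<^sup>2 * (gam F k - gam F l)\<^sup>2 * zeta11 F k l
                + (1 - \<alpha>)\<^sup>2 * (kap F k - kap F l)\<^sup>2 * zeta22 F k l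
                + 2 * \<alpha> * (1 - \<alpha>) * (gam F k - gam F l) * (kap F k - kap F l) * zeta12 F k l)
               / (\<alpha> * (gam F k - gam F l)\<^sup>2 + (1 - \<alpha>) * (kap F k - kap F l)\<^sup>2)\<^sup>2" if "k \<noteq> l" for k l
    unfolding L_var using var(2)[OF that] by (simp only: has_bochner_integral_iff)
  ultimately show ?thesis using seq W_conv by blast
qed

theorem corollary5p1p2:
  fixes M :: "'w measure"
    and F :: "(real^'n) measure"
    and Z :: "nat \<Rightarrow> 'w \<Rightarrow> real^'n"
    and D :: "(real^'n) measure set"
    and \<Gamma> :: "(real^'n) measure \<Rightarrow> real^'n^'n"
    and V :: "nat \<Rightarrow> 'w \<Rightarrow> real^'n^'n"
  assumes F: "independent_standardized F"
    and M: "prob_space M"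
    and Z_indep: "prob_space.indep_vars M (\<lambda>_. borel) Z UNIV"
    and Z_law: "\<And>i. distr M borel (Z i) = F"
    and \<Gamma>: "ic_functional D \<Gamma>"
    and V: "sample_version M Z D \<Gamma> V"
    and V_root_n: "bounded_in_probability M (\<lambda>n \<omega>. sqrt (real n) *\<^sub>R (V n \<omega> - mat 1))"
  shows
    "(finite_moments 6 F \<and> inj (gam F) \<longrightarrow>
      (\<exists>W. compound_cumulant_sequence M Z V 1 W \<and> converges_in_probability M W (mat 1) \<and>
        (\<exists>L. limiting_normal M W L \<and>
          (\<forall>k. ASV L k k = (kap F k + 2) / 4) \<and>
          (\<forall>k l. k \<noteq> l \<longrightarrow> ASV L k l = zeta11 F k l / (gam F k - gam F l)\<^sup>2)))) \<and>
    (finite_moments 8 F \<and> inj (kap F) \<longrightarrow>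
      (\<exists>W. compound_cumulant_sequence M Z V 0 W \<and> converges_in_probability M W (mat 1) \<and>
        (\<exists>L. limiting_normal M W L \<and>
          (\<forall>k. ASV L k k = (kap F k + 2) / 4) \<and>
          (\<forall>k l. k \<noteq> l \<longrightarrow> ASV L k l = zeta22 F k l / (kap F k - kap F l)\<^sup>2)))) \<and>
    (\<forall>\<alpha>. 0 \<le> \<alpha> \<and> \<alpha> \<le> 1 \<and> finite_moments 8 F \<and>
        \<not> (\<exists>k l. k \<noteq> l \<and> gam F k = gam F l \<and> kap F k = kap F l) \<and>
        (\<forall>k l. k \<noteq> l \<longrightarrow> \<alpha> * (gam F k - gam F l)\<^sup>2 + (1 - \<alpha>) * (kap F k - kap F l)\<^sup>2 \<noteq> 0) \<longrightarrow>
      (\<exists>W. compound_cumulant_sequence M Z V \<alpha> W \<and> converges_in_probability M W (mat 1) \<and>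
        (\<exists>L. limiting_normal M W L \<and>
          (\<forall>k. ASV L k k = (kap F k + 2) / 4) \<and>
          (\<forall>k l. k \<noteq> l \<longrightarrow>
             ASV L k l =
               (\<alpha>\<^sup>2 * (gam F k - gam F l)\<^sup>2 * zeta11 F k l
                + (1 - \<alpha>)\<^sup>2 * (kap F k - kap F l)\<^sup>2 * zeta22 F k l
                + 2 * \<alpha> * (1 - \<alpha>) * (gam F k - gam F l) * (kap F k - kap F l) * zeta12 F k l)
               / (\<alpha> * (gam F k - gam F l)\<^sup>2 + (1 - \<alpha>) * (kap F k - kap F l)\<^sup>2)\<^sup>2))))"
proof (intro conjI impI allI, goal_cases)
  case 1
  then have fm: "finite_moments 6 F" and d: "\<And>k l. k \<noteq> l \<Longrightarrow> gam F k - gam F l \<noteq> 0"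
    by (auto simp: inj_eq)
  have "1 * (gam F k - gam F l)\<^sup>2 + (1 - 1) * (kap F k - kap F l)\<^sup>2 \<noteq> 0" if "k \<noteq> l" for k l
    using d[OF that] by simp
  from compound_cumulant_limit[OF F M Z_indep Z_law \<Gamma> V V_root_n, of 1, OF _ _ fm _ this]
  obtain W L where W: "compound_cumulant_sequence M Z V 1 W" "converges_in_probability M W (mat 1)"
    "limiting_normal M W L" "\<And>k. ASV L k k = (kap F k + 2) / 4"
    and off: "\<And>k l. k \<noteq> l \<Longrightarrow> ASV L k l = (gam F k - gam F l)\<^sup>2 * zeta11 F k l / ((gam F k - gam F l)\<^sup>2)\<^sup>2"
    by auto
  have "ASV L k l = zeta11 F k l / (gam F k - gam F l)\<^sup>2" if "k \<noteq> l" for k l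
    unfolding off[OF that] using d[OF that] by (simp add: power2_eq_square)
  then show ?case using W by blast
next
  case 2
  then have fm: "finite_moments 8 F" and d: "\<And>k l. k \<noteq> l \<Longrightarrow> kap F k - kap F l \<noteq> 0"
    by (auto simp: inj_eq)
  have fm6: "finite_moments 6 F" by (rule finite_moments_mono[OF independent_standardizedD(1,2)[OF F] fm]) simp
  have "0 * (gam F k - gam F l)\<^sup>2 + (1 - 0) * (kap F k - kap F l)\<^sup>2 \<noteq> 0" if "k \<noteq> l" for k l
    using d[OF that] by simp
  from compound_cumulant_limit[OF F M Z_indep Z_law \<Gamma> V V_root_n, of 0, OF _ _ fm6 fm this]
  obtain W L where W: "compound_cumulant_sequence M Z V 0 W" "converges_in_probability M W (mat 1)"
    "limiting_normal M W L" "\<And>k. ASV L k k = (kap F k + 2) / 4"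
    and off: "\<And>k l. k \<noteq> l \<Longrightarrow> ASV L k l = (kap F k - kap F l)\<^sup>2 * zeta22 F k l / ((kap F k - kap F l)\<^sup>2)\<^sup>2"
    by auto
  have "ASV L k l = zeta22 F k l / (kap F k - kap F l)\<^sup>2" if "k \<noteq> l" for k l
    unfolding off[OF that] using d[OF that] by (simp add: power2_eq_square)
  then show ?case using W by blast
next
  case (3 \<alpha>)
  then have \<alpha>: "0 \<le> \<alpha>" "\<alpha> \<le> 1" and fm: "finite_moments 8 F"
    and sep: "\<And>k l. k \<noteq> l \<Longrightarrow> \<alpha> * (gam F k - gam F l)\<^sup>2 + (1 - \<alpha>) * (kap F k - kap F l)\<^sup>2 \<noteq> 0"
    by blast+
  have fm6: "finite_moments 6 F" by (rule finite_moments_mono[OF independent_standardizedD(1,2)[OF F] fm]) simp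
  show ?case
    by (rule compound_cumulant_limit[OF F M Z_indep Z_law \<Gamma> V V_root_n \<alpha> fm6 fm sep])
qed

end
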